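(* Let $T\in(0,\infty)$, let $\mu,\sigma\colon\mathbb{R}\to\mathbb{R}$ be measurable functions and let $X\colon[0,T]\times\Omega\to\mathbb{R}$ be an adapted process with continuous paths such that $$X_t=X_0+\int_0^t\mu(X_s)\,ds+\int_0^t\sigma(X_s)\,dW_s,\qquad t\in[0,T].$$ Assume that there exist $t_0\in[0,T)$, $T_0\in(t_0,T]$, $\delta\in(0,\infty)$ and $\xi\in\mathbb{R}$ such that (reach) $\mathbb{P}(X_{t_0}\in B_\delta(\xi))>0$; (local reg) $\mu$ is bounded on $[\xi-\delta,\xi+\delta]$ and $\sigma$ is Lipschitz continuous on $[\xi-\delta,\xi+\delta]$; (non-deg* ) $\inf_{x\in B_\delta(\xi)}|\sigma(x)|>0$. Then there exists a constant $c\in(0,\infty)$ such that for all $n\in\mathbb{N}$, $$\inf_{\substack{t_1,\dots,t_n\in[0,T]\\ g\colon\mathbb{R}^n\to L^1([0,T])\text{ measurable}}}\mathbb{E}\bigl[\|X-g(W_{t_1},\dots,W_{t_n})\|_{L^1([0,T])}\bigr]\ge\frac{c}{n^{1/2}}.$$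
   Context: $(\Omega,\mathcal{F},(\mathcal{F}_t)_{t\ge0},\mathbb{P})$ is a filtered probability space satisfying the usual conditions and $W$ is a standard one-dimensional Brownian motion on it (with respect to the filtration). $B_\delta(\xi)$ is the open ball in $\mathbb{R}$ around $\xi$ with radius $\delta$. $L^1([0,T])$ is the space of measurable $f\colon[0,T]\to\mathbb{R}$ with $\|f\|_{L^1([0,T])}=\int_0^T|f(x)|\,dx<\infty$, with its Borel $\sigma$-algebra. *)

theory Defs
  imports "HOL-Probability.Probability"
begin

subsection \<open>Filtered probability spaces and Brownian motion\<close>

text \<open>Time is modelled by type real; only indices \<open>t \<ge> 0\<close> of \<open>F\<close> are constrained.
  The library locale \<open>filtration\<close> is not used because it would also constrain
  negative times. The \<open>\<sigma>\<close>-algebras \<open>\<F>\<^sub>t\<close> are given by \<open>sets (F t)\<close>; the measures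
  carried by the \<open>F t\<close> play no role.\<close>

locale usual_filtered_prob_space = prob_space M + complete_measure M
  for M :: "'a measure" +
  fixes F :: "real \<Rightarrow> 'a measure"
  assumes subalgebra_filtration: "0 \<le> t \<Longrightarrow> subalgebra M (F t)"
    and filtration_mono: "0 \<le> s \<Longrightarrow> s \<le> t \<Longrightarrow> sets (F s) \<subseteq> sets (F t)"
    and null_sets_filtration: "null_sets M \<subseteq> sets (F 0)"
    and filtration_right_continuous: "0 \<le> t \<Longrightarrow> sets (F t) = (\<Inter>u\<in>{t<..}. sets (F u))"

definition brownian_motion ::
  "'a measure \<Rightarrow> (real \<Rightarrow> 'a measure) \<Rightarrow> (real \<Rightarrow> 'a \<Rightarrow> real) \<Rightarrow> bool" where
  "brownian_motion M F W \<longleftrightarrow>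
     (\<forall>t\<ge>0. W t \<in> borel_measurable (F t)) \<and>
     (\<forall>\<omega>\<in>space M. continuous_on {0..} (\<lambda>t. W t \<omega>)) \<and>
     (AE \<omega> in M. W 0 \<omega> = 0) \<and>
     (\<forall>s t. 0 \<le> s \<and> s < t \<longrightarrow>
        distributed M lborel (\<lambda>\<omega>. W t \<omega> - W s \<omega>) (normal_density 0 (sqrt (t - s))) \<and>
        prob_space.indep_set M (sets (F s))
          (sets (vimage_algebra (space M) (\<lambda>\<omega>. W t \<omega> - W s \<omega>) borel)))"

definition continuous_adapted ::
  "'a measure \<Rightarrow> (real \<Rightarrow> 'a measure) \<Rightarrow> real \<Rightarrow> (real \<Rightarrow> 'a \<Rightarrow> real) \<Rightarrow> bool" where
  "continuous_adapted M F T X \<longleftrightarrow>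
     (\<forall>t\<in>{0..T}. X t \<in> borel_measurable (F t)) \<and>
     (\<forall>\<omega>\<in>space M. continuous_on {0..T} (\<lambda>t. X t \<omega>))"

subsection \<open>The Ito integral\<close>

text \<open>A simple integrand \<open>\<Sum>i<m. \<phi>\<^sub>i 1\<^bsub>(s\<^sub>i, s\<^sub>i\<^sub>+\<^sub>1]\<^esub>\<close> on \<open>[0,T]\<close> is encoded by
  the triple \<open>(m, s, \<phi>)\<close>.\<close>

type_synonym 'a simple_integrand = "nat \<times> (nat \<Rightarrow> real) \<times> (nat \<Rightarrow> 'a \<Rightarrow> real)"

definition simple_integrands ::
  "'a measure \<Rightarrow> (real \<Rightarrow> 'a measure) \<Rightarrow> real \<Rightarrow> 'a simple_integrand set" where
  "simple_integrands M F T =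
     {(m, s, \<phi>). s 0 \<ge> 0 \<and> (\<forall>i<m. s i \<le> s (Suc i)) \<and> s m \<le> T \<and>
        (\<forall>i<m. \<phi> i \<in> borel_measurable (F (s i)) \<and> bounded (\<phi> i ` space M))}"

fun simple_process :: "'a simple_integrand \<Rightarrow> real \<Rightarrow> 'a \<Rightarrow> real" where
  "simple_process (m, s, \<phi>) t \<omega> = (\<Sum>i<m. \<phi> i \<omega> * indicator {s i<..s (Suc i)} t)"

fun simple_integral ::
  "(real \<Rightarrow> 'a \<Rightarrow> real) \<Rightarrow> 'a simple_integrand \<Rightarrow> real \<Rightarrow> 'a \<Rightarrow> real" where
  "simple_integral W (m, s, \<phi>) t \<omega> =
     (\<Sum>i<m. \<phi> i \<omega> * (W (min t (s (Suc i))) \<omega> - W (min t (s i)) \<omega>))"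

definition progressively_measurable ::
  "(real \<Rightarrow> 'a measure) \<Rightarrow> real \<Rightarrow> (real \<Rightarrow> 'a \<Rightarrow> real) \<Rightarrow> bool" where
  "progressively_measurable F T H \<longleftrightarrow>
     (\<forall>t\<in>{0..T}. (\<lambda>(s, \<omega>). H s \<omega>) \<in> borel_measurable (restrict_space borel {0..t} \<Otimes>\<^sub>M F t))"

text \<open>Only meaningful if all \<open>Y n\<close> are measurable.\<close>

definition tendsto_zero_in_prob :: "'a measure \<Rightarrow> (nat \<Rightarrow> 'a \<Rightarrow> ennreal) \<Rightarrow> bool" where
  "tendsto_zero_in_prob M Y \<longleftrightarrow>
     (\<forall>\<epsilon>>0. (\<lambda>n. measure M {\<omega>\<in>space M. ennreal \<epsilon> < Y n \<omega>}) \<longlonglongrightarrow> 0)"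

text \<open>\<open>I = (\<integral>\<^sub>0\<^sup>t H\<^sub>s dW\<^sub>s)\<^bsub>t\<in>[0,T]\<^esub>\<close> for progressively measurable \<open>H\<close> with
  \<open>\<integral>\<^sub>0\<^sup>T H\<^sub>s\<^sup>2 ds < \<infinity>\<close> a.s. The integral is only determined up to
  indistinguishability, so it is a relation between the integrand and the integral process:
  \<open>I\<close> is the limit, uniformly on \<open>[0,T]\<close> in probability, of the integrals of simple integrands
  \<open>K n\<close> that approximate \<open>H\<close>. The random variables below whose convergence in probability is
  required are measurable, by progressive measurability of \<open>H\<close> and path continuity of
  \<open>I\<close> and \<open>W\<close>.\<close>

definition is_ito_integral ::
  "'a measure \<Rightarrow> (real \<Rightarrow> 'a measure) \<Rightarrow> (real \<Rightarrow> 'a \<Rightarrow> real) \<Rightarrow> real \<Rightarrow>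
    (real \<Rightarrow> 'a \<Rightarrow> real) \<Rightarrow> (real \<Rightarrow> 'a \<Rightarrow> real) \<Rightarrow> bool" where
  "is_ito_integral M F W T H I \<longleftrightarrow>
     progressively_measurable F T H \<and>
     (AE \<omega> in M. set_integrable lborel {0..T} (\<lambda>s. (H s \<omega>)\<^sup>2)) \<and>
     continuous_adapted M F T I \<and>
     (\<exists>K. (\<forall>n. K n \<in> simple_integrands M F T) \<and>
        tendsto_zero_in_prob M
          (\<lambda>n \<omega>. \<integral>\<^sup>+ s\<in>{0..T}. ennreal ((simple_process (K n) s \<omega> - H s \<omega>)\<^sup>2) \<partial>lborel) \<and>
        tendsto_zero_in_prob M
          (\<lambda>n \<omega>. SUP t\<in>{0..T}. ennreal \<bar>simple_integral W (K n) t \<omega> - I t \<omega>\<bar>))"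

definition sde_solution ::
  "'a measure \<Rightarrow> (real \<Rightarrow> 'a measure) \<Rightarrow> (real \<Rightarrow> 'a \<Rightarrow> real) \<Rightarrow> real \<Rightarrow>
    (real \<Rightarrow> real) \<Rightarrow> (real \<Rightarrow> real) \<Rightarrow> (real \<Rightarrow> 'a \<Rightarrow> real) \<Rightarrow> bool" where
  "sde_solution M F W T \<mu> \<sigma> X \<longleftrightarrow>
     continuous_adapted M F T X \<and>
     (AE \<omega> in M. set_integrable lborel {0..T} (\<lambda>s. \<mu> (X s \<omega>))) \<and>
     (\<exists>I. is_ito_integral M F W T (\<lambda>s \<omega>. \<sigma> (X s \<omega>)) I \<and>
        (\<forall>t\<in>{0..T}. AE \<omega> in M.
           X t \<omega> = X 0 \<omega> + (LINT s:{0..t}|lborel. \<mu> (X s \<omega>)) + I t \<omega>))"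

subsection \<open>The space \<open>L\<^sup>1([0,T])\<close>\<close>

text \<open>Elements are functions rather than equivalence classes, so \<open>L1_norm T\<close> is a seminorm and
  \<open>L1_open T\<close> the induced (non-Hausdorff) topology. Values outside \<open>[0,T]\<close> are irrelevant.
  Since open sets are saturated with respect to equality almost everywhere, a map into \<open>L1_borel T\<close>
  is measurable iff the induced map into the quotient space is Borel measurable.\<close>

definition L1_space :: "real \<Rightarrow> (real \<Rightarrow> real) set" where
  "L1_space T = {f. set_integrable lborel {0..T} f}"

definition L1_norm :: "real \<Rightarrow> (real \<Rightarrow> real) \<Rightarrow> real" where
  "L1_norm T f = (LINT x:{0..T}|lborel. \<bar>f x\<bar>)"

definition L1_open :: "real \<Rightarrow> (real \<Rightarrow> real) set \<Rightarrow> bool" where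
  "L1_open T U \<longleftrightarrow> U \<subseteq> L1_space T \<and>
     (\<forall>f\<in>U. \<exists>e>0. \<forall>h\<in>L1_space T. L1_norm T (\<lambda>x. h x - f x) < e \<longrightarrow> h \<in> U)"

definition L1_borel :: "real \<Rightarrow> (real \<Rightarrow> real) measure" where
  "L1_borel T = sigma (L1_space T) {U. L1_open T U}"

end

theory Submission
  imports Defs
begin

text \<open>
  Among \<open>2 * n\<close> consecutive cells to the right of \<open>t\<^sub>0\<close>, at least \<open>n\<close> contain none of the observation
  times. On such a cell, with midpoint \<open>m\<close> and endpoints \<open>a < b\<close>, exchanging the increments
  \<open>U = W m - W a\<close> and \<open>V = W b - W m\<close> preserves the joint law and alters neither the observations nor
  anything known at time \<open>a\<close>.
  Hence an antisymmetric function of \<open>(U, V)\<close>, possibly weighted by a random variable known at time \<open>a\<close>,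
  is orthogonal to every bounded function of the observations and of the past
  (\<open>antisymmetric_orthogonal_to_observations\<close>). Just after \<open>m\<close>, however, the solution differs from \<open>X a\<close> by
  approximately \<open>\<sigma> (X t\<^sub>0) * U\<close>, and \<open>U\<close> is correlated with a suitable antisymmetric function at the order
  of its standard deviation, the square root of the cell length. By duality no function of the
  observations gets closer to \<open>X\<close> than that order on average (\<open>interval_lower_bound\<close>). Summing cells of
  length of order \<open>1 / n\<close>, with an error of order \<open>n powr (- 1/2)\<close> on at least half of them, gives the rate
  (\<open>L1_lower_bound\<close>).

  The coefficients are controlled only near \<open>\<xi>\<close>, and the path may leave this region at any time. The test
  therefore applies a clamp to the increment of \<open>X\<close>, at a level proportional to the square root of the cell
  length. The clamp is a contraction, it removes all integrability questions, and a path outside the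
  region costs no more than twice the level. It is then enough that the paths reaching the ball at \<open>t\<^sub>0\<close> stay close
  to \<open>X t\<^sub>0\<close> with large probability on a short interval, which is mere continuity
  (\<open>small_oscillation_event\<close>). On this event the linearisation needs an estimate of the stochastic integral
  of \<open>\<sigma> (X s) - \<sigma> (X t\<^sub>0)\<close> by the supremum of the integrand on that event only
  (\<open>ito_integral_frozen_integrand_bound\<close>). It follows from the isometry for simple integrands, stopped when
  their energy becomes too large.

  Point evaluations are not defined on \<open>L\<^sup>1\<close>. Solution and approximation are therefore compared through
  their integrals over short windows to the right of the midpoints, which are continuous functionals on
  \<open>L\<^sup>1\<close>; the window is a small fraction of the cell, so that the average of \<open>X\<close> over it still behaves like
  \<open>X m\<close>.
\<close>

section \<open>Orthogonality to a \<open>\<sigma>\<close>-algebra\<close>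

text \<open>The conditional expectation of \<open>Z\<close> given \<open>G\<close> vanishes. Integrating against indicators of
  members of \<open>G\<close> is the form that Fubini arguments deliver.\<close>
definition orthogonal_to :: "'a measure \<Rightarrow> 'a measure \<Rightarrow> ('a \<Rightarrow> real) \<Rightarrow> bool" where
  "orthogonal_to M G Z \<longleftrightarrow> (\<forall>Q\<in>sets G. (\<integral>\<omega>. indicator Q \<omega> * Z \<omega> \<partial>M) = 0)"

text \<open>The \<open>\<sigma>\<close>-algebra generated by \<open>G\<close> and \<open>D\<close>. Written as a pullback, each of its members is
  \<open>{\<omega>. (\<omega>, D \<omega>) \<in> S}\<close> with \<open>S\<close> in a product \<open>\<sigma>\<close>-algebra, so \<open>D\<close> can be integrated out when it is
  independent of \<open>G\<close>.\<close>
definition adjoin :: "'a measure \<Rightarrow> ('a \<Rightarrow> real) \<Rightarrow> 'a measure" where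
  "adjoin G D = vimage_algebra (space G) (\<lambda>\<omega>. (\<omega>, D \<omega>)) (G \<Otimes>\<^sub>M borel)"

lemma space_adjoin [simp]: "space (adjoin G D) = space G"
  by (simp add: adjoin_def)

lemma pair_measurable_adjoin: "(\<lambda>\<omega>. (\<omega>, D \<omega>)) \<in> adjoin G D \<rightarrow>\<^sub>M G \<Otimes>\<^sub>M borel"
  unfolding adjoin_def by (rule measurable_vimage_algebra1) (auto simp: space_pair_measure)

lemma adjoined_measurable: "D \<in> borel_measurable (adjoin G D)"
  using measurable_compose[OF pair_measurable_adjoin measurable_snd] by simp

lemma id_measurable_adjoin: "(\<lambda>\<omega>. \<omega>) \<in> adjoin G D \<rightarrow>\<^sub>M G"
  using measurable_compose[OF pair_measurable_adjoin measurable_fst] by simp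

lemma sets_le_adjoin: "sets G \<subseteq> sets (adjoin G D)"
proof
  fix A assume A: "A \<in> sets G"
  from measurable_sets[OF id_measurable_adjoin A] sets.sets_into_space[OF A]
  show "A \<in> sets (adjoin G D)" by (simp add: vimage_def Int_absorb2 Collect_conj_eq Int_commute)
qed

lemma measurable_coarser:
  assumes "f \<in> G \<rightarrow>\<^sub>M N" "space G = space H" "sets G \<subseteq> sets H"
  shows "f \<in> H \<rightarrow>\<^sub>M N"
  by (rule measurable_from_subalg[OF _ assms(1)]) (use assms in \<open>simp add: subalgebra_def\<close>)

lemma sets_adjoin_le:
  assumes "space G = space H" "sets G \<subseteq> sets H" "D \<in> borel_measurable H"
  shows "sets (adjoin G D) \<subseteq> sets H"
proof -
  have "(\<lambda>\<omega>. \<omega>) \<in> H \<rightarrow>\<^sub>M G"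
    by (rule measurable_coarser[OF measurable_ident_sets[OF refl] assms(1,2)])
  then have pr: "(\<lambda>\<omega>. (\<omega>, D \<omega>)) \<in> H \<rightarrow>\<^sub>M G \<Otimes>\<^sub>M borel"
    using assms(3) by simp
  show ?thesis
  proof
    fix Q assume "Q \<in> sets (adjoin G D)"
    then obtain S where S: "S \<in> sets (G \<Otimes>\<^sub>M borel)" "Q = (\<lambda>\<omega>. (\<omega>, D \<omega>)) -` S \<inter> space G"
      unfolding adjoin_def by (subst (asm) sets_vimage_algebra2) (auto simp: space_pair_measure)
    then show "Q \<in> sets H" using measurable_sets[OF pr S(1)] assms(1) by simp
  qed
qed

lemma adjoin_setE:
  assumes "Q \<in> sets (adjoin G D)"
  obtains S where "S \<in> sets (G \<Otimes>\<^sub>M borel)" "\<And>\<omega>. \<omega> \<in> space G \<Longrightarrow> \<omega> \<in> Q \<longleftrightarrow> (\<omega>, D \<omega>) \<in> S"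
  using assms unfolding adjoin_def
  by (subst (asm) sets_vimage_algebra2) (auto simp: space_pair_measure)

text \<open>Orthogonality passes from indicators to bounded observables because the conditional expectation
  of \<open>Z\<close> given \<open>G\<close> is almost surely zero.\<close>
lemma (in prob_space) integral_mult_eq_0_if_orthogonal:
  assumes sub: "subalgebra M G" and orth: "orthogonal_to M G Z"
    and Z: "integrable M Z"
    and Y: "Y \<in> borel_measurable G" and B: "\<And>\<omega>. \<bar>Y \<omega>\<bar> \<le> B"
  shows "(\<integral>\<omega>. Y \<omega> * Z \<omega> \<partial>M) = 0"
proof -
  interpret G: finite_measure_subalgebra M G
    by (rule finite_measure_subalgebra.intro[OF finite_measure_axioms])
       (simp add: finite_measure_subalgebra_axioms_def sub)
  have YM: "Y \<in> borel_measurable M" by (rule measurable_from_subalg[OF sub Y])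
  have int: "integrable M (\<lambda>\<omega>. Y \<omega> * Z \<omega>)"
    by (rule Bochner_Integration.integrable_bound[OF integrable_mult_right[OF Z, of B]])
       (use YM Z B in \<open>auto simp: abs_mult intro!: mult_mono order_trans[OF B abs_ge_self]\<close>)
  have "AE \<omega> in M. real_cond_exp M G Z \<omega> = 0"
  proof (rule G.real_cond_exp_charact[OF _ Z])
    fix A assume "A \<in> sets G"
    then show "set_lebesgue_integral M A Z = set_lebesgue_integral M A (\<lambda>_. 0)"
      using orth by (simp add: orthogonal_to_def set_lebesgue_integral_def)
  qed auto
  then have "(\<integral>\<omega>. Y \<omega> * real_cond_exp M G Z \<omega> \<partial>M) = 0"
    using YM by (subst integral_cong_AE[of _ _ "\<lambda>_. 0"]) auto
  then show ?thesis
    using G.real_cond_exp_intg(2)[OF int Y] Z by simp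
qed

section \<open>Brownian increments and unobserved cells\<close>

locale brownian_filtration = usual_filtered_prob_space M F
  for M :: "'a measure" and F :: "real \<Rightarrow> 'a measure" +
  fixes W :: "real \<Rightarrow> 'a \<Rightarrow> real"
  assumes bm: "brownian_motion M F W"
begin

abbreviation gauss :: "real \<Rightarrow> real measure" where
  "gauss h \<equiv> density lborel (\<lambda>x. ennreal (normal_density 0 (sqrt h) x))"

lemma space_F: "0 \<le> t \<Longrightarrow> space (F t) = space M"
  using subalgebra_filtration by (auto simp: subalgebra_def)

lemma sets_F: "0 \<le> t \<Longrightarrow> sets (F t) \<subseteq> sets M"
  using subalgebra_filtration by (auto simp: subalgebra_def)

lemma F_measurable_M: "0 \<le> t \<Longrightarrow> f \<in> F t \<rightarrow>\<^sub>M N \<Longrightarrow> f \<in> M \<rightarrow>\<^sub>M N"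
  using subalgebra_filtration measurable_from_subalg by blast

lemma F_measurable_mono:
  assumes "0 \<le> s" "s \<le> t" "f \<in> F s \<rightarrow>\<^sub>M N"
  shows "f \<in> F t \<rightarrow>\<^sub>M N"
proof (rule measurable_coarser[OF assms(3)])
  show "space (F s) = space (F t)"
    using space_F[OF assms(1)] space_F[OF order_trans[OF assms(1,2)]] by simp
  show "sets (F s) \<subseteq> sets (F t)" by (rule filtration_mono[OF assms(1,2)])
qed

lemma W_measurable_F: "0 \<le> s \<Longrightarrow> s \<le> t \<Longrightarrow> W s \<in> borel_measurable (F t)"
  by (rule F_measurable_mono[of s]) (use bm in \<open>auto simp: brownian_motion_def\<close>)

lemma W_measurable [measurable]: "0 \<le> s \<Longrightarrow> W s \<in> borel_measurable M"
  using W_measurable_F F_measurable_M by blast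

lemma id_measurable_F: "0 \<le> s \<Longrightarrow> (\<lambda>\<omega>. \<omega>) \<in> M \<rightarrow>\<^sub>M F s"
  by (rule F_measurable_M[OF _ measurable_ident_sets[OF refl]])

lemma increment_distr:
  assumes "0 \<le> s" "s < t"
  shows "distr M borel (\<lambda>\<omega>. W t \<omega> - W s \<omega>) = gauss (t - s)"
proof -
  have "distributed M lborel (\<lambda>\<omega>. W t \<omega> - W s \<omega>) (normal_density 0 (sqrt (t - s)))"
    using bm assms unfolding brownian_motion_def by blast
  from distributed_distr_eq_density[OF this] show ?thesis
    by (metis (mono_tags, lifting) distr_cong sets_lborel)
qed

lemma prob_space_gauss: "0 < h \<Longrightarrow> prob_space (gauss h)"
  by (simp add: prob_space_normal_density)

lemma increment_indep:
  assumes "0 \<le> s" "s < t" "A \<in> sets (F s)" "B \<in> sets borel"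
  shows "prob (A \<inter> ((\<lambda>\<omega>. W t \<omega> - W s \<omega>) -` B \<inter> space M)) = prob A * prob ((\<lambda>\<omega>. W t \<omega> - W s \<omega>) -` B \<inter> space M)"
proof -
  have "indep_set (sets (F s)) (sets (vimage_algebra (space M) (\<lambda>\<omega>. W t \<omega> - W s \<omega>) borel))"
    using bm assms unfolding brownian_motion_def by blast
  from indep_setD[OF this assms(3) in_vimage_algebra[OF assms(4)]] show ?thesis .
qed

text \<open>The sample point itself serves as the random element that carries all information of \<open>F s\<close>.
  This avoids listing the finitely many values of \<open>W\<close> that a given observable uses.\<close>
lemma joint_law:
  assumes st: "0 \<le> s" "s < t"
  shows "distr M (F s \<Otimes>\<^sub>M borel) (\<lambda>\<omega>. (\<omega>, W t \<omega> - W s \<omega>)) = distr M (F s) (\<lambda>\<omega>. \<omega>) \<Otimes>\<^sub>M gauss (t - s)"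
proof -
  have [measurable]: "(\<lambda>\<omega>. \<omega>) \<in> M \<rightarrow>\<^sub>M F s" by (rule id_measurable_F[OF st(1)])
  have [measurable]: "W t \<in> borel_measurable M" "W s \<in> borel_measurable M" using st by auto
  interpret D: prob_space "distr M (F s) (\<lambda>\<omega>. \<omega>)" by (rule prob_space_distr) simp
  interpret g: prob_space "gauss (t - s)" using st by (intro prob_space_gauss) simp
  show ?thesis
  proof (rule pair_measure_eqI[symmetric])
    fix A B assume "A \<in> sets (distr M (F s) (\<lambda>\<omega>. \<omega>))" "B \<in> sets (gauss (t - s))"
    then have AB: "A \<in> sets (F s)" "B \<in> sets borel" by auto
    have A: "A \<subseteq> space M" using sets.sets_into_space[OF AB(1)] space_F[OF st(1)] by simp
    have "emeasure (distr M (F s \<Otimes>\<^sub>M borel) (\<lambda>\<omega>. (\<omega>, W t \<omega> - W s \<omega>))) (A \<times> B)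
      = emeasure M (A \<inter> ((\<lambda>\<omega>. W t \<omega> - W s \<omega>) -` B \<inter> space M))"
      using AB A by (subst emeasure_distr) (auto intro!: arg_cong[where f="emeasure M"])
    also have "\<dots> = emeasure M A * emeasure M ((\<lambda>\<omega>. W t \<omega> - W s \<omega>) -` B \<inter> space M)"
      using increment_indep[OF st AB] by (simp add: emeasure_eq_measure ennreal_mult)
    also have "emeasure M A = emeasure (distr M (F s) (\<lambda>\<omega>. \<omega>)) A"
      using AB A by (subst emeasure_distr) (auto simp: vimage_def Int_absorb2)
    also have "emeasure M ((\<lambda>\<omega>. W t \<omega> - W s \<omega>) -` B \<inter> space M) = emeasure (gauss (t - s)) B"
      unfolding increment_distr[OF st, symmetric] using AB by (subst emeasure_distr) auto
    finally show "emeasure (distr M (F s) (\<lambda>\<omega>. \<omega>)) A * emeasure (gauss (t - s)) B =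
      emeasure (distr M (F s \<Otimes>\<^sub>M borel) (\<lambda>\<omega>. (\<omega>, W t \<omega> - W s \<omega>))) (A \<times> B)" by simp
  qed (auto cong: sets_pair_measure_cong intro: D.sigma_finite_measure_axioms g.sigma_finite_measure_axioms)
qed

lemma expectation_joint:
  fixes f :: "'a \<times> real \<Rightarrow> real"
  assumes st: "0 \<le> s" "s < t" and f: "f \<in> borel_measurable (F s \<Otimes>\<^sub>M borel)" and B: "\<And>p. \<bar>f p\<bar> \<le> B"
  shows "(\<integral>\<omega>. f (\<omega>, W t \<omega> - W s \<omega>) \<partial>M) = (\<integral>x. (\<integral>\<omega>. f (\<omega>, x) \<partial>M) \<partial>gauss (t - s))"
proof -
  have [measurable]: "(\<lambda>\<omega>. \<omega>) \<in> M \<rightarrow>\<^sub>M F s" by (rule id_measurable_F[OF st(1)])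
  have [measurable]: "W t \<in> borel_measurable M" "W s \<in> borel_measurable M" using st by auto
  let ?D = "distr M (F s) (\<lambda>\<omega>. \<omega>)"
  interpret D: prob_space ?D by (rule prob_space_distr) simp
  interpret g: prob_space "gauss (t - s)" using st by (intro prob_space_gauss) simp
  interpret P: pair_prob_space ?D "gauss (t - s)" ..
  have fm: "f \<in> borel_measurable (?D \<Otimes>\<^sub>M gauss (t - s))"
    using f by (simp cong: measurable_cong_sets sets_pair_measure_cong)
  have int: "integrable (?D \<Otimes>\<^sub>M gauss (t - s)) (\<lambda>(x, y). f (x, y))"
    using fm B by (intro P.integrable_const_bound[of _ B]) auto
  have "(\<integral>\<omega>. f (\<omega>, W t \<omega> - W s \<omega>) \<partial>M) = integral\<^sup>L (distr M (F s \<Otimes>\<^sub>M borel) (\<lambda>\<omega>. (\<omega>, W t \<omega> - W s \<omega>))) f"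
    using f by (subst integral_distr) auto
  also have "\<dots> = (\<integral>x. (\<integral>\<omega>. f (\<omega>, x) \<partial>?D) \<partial>gauss (t - s))"
    unfolding joint_law[OF st] using P.integral_snd[OF int] by simp
  also have "\<dots> = (\<integral>x. (\<integral>\<omega>. f (\<omega>, x) \<partial>M) \<partial>gauss (t - s))"
    by (intro Bochner_Integration.integral_cong refl integral_distr) (use f in measurable)
  finally show ?thesis .
qed

lemma expectation_mult_increment:
  assumes st: "0 \<le> s" "s < t" and Y: "Y \<in> borel_measurable (F s)" "integrable M Y"
    and h: "(h :: real \<Rightarrow> real) \<in> borel_measurable borel" "integrable M (\<lambda>\<omega>. h (W t \<omega> - W s \<omega>))"
  shows "integrable M (\<lambda>\<omega>. Y \<omega> * h (W t \<omega> - W s \<omega>))"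
    and "(\<integral>\<omega>. Y \<omega> * h (W t \<omega> - W s \<omega>) \<partial>M) = (\<integral>\<omega>. Y \<omega> \<partial>M) * (\<integral>\<omega>. h (W t \<omega> - W s \<omega>) \<partial>M)"
proof -
  have iv: "indep_var borel Y borel (\<lambda>\<omega>. h (W t \<omega> - W s \<omega>))"
    unfolding indep_var_eq
  proof safe
    show "random_variable borel Y" "random_variable borel (\<lambda>\<omega>. h (W t \<omega> - W s \<omega>))"
      using Y(2) h(2) by auto
    have 1: "indep_set (sets (F s)) (sets (vimage_algebra (space M) (\<lambda>\<omega>. W t \<omega> - W s \<omega>) borel))"
      using bm st unfolding brownian_motion_def by blast
    have 2: "sigma_sets (space M) {Y -` A \<inter> space M |A. A \<in> sets borel} \<subseteq> sets (F s)"
      using measurable_sets[OF Y(1)] space_F[OF st(1)] sets.top[of "F s"] by (intro sets.sigma_sets_subset') auto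
    have 3: "sigma_sets (space M) {(\<lambda>\<omega>. h (W t \<omega> - W s \<omega>)) -` A \<inter> space M |A. A \<in> sets borel}
      \<subseteq> sets (vimage_algebra (space M) (\<lambda>\<omega>. W t \<omega> - W s \<omega>) borel)"
    proof (intro sets.sigma_sets_subset' subsetI, clarify)
      fix A :: "real set" assume "A \<in> sets borel"
      then have "h -` A \<in> sets borel" using measurable_sets[OF h(1)] by auto
      from in_vimage_algebra[OF this, of "\<lambda>\<omega>. W t \<omega> - W s \<omega>" "space M"]
      show "(\<lambda>\<omega>. h (W t \<omega> - W s \<omega>)) -` A \<inter> space M \<in> sets (vimage_algebra (space M) (\<lambda>\<omega>. W t \<omega> - W s \<omega>) borel)"
        by (simp add: vimage_def)
    qed (use sets.top[of "vimage_algebra (space M) (\<lambda>\<omega>. W t \<omega> - W s \<omega>) borel"] in simp)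
    show "indep_set (sigma_sets (space M) {Y -` A \<inter> space M |A. A \<in> sets borel})
      (sigma_sets (space M) {(\<lambda>\<omega>. h (W t \<omega> - W s \<omega>)) -` A \<inter> space M |A. A \<in> sets borel})"
      using 1 unfolding indep_set_def
      by (rule indep_sets_mono_sets) (use 2 3 in \<open>auto split: bool.split\<close>)
  qed
  show "integrable M (\<lambda>\<omega>. Y \<omega> * h (W t \<omega> - W s \<omega>))"
    by (rule indep_var_integrable[OF iv Y(2) h(2)])
  show "(\<integral>\<omega>. Y \<omega> * h (W t \<omega> - W s \<omega>) \<partial>M) = (\<integral>\<omega>. Y \<omega> \<partial>M) * (\<integral>\<omega>. h (W t \<omega> - W s \<omega>) \<partial>M)"
    by (rule indep_var_lebesgue_integral[OF iv Y(2) h(2)])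
qed

lemma increment_moments:
  assumes st: "0 \<le> s" "s \<le> t"
  shows "integrable M (\<lambda>\<omega>. W t \<omega> - W s \<omega>) \<and> (\<integral>\<omega>. W t \<omega> - W s \<omega> \<partial>M) = 0 \<and>
    integrable M (\<lambda>\<omega>. (W t \<omega> - W s \<omega>)\<^sup>2) \<and> (\<integral>\<omega>. (W t \<omega> - W s \<omega>)\<^sup>2 \<partial>M) = t - s"
proof (cases "s = t")
  case False
  then have lt: "s < t" using st by simp
  have D: "distributed M lborel (\<lambda>\<omega>. W t \<omega> - W s \<omega>) (normal_density 0 (sqrt (t - s)))"
    using bm st lt unfolding brownian_motion_def by blast
  have pos: "0 < sqrt (t - s)" using lt by simp
  have 1: "integrable M (\<lambda>\<omega>. W t \<omega> - W s \<omega>)"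
    using distributed_integrable[OF D, of "\<lambda>x. x"] integrable_normal_moment_nz_1[OF pos] by auto
  have 2: "integrable M (\<lambda>\<omega>. (W t \<omega> - W s \<omega>)\<^sup>2)"
    using distributed_integrable[OF D, of "\<lambda>x. x^2"] integrable_normal_moment[OF pos, of 0 2] by auto
  have 3: "(\<integral>\<omega>. W t \<omega> - W s \<omega> \<partial>M) = 0" by (rule normal_distributed_expectation[OF pos D])
  have 4: "(\<integral>\<omega>. (W t \<omega> - W s \<omega>)\<^sup>2 \<partial>M) = t - s"
    using normal_distributed_variance[OF pos D] lt by (simp only: 3) simp
  from 1 2 3 4 show ?thesis by blast
qed simp

text \<open>The probability that a Brownian increment exceeds its standard deviation.\<close>
definition tail :: real where "tail = measure (density lborel std_normal_density) {1..}"

lemma tail_pos: "0 < tail"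
proof -
  interpret N: prob_space "density lborel std_normal_density"
    by (rule prob_space_normal_density) simp
  have "emeasure (density lborel std_normal_density) {1..} \<noteq> 0"
  proof
    assume "emeasure (density lborel std_normal_density) {1..} = 0"
    then have "(\<integral>\<^sup>+x. ennreal (std_normal_density x) * indicator {1..} x \<partial>lborel) = 0"
      by (subst (asm) emeasure_density) auto
    then have "AE x in lborel. ennreal (std_normal_density x) * indicator {1..} x = 0"
      by (subst (asm) nn_integral_0_iff_AE) auto
    then have "AE x in lborel. x \<notin> {1..2::real}"
    proof eventually_elim
      case (elim x)
      have "0 < std_normal_density x" by (rule normal_density_pos) simp
      with elim show ?case by (auto simp: indicator_def)
    qed
    then have "emeasure lborel {1..2::real} = 0"
      by (subst (asm) AE_iff_measurable[of "{1..2}"]) auto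
    then show False by simp
  qed
  then show ?thesis unfolding tail_def N.emeasure_eq_measure by (simp add: zero_less_measure_iff N.emeasure_eq_measure)
qed

lemma increment_tail:
  assumes st: "0 \<le> s" "s < t"
  shows "prob {\<omega>\<in>space M. W t \<omega> - W s \<omega> \<ge> sqrt (t - s)} = tail"
    and "prob {\<omega>\<in>space M. W t \<omega> - W s \<omega> \<le> - sqrt (t - s)} = tail"
proof -
  have D: "distributed M lborel (\<lambda>\<omega>. W t \<omega> - W s \<omega>) (normal_density 0 (sqrt (t - s)))"
    using bm st unfolding brownian_motion_def by blast
  have pos: "0 < sqrt (t - s)" using st by simp
  have *: "prob {\<omega>\<in>space M. \<alpha> * (W t \<omega> - W s \<omega>) \<ge> sqrt (t - s)} = tail" if a: "\<bar>\<alpha>\<bar> = 1" for \<alpha>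
  proof -
    have "distributed M lborel (\<lambda>\<omega>. 0 + \<alpha> * (W t \<omega> - W s \<omega>)) (normal_density (0 + \<alpha> * 0) (\<bar>\<alpha>\<bar> * sqrt (t - s)))"
      by (rule normal_density_affine[OF D pos]) (use a in auto)
    then have "distributed M lborel (\<lambda>\<omega>. \<alpha> * (W t \<omega> - W s \<omega>)) (normal_density 0 (sqrt (t - s)))"
      using a by simp
    then have D': "distributed M lborel (\<lambda>\<omega>. (\<alpha> * (W t \<omega> - W s \<omega>) - 0) / sqrt (t - s)) std_normal_density"
      by (subst (asm) normal_standard_normal_convert[OF pos]) auto
    have "{\<omega>\<in>space M. \<alpha> * (W t \<omega> - W s \<omega>) \<ge> sqrt (t - s)} =
       (\<lambda>\<omega>. (\<alpha> * (W t \<omega> - W s \<omega>) - 0) / sqrt (t - s)) -` {1..} \<inter> space M"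
      using pos by (auto simp: field_simps)
    then show ?thesis
      using distributed_distr_eq_density[OF D', symmetric] distributed_measurable[OF D']
      by (simp add: tail_def measure_distr)
  qed
  show "prob {\<omega>\<in>space M. W t \<omega> - W s \<omega> \<ge> sqrt (t - s)} = tail" using *[of 1] by simp
  have eq: "sqrt (t - s) \<le> W s \<omega> - W t \<omega> \<longleftrightarrow> W t \<omega> - W s \<omega> \<le> - sqrt (t - s)" for \<omega> by linarith
  show "prob {\<omega>\<in>space M. W t \<omega> - W s \<omega> \<le> - sqrt (t - s)} = tail" using *[of "-1"] by (simp add: eq)
qed

text \<open>An increment after time \<open>s\<close> is independent of both \<open>G\<close> and \<open>Z\<close>. If it is integrated last, what
  remains for each of its values is the integral of \<open>Z\<close> over a section, which belongs to \<open>G\<close>.\<close>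
lemma orthogonal_adjoin_increment:
  assumes st: "0 \<le> s" "s < t"
    and G: "space G = space M" "sets G \<subseteq> sets (F s)"
    and Z: "Z \<in> borel_measurable (F s)" "\<And>\<omega>. \<bar>Z \<omega>\<bar> \<le> 1"
    and orth: "orthogonal_to M G Z"
  shows "orthogonal_to M (adjoin G (\<lambda>\<omega>. W t \<omega> - W s \<omega>)) Z"
  unfolding orthogonal_to_def
proof
  let ?D = "\<lambda>\<omega>. W t \<omega> - W s \<omega>"
  fix Q assume "Q \<in> sets (adjoin G ?D)"
  then obtain S where S: "S \<in> sets (G \<Otimes>\<^sub>M borel)" and Q: "\<And>\<omega>. \<omega> \<in> space G \<Longrightarrow> \<omega> \<in> Q \<longleftrightarrow> (\<omega>, ?D \<omega>) \<in> S"
    by (rule adjoin_setE) blast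
  have "(\<lambda>\<omega>. \<omega>) \<in> F s \<rightarrow>\<^sub>M G"
    by (rule measurable_coarser[OF measurable_ident_sets[OF refl]]) (use G space_F[OF st(1)] in auto)
  then have "(\<lambda>p. (fst p, snd p)) \<in> F s \<Otimes>\<^sub>M borel \<rightarrow>\<^sub>M G \<Otimes>\<^sub>M borel"
    by (intro measurable_Pair measurable_compose[OF measurable_fst]) auto
  then have [measurable]: "(\<lambda>p. p) \<in> F s \<Otimes>\<^sub>M borel \<rightarrow>\<^sub>M G \<Otimes>\<^sub>M borel" by simp
  have "(\<lambda>p. indicator S p :: real) \<in> borel_measurable (F s \<Otimes>\<^sub>M borel)"
    by (rule measurable_compose[of "\<lambda>p. p" _ "G \<Otimes>\<^sub>M borel"]) (use S in auto)
  then have f: "(\<lambda>p. indicator S p * Z (fst p)) \<in> borel_measurable (F s \<Otimes>\<^sub>M borel)"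
    by (intro borel_measurable_times measurable_compose[OF measurable_fst Z(1)])
  have "(\<integral>\<omega>. indicator Q \<omega> * Z \<omega> \<partial>M) = (\<integral>\<omega>. indicator S (\<omega>, ?D \<omega>) * Z (fst (\<omega>, ?D \<omega>)) \<partial>M)"
    using Q G(1) by (intro Bochner_Integration.integral_cong) (auto simp: indicator_def)
  also have "\<dots> = (\<integral>x. (\<integral>\<omega>. indicator S (\<omega>, x) * Z (fst (\<omega>, x)) \<partial>M) \<partial>gauss (t - s))"
    by (rule expectation_joint[OF st f, of 1]) (use Z(2) in \<open>auto simp: indicator_def abs_mult\<close>)
  also have "\<dots> = (\<integral>x. 0 \<partial>gauss (t - s))"
  proof (intro Bochner_Integration.integral_cong refl)
    fix x
    have "(\<lambda>\<omega>. (\<omega>, x)) -` S \<inter> space G \<in> sets G"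
      using S by (intro measurable_sets[of _ _ "G \<Otimes>\<^sub>M borel"]) auto
    then have "(\<integral>\<omega>. indicator ((\<lambda>\<omega>. (\<omega>, x)) -` S \<inter> space G) \<omega> * Z \<omega> \<partial>M) = 0"
      using orth unfolding orthogonal_to_def by blast
    moreover have "(\<integral>\<omega>. indicator ((\<lambda>\<omega>. (\<omega>, x)) -` S \<inter> space G) \<omega> * Z \<omega> \<partial>M) = (\<integral>\<omega>. indicator S (\<omega>, x) * Z (fst (\<omega>, x)) \<partial>M)"
      using G by (intro Bochner_Integration.integral_cong) (auto simp: indicator_def)
    ultimately show "(\<integral>\<omega>. indicator S (\<omega>, x) * Z (fst (\<omega>, x)) \<partial>M) = 0" by simp
  qed
  finally show "(\<integral>\<omega>. indicator Q \<omega> * Z \<omega> \<partial>M) = 0" by simp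
qed

text \<open>Given \<open>F a\<close>, the two halves \<open>U, V\<close> of the increment over \<open>[a, a + 2 * \<eta>]\<close> are independent and
  identically distributed. Exchanging them preserves their sum and changes the sign of \<open>\<zeta> U V\<close>, so
  every integral against information from \<open>F a\<close> and \<open>U + V\<close> equals its own negative.\<close>
lemma orthogonal_adjoin_sum:
  assumes a: "0 \<le> a" "0 < \<eta>"
    and \<theta>: "\<theta> \<in> borel_measurable (F a)" "\<And>\<omega>. \<bar>\<theta> \<omega>\<bar> \<le> 1"
    and \<zeta>: "(\<lambda>(u, v). \<zeta> u v) \<in> borel_measurable (borel \<Otimes>\<^sub>M borel)" "\<And>u v. \<bar>\<zeta> u v\<bar> \<le> 1"
    and anti: "\<And>u v. \<zeta> v u = - \<zeta> u v"
  shows "orthogonal_to M (adjoin (F a) (\<lambda>\<omega>. W (a + 2 * \<eta>) \<omega> - W a \<omega>))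
     (\<lambda>\<omega>. \<theta> \<omega> * \<zeta> (W (a + \<eta>) \<omega> - W a \<omega>) (W (a + 2 * \<eta>) \<omega> - W (a + \<eta>) \<omega>))"
  unfolding orthogonal_to_def
proof
  let ?D = "\<lambda>\<omega>. W (a + 2 * \<eta>) \<omega> - W a \<omega>"
  let ?U = "\<lambda>\<omega>. W (a + \<eta>) \<omega> - W a \<omega>"
  let ?V = "\<lambda>\<omega>. W (a + 2 * \<eta>) \<omega> - W (a + \<eta>) \<omega>"
  fix Q assume "Q \<in> sets (adjoin (F a) ?D)"
  then obtain S where S[measurable]: "S \<in> sets (F a \<Otimes>\<^sub>M borel)" and Q: "\<And>\<omega>. \<omega> \<in> space (F a) \<Longrightarrow> \<omega> \<in> Q \<longleftrightarrow> (\<omega>, ?D \<omega>) \<in> S"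
    by (rule adjoin_setE) blast
  note [measurable] = \<theta>(1) \<zeta>(1)
  have [measurable]: "(\<lambda>\<omega>. \<omega>) \<in> F (a + \<eta>) \<rightarrow>\<^sub>M F a"
    by (rule F_measurable_mono[of a]) (use a in auto)
  have [measurable]: "(\<lambda>\<omega>. \<omega>) \<in> M \<rightarrow>\<^sub>M F a"
    by (rule id_measurable_F[OF a(1)])
  have [measurable]: "?U \<in> borel_measurable (F (a + \<eta>))"
    using a by (intro borel_measurable_diff W_measurable_F) auto
  have \<theta>'[measurable]: "\<theta> \<in> borel_measurable (F (a + \<eta>))"
    by (rule F_measurable_mono[of a]) (use a \<theta>(1) in auto)
  have \<theta>M[measurable]: "\<theta> \<in> borel_measurable M"
    by (rule F_measurable_M[of a]) (use a \<theta>(1) in auto)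
  have S': "(\<lambda>p. indicator S (fst p, ?U (fst p) + snd p) :: real) \<in> borel_measurable (F (a + \<eta>) \<Otimes>\<^sub>M borel)"
    by (rule measurable_compose[of "\<lambda>p. (fst p, ?U (fst p) + snd p)" _ "F a \<Otimes>\<^sub>M borel"]) measurable
  have Z': "(\<lambda>p. \<zeta> (?U (fst p)) (snd p)) \<in> borel_measurable (F (a + \<eta>) \<Otimes>\<^sub>M borel)"
    by measurable
  have bd: "\<bar>x * (y * z)\<bar> \<le> 1" if "\<bar>x\<bar> \<le> 1" "\<bar>y\<bar> \<le> 1" "\<bar>z\<bar> \<le> 1" for x y z :: real
    using that by (simp add: abs_mult mult_le_one)
  have bS: "\<bar>indicator S p\<bar> \<le> (1::real)" for p by (simp add: indicator_def)
  have "(\<integral>\<omega>. indicator Q \<omega> * (\<theta> \<omega> * \<zeta> (?U \<omega>) (?V \<omega>)) \<partial>M)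
      = (\<integral>\<omega>. (\<lambda>p. indicator S (fst p, ?U (fst p) + snd p) * (\<theta> (fst p) * \<zeta> (?U (fst p)) (snd p))) (\<omega>, ?V \<omega>) \<partial>M)"
    using Q space_F[OF a(1)] by (intro Bochner_Integration.integral_cong) (auto simp: indicator_def)
  also have "\<dots> = (\<integral>v. (\<integral>\<omega>. (\<lambda>p. indicator S (fst p, ?U (fst p) + snd p) * (\<theta> (fst p) * \<zeta> (?U (fst p)) (snd p))) (\<omega>, v) \<partial>M) \<partial>gauss (a + 2 * \<eta> - (a + \<eta>)))"
  proof (rule expectation_joint[where B=1])
    show "(\<lambda>p. indicator S (fst p, ?U (fst p) + snd p) * (\<theta> (fst p) * \<zeta> (?U (fst p)) (snd p))) \<in> borel_measurable (F (a + \<eta>) \<Otimes>\<^sub>M borel)"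
      by (intro borel_measurable_times S' Z' measurable_compose[OF measurable_fst \<theta>'])
    show "\<bar>indicator S (fst p, ?U (fst p) + snd p) * (\<theta> (fst p) * \<zeta> (?U (fst p)) (snd p))\<bar> \<le> 1" for p
      by (intro bd bS \<theta> \<zeta>)
  qed (use a in auto)
  also have "a + 2 * \<eta> - (a + \<eta>) = \<eta>" by simp
  also have "(\<integral>v. (\<integral>\<omega>. (\<lambda>p. indicator S (fst p, ?U (fst p) + snd p) * (\<theta> (fst p) * \<zeta> (?U (fst p)) (snd p))) (\<omega>, v) \<partial>M) \<partial>gauss \<eta>)
     = (\<integral>v. (\<integral>u. (\<integral>\<omega>. indicator S (\<omega>, u + v) * (\<theta> \<omega> * \<zeta> u v) \<partial>M) \<partial>gauss \<eta>) \<partial>gauss \<eta>)"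
  proof (intro Bochner_Integration.integral_cong refl)
    fix v
    have "(\<integral>\<omega>. (\<lambda>p. indicator S (fst p, snd p + v) * (\<theta> (fst p) * \<zeta> (snd p) v)) (\<omega>, ?U \<omega>) \<partial>M) =
      (\<integral>u. (\<integral>\<omega>. (\<lambda>p. indicator S (fst p, snd p + v) * (\<theta> (fst p) * \<zeta> (snd p) v)) (\<omega>, u) \<partial>M) \<partial>gauss (a + \<eta> - a))"
    proof (rule expectation_joint[where B=1])
      have "(\<lambda>p. indicator S (fst p, snd p + v) :: real) \<in> borel_measurable (F a \<Otimes>\<^sub>M borel)"
        by (rule measurable_compose[of "\<lambda>p. (fst p, snd p + v)" _ "F a \<Otimes>\<^sub>M borel"]) measurable
      moreover have "(\<lambda>p. \<zeta> (snd p) v) \<in> borel_measurable (F a \<Otimes>\<^sub>M borel)" by measurable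
      ultimately show "(\<lambda>p. indicator S (fst p, snd p + v) * (\<theta> (fst p) * \<zeta> (snd p) v)) \<in> borel_measurable (F a \<Otimes>\<^sub>M borel)"
        by (intro borel_measurable_times measurable_compose[OF measurable_fst \<theta>(1)])
      show "\<bar>indicator S (fst p, snd p + v) * (\<theta> (fst p) * \<zeta> (snd p) v)\<bar> \<le> 1" for p
        by (intro bd bS \<theta> \<zeta>)
    qed (use a in auto)
    then show "(\<integral>\<omega>. (\<lambda>p. indicator S (fst p, ?U (fst p) + snd p) * (\<theta> (fst p) * \<zeta> (?U (fst p)) (snd p))) (\<omega>, v) \<partial>M)
      = (\<integral>u. (\<integral>\<omega>. indicator S (\<omega>, u + v) * (\<theta> \<omega> * \<zeta> u v) \<partial>M) \<partial>gauss \<eta>)"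
      by simp
  qed
  also have "\<dots> = 0"
  proof -
    define h where "h u v = (\<integral>\<omega>. indicator S (\<omega>, u + v) * (\<theta> \<omega> * \<zeta> u v) \<partial>M)" for u v
    \<comment> \<open>With the sample point integrated out, only an antisymmetric function of the two halves is left.\<close>
    have hanti: "h v u = - h u v" for u v
      unfolding h_def anti[of v u] by (simp add: add.commute)
    interpret g: prob_space "gauss \<eta>" using a by (intro prob_space_gauss) simp
    interpret P: pair_prob_space "gauss \<eta>" "gauss \<eta>" ..
    have hm: "(\<lambda>(u, v). h u v) \<in> borel_measurable (borel \<Otimes>\<^sub>M borel)"
      unfolding h_def
    proof -
      have "(\<lambda>(p, \<omega>). indicator S (\<omega>, fst p + snd p) * (\<theta> \<omega> * \<zeta> (fst p) (snd p)) :: real) \<in> borel_measurable ((borel \<Otimes>\<^sub>M borel) \<Otimes>\<^sub>M M)"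
      proof -
        have "(\<lambda>q. indicator S (snd q, fst (fst q) + snd (fst q)) :: real) \<in> borel_measurable ((borel \<Otimes>\<^sub>M borel) \<Otimes>\<^sub>M M)"
          by (rule measurable_compose[of "\<lambda>q. (snd q, fst (fst q) + snd (fst q))" _ "F a \<Otimes>\<^sub>M borel"]) measurable
        moreover have "(\<lambda>q. \<theta> (snd q)) \<in> borel_measurable ((borel \<Otimes>\<^sub>M borel) \<Otimes>\<^sub>M M)" by measurable
        moreover have "(\<lambda>q. \<zeta> (fst (fst q)) (snd (fst q))) \<in> borel_measurable ((borel \<Otimes>\<^sub>M borel) \<Otimes>\<^sub>M M)" by measurable
        ultimately show ?thesis unfolding case_prod_beta by (intro borel_measurable_times)
      qed
      from borel_measurable_lebesgue_integral[OF this]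
      show "(\<lambda>(u, v). \<integral>\<omega>. indicator S (\<omega>, u + v) * (\<theta> \<omega> * \<zeta> u v) \<partial>M) \<in> borel_measurable (borel \<Otimes>\<^sub>M borel)"
        unfolding case_prod_beta fst_conv snd_conv .
    qed
    have hb: "\<bar>h u v\<bar> \<le> 1" for u v
    proof -
      have int: "integrable M (\<lambda>\<omega>. indicator S (\<omega>, u + v) * (\<theta> \<omega> * \<zeta> u v))"
      proof -
        have "(\<lambda>\<omega>. indicator S (\<omega>, u + v) :: real) \<in> borel_measurable M"
          by (rule measurable_compose[of "\<lambda>\<omega>. (\<omega>, u + v)" _ "F a \<Otimes>\<^sub>M borel"]) measurable
        then show ?thesis
          by (intro integrable_const_bound[of _ 1]) (auto intro!: bd bS \<theta> \<zeta>)
      qed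
      show ?thesis unfolding h_def
        by (rule order_trans[OF integral_abs_bound integral_le_const])
          (use int in \<open>auto intro!: bd bS \<theta> \<zeta>\<close>)
    qed
    have int: "integrable (gauss \<eta> \<Otimes>\<^sub>M gauss \<eta>) (\<lambda>(u, v). h u v)"
      using hm hb by (intro P.integrable_const_bound[of _ 1]) (auto cong: measurable_cong_sets sets_pair_measure_cong)
    have "(\<integral>v. (\<integral>u. h u v \<partial>gauss \<eta>) \<partial>gauss \<eta>) = (\<integral>u. (\<integral>v. h u v \<partial>gauss \<eta>) \<partial>gauss \<eta>)"
      by (rule P.Fubini_integral[OF int])
    also have "\<dots> = (\<integral>u. (\<integral>v. - h v u \<partial>gauss \<eta>) \<partial>gauss \<eta>)"
      by (intro Bochner_Integration.integral_cong refl) (rule hanti)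
    also have "\<dots> = - (\<integral>u. (\<integral>v. h v u \<partial>gauss \<eta>) \<partial>gauss \<eta>)" by simp
    finally show ?thesis unfolding h_def by linarith
  qed
  finally show "(\<integral>\<omega>. indicator Q \<omega> * (\<theta> \<omega> * \<zeta> (?U \<omega>) (?V \<omega>)) \<partial>M) = 0" .
qed

text \<open>Times up to \<open>a\<close> are covered by \<open>F a\<close>, and \<open>W\<close> at the right endpoint is recovered from \<open>F a\<close> and the
  total increment. Later times are reached one by one in increasing order, each by adjoining an
  increment that is independent of everything adjoined before.\<close>
lemma antisymmetric_orthogonal_to_observations:
  assumes a: "0 \<le> a" "0 < \<eta>"
    and \<theta>: "\<theta> \<in> borel_measurable (F a)" "\<And>\<omega>. \<bar>\<theta> \<omega>\<bar> \<le> 1"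
    and \<zeta>: "(\<lambda>(u, v). \<zeta> u v) \<in> borel_measurable (borel \<Otimes>\<^sub>M borel)" "\<And>u v. \<bar>\<zeta> u v\<bar> \<le> 1"
    and anti: "\<And>u v. \<zeta> v u = - \<zeta> u v"
    and R: "finite R" "\<And>r. r \<in> R \<Longrightarrow> 0 \<le> r" "\<And>r. r \<in> R \<Longrightarrow> r \<notin> {a<..<a + 2 * \<eta>}"
  obtains G where "subalgebra M G" "sets (F a) \<subseteq> sets G" "\<And>r. r \<in> R \<Longrightarrow> W r \<in> borel_measurable G"
    "orthogonal_to M G (\<lambda>\<omega>. \<theta> \<omega> * \<zeta> (W (a + \<eta>) \<omega> - W a \<omega>) (W (a + 2 * \<eta>) \<omega> - W (a + \<eta>) \<omega>))"
proof -
  let ?Z = "\<lambda>\<omega>. \<theta> \<omega> * \<zeta> (W (a + \<eta>) \<omega> - W a \<omega>) (W (a + 2 * \<eta>) \<omega> - W (a + \<eta>) \<omega>)"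
  let ?b = "a + 2 * \<eta>"
  note [measurable] = \<zeta>(1)
  have Zb: "\<bar>?Z \<omega>\<bar> \<le> 1" for \<omega>
    using \<theta>(2)[of \<omega>] \<zeta>(2) by (simp add: abs_mult mult_le_one)
  have Zm: "?Z \<in> borel_measurable (F u)" if "?b \<le> u" for u
  proof -
    have [measurable]: "\<theta> \<in> borel_measurable (F u)"
      by (rule F_measurable_mono[OF a(1) _ \<theta>(1)]) (use a that in simp)
    have [measurable]: "W a \<in> borel_measurable (F u)" "W (a + \<eta>) \<in> borel_measurable (F u)" "W ?b \<in> borel_measurable (F u)"
      using a that by (auto intro!: W_measurable_F)
    show ?thesis by measurable
  qed
  have mono_meas: "f \<in> borel_measurable H" if "f \<in> borel_measurable G" "space G = space H" "sets G \<subseteq> sets H" for f :: "'a \<Rightarrow> real" and G H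
    by (rule measurable_coarser[OF that(1) that(2,3)])
  \<comment> \<open>The clause about \<open>F u\<close> keeps the next increment independent of what has been adjoined so far.\<close>
  have ex: "finite S \<Longrightarrow> (\<forall>r\<in>S. ?b < r) \<Longrightarrow> \<exists>G. space G = space M \<and> sets (F a) \<subseteq> sets G \<and> W ?b \<in> borel_measurable G \<and>
      (\<forall>r\<in>S. W r \<in> borel_measurable G) \<and> (\<forall>u. ?b \<le> u \<and> (\<forall>r\<in>S. r \<le> u) \<longrightarrow> sets G \<subseteq> sets (F u)) \<and> orthogonal_to M G ?Z" for S
  proof (induction S rule: finite_linorder_max_induct)
    case empty
    let ?G = "adjoin (F a) (\<lambda>\<omega>. W ?b \<omega> - W a \<omega>)"
    have "W a \<in> borel_measurable ?G"
      by (rule mono_meas[OF W_measurable_F[of a a]]) (use a sets_le_adjoin in auto)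
    from borel_measurable_add[OF this adjoined_measurable] have "W ?b \<in> borel_measurable ?G" by simp
    moreover have "sets ?G \<subseteq> sets (F u)" if "?b \<le> u" for u
      using a that filtration_mono[of a u] space_F[of a] space_F[of u]
      by (intro sets_adjoin_le borel_measurable_diff W_measurable_F) auto
    moreover have "orthogonal_to M ?G ?Z"
      by (rule orthogonal_adjoin_sum[OF a \<theta> \<zeta> anti])
    ultimately show ?case
      using space_F[OF a(1)] sets_le_adjoin[of "F a" "\<lambda>\<omega>. W ?b \<omega> - W a \<omega>"] by (intro exI[of _ ?G]) simp
  next
    case (insert r S)
    then obtain G where G: "space G = space M" "sets (F a) \<subseteq> sets G" "W ?b \<in> borel_measurable G"
      "\<forall>r\<in>S. W r \<in> borel_measurable G" "\<And>u. ?b \<le> u \<Longrightarrow> (\<forall>r\<in>S. r \<le> u) \<Longrightarrow> sets G \<subseteq> sets (F u)" "orthogonal_to M G ?Z"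
      by auto
    define u where "u = Max (insert ?b S)"
    have u: "?b \<le> u" "\<forall>r\<in>S. r \<le> u" "u \<in> insert ?b S"
      using Max_in[of "insert ?b S"] Max_ge[of "insert ?b S"] insert.hyps(1)
    unfolding u_def by (simp_all del: Max_insert)
    have ur: "u < r" using u(3) insert.hyps(2) insert.prems by blast
    have u0: "0 \<le> u" using a u(1) by simp
    let ?D = "\<lambda>\<omega>. W r \<omega> - W u \<omega>"
    let ?G = "adjoin G ?D"
    have up: "f \<in> borel_measurable ?G" if "f \<in> borel_measurable G" for f :: "'a \<Rightarrow> real"
      by (rule mono_meas[OF that space_adjoin[symmetric] sets_le_adjoin])
    have "W u \<in> borel_measurable G" using u(3) G(3,4) by blast
    then have Wu: "W u \<in> borel_measurable ?G" by (rule up)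
    from borel_measurable_add[OF this adjoined_measurable] have "W r \<in> borel_measurable ?G" by simp
    moreover have "sets ?G \<subseteq> sets (F w)" if "?b \<le> w" "\<forall>q\<in>insert r S. q \<le> w" for w
      using that G(1,5) u0 ur space_F[of w]
      by (intro sets_adjoin_le borel_measurable_diff W_measurable_F) auto
    moreover have "orthogonal_to M ?G ?Z"
      by (rule orthogonal_adjoin_increment[OF u0 ur G(1) G(5)[OF u(1,2)] Zm[OF u(1)] Zb G(6)])
    moreover have "space ?G = space M" using G(1) by simp
    moreover have "sets (F a) \<subseteq> sets ?G" using G(2) sets_le_adjoin[of G ?D] by (rule order_trans)
    moreover have "W ?b \<in> borel_measurable ?G" by (rule up[OF G(3)])
    moreover have "\<forall>q\<in>S. W q \<in> borel_measurable ?G" using up G(4) by blast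
    ultimately show ?case by (intro exI[of _ ?G]) blast
  qed
  have "finite {r \<in> R. ?b < r}" using R(1) by simp
  from ex[OF this] obtain G where G: "space G = space M" "sets (F a) \<subseteq> sets G" "W ?b \<in> borel_measurable G"
      "\<And>r. r \<in> R \<Longrightarrow> ?b < r \<Longrightarrow> W r \<in> borel_measurable G"
      "\<And>u. ?b \<le> u \<Longrightarrow> (\<forall>r\<in>{r \<in> R. ?b < r}. r \<le> u) \<Longrightarrow> sets G \<subseteq> sets (F u)" "orthogonal_to M G ?Z"
    by auto
  show thesis
  proof
    have "?b \<le> Max (insert ?b R)" "\<forall>r\<in>{r \<in> R. ?b < r}. r \<le> Max (insert ?b R)" using R(1) by auto
    with G(5)[OF this] sets_F[of "Max (insert ?b R)"] a show "subalgebra M G"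
      using G(1) by (auto simp: subalgebra_def)
    show "W r \<in> borel_measurable G" if r: "r \<in> R" for r
    proof -
      consider "r \<le> a" | "r = ?b" | "r > ?b" using R(3)[OF r] by fastforce
      then show ?thesis
      proof cases
        case 1
        have "W r \<in> borel_measurable (F a)" by (rule W_measurable_F[OF R(2)[OF r] 1])
        then show ?thesis
          by (rule mono_meas) (simp_all add: G(1,2) space_F[OF a(1)])
      next
        case 2
        then show ?thesis using G(3) by simp
      next
        case 3
        then show ?thesis by (rule G(4)[OF r])
      qed
    qed
  qed (rule G(2), rule G(6))
qed

end

section \<open>Suprema, partitions and second moments\<close>

text \<open>Reduces a supremum over a path to countably many times, which makes it a random variable. Clamping
  rational numbers to \<open>[a, b]\<close> keeps the endpoints even if they are irrational.\<close>
lemma continuous_SUP_eq_rational_SUP: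
  fixes f :: "real \<Rightarrow> real"
  assumes f: "continuous_on {a..b} f" and ab: "a \<le> b"
  shows "(SUP t\<in>{a..b}. ennreal (f t)) = (SUP q\<in>\<rat>. ennreal (f (max a (min b q))))"
proof (rule antisym)
  show "(SUP t\<in>{a..b}. ennreal (f t)) \<le> (SUP q\<in>\<rat>. ennreal (f (max a (min b q))))"
  proof (rule SUP_least)
    fix t assume t: "t \<in> {a..b}"
    have "t \<in> closure \<rat>" by (simp add: Rats_closure_real)
    then obtain q where q: "\<And>n. q n \<in> \<rat>" "q \<longlonglongrightarrow> t" unfolding closure_sequential by blast
    have "(\<lambda>n. max a (min b (q n))) \<longlonglongrightarrow> max a (min b t)" by (intro tendsto_intros q)
    also have "max a (min b t) = t" using t by auto
    finally have "(\<lambda>n. f (max a (min b (q n)))) \<longlonglongrightarrow> f t"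
      by (rule continuous_on_tendsto_compose[OF f]) (use t ab in auto)
    then have "(\<lambda>n. ennreal (f (max a (min b (q n))))) \<longlonglongrightarrow> ennreal (f t)" by (rule tendsto_ennrealI)
    then show "ennreal (f t) \<le> (SUP q\<in>\<rat>. ennreal (f (max a (min b q))))"
      by (rule LIMSEQ_le_const2) (use q(1) in \<open>auto intro!: SUP_upper exI[of _ 0]\<close>)
  qed
  show "(SUP q\<in>\<rat>. ennreal (f (max a (min b q)))) \<le> (SUP t\<in>{a..b}. ennreal (f t))"
    using ab by (intro SUP_least SUP_upper) auto
qed

lemma sum_indicator_mono_partition:
  fixes u :: "nat \<Rightarrow> real"
  assumes "\<And>i. i < N \<Longrightarrow> u i \<le> u (Suc i)"
  shows "(\<Sum>i<N. indicator {u i<..u (Suc i)} t) = (indicator {u 0<..u N} t :: ennreal) \<and> u 0 \<le> u N"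
  using assms
proof (induction N)
  case (Suc N)
  then have IH: "(\<Sum>i<N. indicator {u i<..u (Suc i)} t) = (indicator {u 0<..u N} t :: ennreal)" "u 0 \<le> u N"
    and "u N \<le> u (Suc N)" by auto
  then show ?case by (auto simp: indicator_def)
qed simp

lemma (in prob_space) expectation_abs_le_sqrt:
  assumes "f \<in> borel_measurable M" "integrable M (\<lambda>x. (f x)\<^sup>2)" "(\<integral>x. (f x)\<^sup>2 \<partial>M) \<le> v"
  shows "integrable M f" "(\<integral>x. \<bar>f x\<bar> \<partial>M) \<le> sqrt v"
proof -
  show i: "integrable M f" by (rule square_integrable_imp_integrable[OF assms(1,2)])
  have "0 \<le> variance (\<lambda>x. \<bar>f x\<bar>)" by (rule variance_positive)
  also have "\<dots> = (\<integral>x. (\<bar>f x\<bar>)\<^sup>2 \<partial>M) - (\<integral>x. \<bar>f x\<bar> \<partial>M)\<^sup>2"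
    by (rule variance_eq) (use i assms in auto)
  finally have "(\<integral>x. \<bar>f x\<bar> \<partial>M)\<^sup>2 \<le> v" using assms(3) by simp
  then show "(\<integral>x. \<bar>f x\<bar> \<partial>M) \<le> sqrt v" by (rule real_le_rsqrt)
qed

section \<open>Sums over Brownian increments\<close>

context brownian_filtration begin

text \<open>The Ito isometry for finite sums. In the square of \<open>S n + \<theta> n * \<Delta>\<close> the mixed term has mean
  zero, because \<open>S n * \<theta> n\<close> is known at the left endpoint and the increment \<open>\<Delta>\<close> is independent of it.\<close>
lemma transform_isometry:
  fixes u :: "nat \<Rightarrow> real" and \<theta> :: "nat \<Rightarrow> 'a \<Rightarrow> real"
  assumes u0: "0 \<le> u 0" and u: "\<And>i. i < N \<Longrightarrow> u i \<le> u (Suc i)"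
    and m: "\<And>i. i < N \<Longrightarrow> \<theta> i \<in> borel_measurable (F (u i))"
    and b: "\<And>i. i < N \<Longrightarrow> \<exists>B. \<forall>\<omega>\<in>space M. \<bar>\<theta> i \<omega>\<bar> \<le> B"
  defines "S \<equiv> \<lambda>n \<omega>. \<Sum>i<n. \<theta> i \<omega> * (W (u (Suc i)) \<omega> - W (u i) \<omega>)"
  assumes "n \<le> N"
  shows "0 \<le> u n \<and> S n \<in> borel_measurable (F (u n)) \<and> integrable M (\<lambda>\<omega>. (S n \<omega>)\<^sup>2) \<and>
    integrable M (\<lambda>\<omega>. \<Sum>i<n. (\<theta> i \<omega>)\<^sup>2 * (u (Suc i) - u i)) \<and>
    (\<integral>\<omega>. (S n \<omega>)\<^sup>2 \<partial>M) = (\<integral>\<omega>. (\<Sum>i<n. (\<theta> i \<omega>)\<^sup>2 * (u (Suc i) - u i)) \<partial>M)"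
  using \<open>n \<le> N\<close>
proof (induction n)
  case 0
  then show ?case using u0 by (simp add: S_def)
next
  case (Suc n)
  then have n: "n < N" by simp
  from Suc have IH: "0 \<le> u n" "S n \<in> borel_measurable (F (u n))" "integrable M (\<lambda>\<omega>. (S n \<omega>)\<^sup>2)"
    "integrable M (\<lambda>\<omega>. \<Sum>i<n. (\<theta> i \<omega>)\<^sup>2 * (u (Suc i) - u i))"
    "(\<integral>\<omega>. (S n \<omega>)\<^sup>2 \<partial>M) = (\<integral>\<omega>. (\<Sum>i<n. (\<theta> i \<omega>)\<^sup>2 * (u (Suc i) - u i)) \<partial>M)"
    by auto
  let ?D = "\<lambda>\<omega>. W (u (Suc n)) \<omega> - W (u n) \<omega>"
  let ?h = "u (Suc n) - u n"
  have le: "u n \<le> u (Suc n)" using u[OF n] .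
  have 0: "0 \<le> u (Suc n)" using IH(1) le by simp
  have Ssuc: "S (Suc n) = (\<lambda>\<omega>. S n \<omega> + \<theta> n \<omega> * ?D \<omega>)" by (simp add: S_def fun_eq_iff)
  have \<theta>F: "\<theta> n \<in> borel_measurable (F (u (Suc n)))" by (rule F_measurable_mono[OF IH(1) le m[OF n]])
  have SF: "S n \<in> borel_measurable (F (u (Suc n)))" by (rule F_measurable_mono[OF IH(1) le IH(2)])
  have DF: "?D \<in> borel_measurable (F (u (Suc n)))"
    using IH(1) le 0 by (intro borel_measurable_diff W_measurable_F) auto
  have meas: "S (Suc n) \<in> borel_measurable (F (u (Suc n)))"
    unfolding Ssuc using \<theta>F SF DF by simp
  have [measurable]: "\<theta> n \<in> borel_measurable M" "S n \<in> borel_measurable M"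
    using F_measurable_M[OF IH(1) m[OF n]] F_measurable_M[OF IH(1) IH(2)] by auto
  obtain B where B: "\<And>\<omega>. \<omega> \<in> space M \<Longrightarrow> \<bar>\<theta> n \<omega>\<bar> \<le> B" using b[OF n] by blast
  have S1: "integrable M (S n)" by (rule square_integrable_imp_integrable) (use IH in auto)
  have S\<theta>: "integrable M (\<lambda>\<omega>. S n \<omega> * \<theta> n \<omega>)"
    by (rule Bochner_Integration.integrable_bound[OF integrable_mult_right[OF S1, of B]])
       (auto simp: abs_mult mult.commute[of "\<bar>S n _\<bar>"] intro!: AE_I2 mult_right_mono order_trans[OF B abs_ge_self])
  have \<theta>2: "integrable M (\<lambda>\<omega>. (\<theta> n \<omega>)\<^sup>2)"
    by (rule integrable_const_bound[of _ "B\<^sup>2"]) (use B in \<open>auto intro!: AE_I2 abs_le_square_iff[THEN iffD1] order_trans[OF B abs_ge_self]\<close>)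
  have mom: "integrable M ?D" "(\<integral>\<omega>. ?D \<omega> \<partial>M) = 0" "integrable M (\<lambda>\<omega>. (?D \<omega>)\<^sup>2)" "(\<integral>\<omega>. (?D \<omega>)\<^sup>2 \<partial>M) = ?h"
    using increment_moments[OF IH(1) le] by auto
  have cross: "integrable M (\<lambda>\<omega>. S n \<omega> * \<theta> n \<omega> * ?D \<omega>) \<and> (\<integral>\<omega>. S n \<omega> * \<theta> n \<omega> * ?D \<omega> \<partial>M) = 0"
  proof (cases "u n = u (Suc n)")
    case False
    then have lt: "u n < u (Suc n)" using le by simp
    have "(\<lambda>\<omega>. S n \<omega> * \<theta> n \<omega>) \<in> borel_measurable (F (u n))" using IH(2) m[OF n] by simp
    from expectation_mult_increment[OF IH(1) lt this S\<theta>, of "\<lambda>x. x"] mom show ?thesis by simp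
  qed simp
  have quad: "integrable M (\<lambda>\<omega>. (\<theta> n \<omega>)\<^sup>2 * (?D \<omega>)\<^sup>2) \<and> (\<integral>\<omega>. (\<theta> n \<omega>)\<^sup>2 * (?D \<omega>)\<^sup>2 \<partial>M) = (\<integral>\<omega>. (\<theta> n \<omega>)\<^sup>2 * ?h \<partial>M)"
  proof (cases "u n = u (Suc n)")
    case False
    then have lt: "u n < u (Suc n)" using le by simp
    have "(\<lambda>\<omega>. (\<theta> n \<omega>)\<^sup>2) \<in> borel_measurable (F (u n))" using m[OF n] by simp
    from expectation_mult_increment[OF IH(1) lt this \<theta>2, of "\<lambda>x. x\<^sup>2"] mom \<theta>2 show ?thesis by simp
  qed simp
  have eq: "(S (Suc n) \<omega>)\<^sup>2 = (S n \<omega>)\<^sup>2 + (2 * (S n \<omega> * \<theta> n \<omega> * ?D \<omega>) + (\<theta> n \<omega>)\<^sup>2 * (?D \<omega>)\<^sup>2)" for \<omega>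
    unfolding Ssuc by (simp add: power2_eq_square algebra_simps)
  have int: "integrable M (\<lambda>\<omega>. (S (Suc n) \<omega>)\<^sup>2)"
    unfolding eq using IH(3) cross quad by auto
  have "(\<integral>\<omega>. (S (Suc n) \<omega>)\<^sup>2 \<partial>M) = (\<integral>\<omega>. (S n \<omega>)\<^sup>2 \<partial>M) + (\<integral>\<omega>. (\<theta> n \<omega>)\<^sup>2 * ?h \<partial>M)"
    unfolding eq using IH(3) cross quad by simp
  also have "\<dots> = (\<integral>\<omega>. (\<Sum>i<Suc n. (\<theta> i \<omega>)\<^sup>2 * (u (Suc i) - u i)) \<partial>M)"
    using IH(4,5) \<theta>2 by simp
  finally show ?case using 0 meas int IH(4) \<theta>2 by simp
qed

text \<open>The integrand is switched off as soon as its accumulated energy exceeds \<open>v\<close>. The energy of a step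
  is known at the beginning of that step, hence the stopped integrand is adapted, and its energy never
  exceeds \<open>v\<close>. The isometry thus bounds a random variable that coincides with the original sum on
  every path of small energy.\<close>
lemma stopped_transform:
  fixes u :: "nat \<Rightarrow> real" and \<theta> :: "nat \<Rightarrow> 'a \<Rightarrow> real"
  assumes u0: "0 \<le> u 0" and u: "\<And>i. i < N \<Longrightarrow> u i \<le> u (Suc i)"
    and m: "\<And>i. i < N \<Longrightarrow> \<theta> i \<in> borel_measurable (F (u i))"
    and b: "\<And>i. i < N \<Longrightarrow> \<exists>B. \<forall>\<omega>\<in>space M. \<bar>\<theta> i \<omega>\<bar> \<le> B"
    and v: "0 \<le> v"
  obtains S where "S \<in> borel_measurable M" "integrable M S" "(\<integral>\<omega>. \<bar>S \<omega>\<bar> \<partial>M) \<le> sqrt v"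
    "\<And>\<omega>. (\<Sum>i<N. (\<theta> i \<omega>)\<^sup>2 * (u (Suc i) - u i)) \<le> v \<Longrightarrow>
        S \<omega> = (\<Sum>i<N. \<theta> i \<omega> * (W (u (Suc i)) \<omega> - W (u i) \<omega>))"
proof -
  define E where "E n \<omega> = (\<Sum>i<n. (\<theta> i \<omega>)\<^sup>2 * (u (Suc i) - u i))" for n \<omega>
  \<comment> \<open>\<open>E (Suc i)\<close> includes the current step, which is what keeps the total below \<open>v\<close>.\<close>
  define \<rho> where "\<rho> i \<omega> = (if E (Suc i) \<omega> \<le> v then \<theta> i \<omega> else 0)" for i \<omega>
  have Emono: "E n \<omega> \<le> E k \<omega>" if "n \<le> k" "k \<le> N" for n k \<omega>
    unfolding E_def using that u by (intro sum_mono2) auto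
  have u0': "0 \<le> u i \<and> (\<forall>j\<le>i. 0 \<le> u j \<and> u j \<le> u i)" if "i \<le> N" for i
    using that
  proof (induction i)
    case (Suc i)
    then have "0 \<le> u i" "\<forall>j\<le>i. 0 \<le> u j \<and> u j \<le> u i" "u i \<le> u (Suc i)" using u[of i] by auto
    then show ?case by (auto simp: le_Suc_eq)
  qed (use u0 in simp)
  have \<rho>m: "\<rho> i \<in> borel_measurable (F (u i))" if i: "i < N" for i
  proof -
    have [measurable]: "\<theta> j \<in> borel_measurable (F (u i))" if "j \<le> i" for j
      by (rule F_measurable_mono[of "u j"]) (use that u0'[of i] i m in auto)
    have [measurable]: "E (Suc i) \<in> borel_measurable (F (u i))" unfolding E_def by (intro borel_measurable_sum) auto
    show ?thesis unfolding \<rho>_def by measurable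
  qed
  have \<rho>b: "\<exists>B. \<forall>\<omega>\<in>space M. \<bar>\<rho> i \<omega>\<bar> \<le> B" if i: "i < N" for i
  proof -
    obtain B where "\<forall>\<omega>\<in>space M. \<bar>\<theta> i \<omega>\<bar> \<le> B" using b[OF i] by blast
    then have "\<forall>\<omega>\<in>space M. \<bar>\<rho> i \<omega>\<bar> \<le> max B 0" by (auto simp: \<rho>_def le_max_iff_disj)
    then show ?thesis ..
  qed
  have en: "(\<Sum>i<n. (\<rho> i \<omega>)\<^sup>2 * (u (Suc i) - u i)) \<le> v" if "n \<le> N" for n \<omega>
    using that
  proof (induction n)
    case (Suc n)
    show ?case
    proof (cases "E (Suc n) \<omega> \<le> v")
      case True
      have "E (Suc i) \<omega> \<le> v" if "i < Suc n" for i using order_trans[OF Emono True] that Suc.prems by simp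
      then have "(\<Sum>i<Suc n. (\<rho> i \<omega>)\<^sup>2 * (u (Suc i) - u i)) = E (Suc n) \<omega>"
        unfolding E_def \<rho>_def by (intro sum.cong) auto
      with True show ?thesis by simp
    next
      case False
      then show ?thesis using Suc by (simp add: \<rho>_def)
    qed
  qed (use v in simp)
  define S where "S = (\<lambda>\<omega>. \<Sum>i<N. \<rho> i \<omega> * (W (u (Suc i)) \<omega> - W (u i) \<omega>))"
  have iso: "0 \<le> u N" "S \<in> borel_measurable (F (u N))" "integrable M (\<lambda>\<omega>. (S \<omega>)\<^sup>2)"
    "integrable M (\<lambda>\<omega>. \<Sum>i<N. (\<rho> i \<omega>)\<^sup>2 * (u (Suc i) - u i))"
    "(\<integral>\<omega>. (S \<omega>)\<^sup>2 \<partial>M) = (\<integral>\<omega>. (\<Sum>i<N. (\<rho> i \<omega>)\<^sup>2 * (u (Suc i) - u i)) \<partial>M)"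
    using transform_isometry[OF u0 u \<rho>m \<rho>b order_refl] unfolding S_def by blast+
  have Sm: "S \<in> borel_measurable M" by (rule F_measurable_M[OF iso(1,2)])
  note S2 = iso(3)
  have "(\<integral>\<omega>. (S \<omega>)\<^sup>2 \<partial>M) = (\<integral>\<omega>. (\<Sum>i<N. (\<rho> i \<omega>)\<^sup>2 * (u (Suc i) - u i)) \<partial>M)" by (rule iso(5))
  also have "\<dots> \<le> v" by (rule integral_le_const[OF iso(4)]) (simp add: en)
  finally have S2v: "(\<integral>\<omega>. (S \<omega>)\<^sup>2 \<partial>M) \<le> v" .
  show thesis
  proof
    show "S \<in> borel_measurable M" by (rule Sm)
    show "integrable M S" "(\<integral>\<omega>. \<bar>S \<omega>\<bar> \<partial>M) \<le> sqrt v" using expectation_abs_le_sqrt[OF Sm S2 S2v] by auto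
    fix \<omega> assume le: "(\<Sum>i<N. (\<theta> i \<omega>)\<^sup>2 * (u (Suc i) - u i)) \<le> v"
    have "E (Suc i) \<omega> \<le> v" if "i < N" for i
      using Emono[of "Suc i" N \<omega>] that le unfolding E_def by simp
    then show "S \<omega> = (\<Sum>i<N. \<theta> i \<omega> * (W (u (Suc i)) \<omega> - W (u i) \<omega>))"
      unfolding S_def \<rho>_def by (intro sum.cong) auto
  qed
qed

text \<open>Over \<open>[a, r]\<close> the grid of \<open>K\<close> is truncated to that interval and padded with the endpoints. On the
  padding cells \<open>K\<close> vanishes but the subtracted integrand \<open>c\<close> does not, so they are needed for the
  telescoping sum \<open>W r - W a\<close>.\<close>
lemma simple_increment_as_transform:
  assumes K: "K \<in> simple_integrands M F T" and ar: "0 \<le> a" "a < r"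
    and c: "c \<in> borel_measurable (F a)" "\<And>\<omega>. \<omega> \<in> space M \<Longrightarrow> \<bar>c \<omega>\<bar> \<le> C"
  obtains N u \<theta> where "\<And>i. i < N \<Longrightarrow> \<theta> i \<in> borel_measurable (F (u i))"
    "u 0 = a" "\<And>i. i < N \<Longrightarrow> u i \<le> u (Suc i)"
    "\<And>i. i < N \<Longrightarrow> \<exists>B. \<forall>\<omega>\<in>space M. \<bar>\<theta> i \<omega>\<bar> \<le> B"
    "\<And>\<omega>. simple_integral W K r \<omega> - simple_integral W K a \<omega> - c \<omega> * (W r \<omega> - W a \<omega>)
       = (\<Sum>i<N. \<theta> i \<omega> * (W (u (Suc i)) \<omega> - W (u i) \<omega>))"
    "\<And>\<omega>. ennreal (\<Sum>i<N. (\<theta> i \<omega>)\<^sup>2 * (u (Suc i) - u i))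
       = (\<integral>\<^sup>+t. ennreal ((simple_process K t \<omega> - c \<omega>)\<^sup>2) * indicator {a<..r} t \<partial>lborel)"
proof -
  obtain m s \<phi> where Kdef: "K = (m, s, \<phi>)" by (cases K) auto
  have s0: "0 \<le> s 0" and s: "\<And>i. i < m \<Longrightarrow> s i \<le> s (Suc i)"
    and \<phi>: "\<And>i. i < m \<Longrightarrow> \<phi> i \<in> borel_measurable (F (s i))"
    and \<phi>b: "\<And>i. i < m \<Longrightarrow> bounded (\<phi> i ` space M)"
    using K by (auto simp: simple_integrands_def Kdef)
  have smono: "s i \<le> s j" if "i \<le> j" "j \<le> m" for i j
    using that
  proof (induction j)
    case (Suc j)
    then show ?case using s[of j] by (cases "i = Suc j") auto
  qed simp
  have s_nn: "0 \<le> s i" if "i \<le> m" for i using smono[of 0 i] s0 that by simp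
  define cl where "cl x = max a (min r x)" for x :: real
  have cl: "a \<le> cl x" "cl x \<le> r" for x using ar by (auto simp: cl_def)
  have cl_mono: "cl x \<le> cl y" if "x \<le> y" for x y using that by (auto simp: cl_def)
  define u where "u i = (case i of 0 \<Rightarrow> a | Suc j \<Rightarrow> if j \<le> m then cl (s j) else r)" for i
  \<comment> \<open>Cells beyond \<open>r\<close> have length zero after truncation, but there \<open>\<phi> j\<close> need not be known at time \<open>r\<close>;
    hence the guard \<open>s j < r\<close>.\<close>
  define \<psi> where "\<psi> i \<omega> = (case i of 0 \<Rightarrow> 0 | Suc j \<Rightarrow> if j < m \<and> s j < r then \<phi> j \<omega> else 0)" for i \<omega>
  define \<theta> where "\<theta> i \<omega> = \<psi> i \<omega> - c \<omega>" for i \<omega>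
  define N where "N = Suc (Suc m)"
  have u_le: "u i \<le> u (Suc i)" if "i < N" for i
    using that cl cl_mono s by (auto simp: u_def N_def less_Suc_eq_le split: nat.split)
  have u_ge: "a \<le> u i" for i using cl ar by (auto simp: u_def split: nat.split)
  have \<theta>m: "\<theta> i \<in> borel_measurable (F (u i))" if i: "i < N" for i
  proof -
    have "c \<in> borel_measurable (F (u i))" by (rule F_measurable_mono[OF ar(1) u_ge c(1)])
    moreover have "\<psi> i \<in> borel_measurable (F (u i))"
    proof (cases "\<exists>j. i = Suc j \<and> j < m \<and> s j < r")
      case True
      then obtain j where j: "i = Suc j" "j < m" "s j < r" by blast
      have "s j \<le> u i" using j by (auto simp: u_def cl_def)
      from F_measurable_mono[OF s_nn this \<phi>] j have "\<phi> j \<in> borel_measurable (F (u i))" by simp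
      moreover have "\<psi> i = \<phi> j" using j by (auto simp: \<psi>_def)
      ultimately show ?thesis by simp
    next
      case False
      then have "\<psi> i = (\<lambda>_. 0)" by (auto simp: \<psi>_def fun_eq_iff split: nat.split)
      then show ?thesis by simp
    qed
    ultimately show ?thesis unfolding \<theta>_def by simp
  qed
  have \<theta>b: "\<exists>B. \<forall>\<omega>\<in>space M. \<bar>\<theta> i \<omega>\<bar> \<le> B" if "i < N" for i
  proof -
    have "\<exists>B\<ge>0. \<forall>\<omega>\<in>space M. \<bar>\<psi> i \<omega>\<bar> \<le> B"
    proof (cases "\<exists>j. i = Suc j \<and> j < m \<and> s j < r")
      case True
      then obtain j where j: "i = Suc j" "j < m" "s j < r" by blast
      obtain B where B: "\<forall>x\<in>\<phi> j ` space M. norm x \<le> B" using \<phi>b[OF j(2)] unfolding bounded_iff by blast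
      show ?thesis
        by (rule exI[of _ "max B 0"]) (use j B in \<open>auto simp: \<psi>_def le_max_iff_disj\<close>)
    next
      case False
      then have "\<psi> i = (\<lambda>_. 0)" by (auto simp: \<psi>_def fun_eq_iff split: nat.split)
      then show ?thesis by auto
    qed
    then obtain B where B: "\<And>\<omega>. \<omega> \<in> space M \<Longrightarrow> \<bar>\<psi> i \<omega>\<bar> \<le> B" by blast
    have "\<bar>\<theta> i \<omega>\<bar> \<le> B + C" if "\<omega> \<in> space M" for \<omega>
      using B[OF that] c(2)[OF that] unfolding \<theta>_def by linarith
    then show ?thesis by blast
  qed
  have uN: "u N = r" by (simp add: u_def N_def)
  have uS: "u (Suc j) = cl (s j)" if "j \<le> m" for j using that by (simp add: u_def)
  have sum_eq: "simple_integral W K r \<omega> - simple_integral W K a \<omega> - c \<omega> * (W r \<omega> - W a \<omega>)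
       = (\<Sum>i<N. \<theta> i \<omega> * (W (u (Suc i)) \<omega> - W (u i) \<omega>))" for \<omega>
  proof -
    have W: "W (min r x) \<omega> - W (min a x) \<omega> = W (cl x) \<omega> - W a \<omega>" for x
      using ar by (auto simp: cl_def min_def max_def)
    have "simple_integral W K r \<omega> - simple_integral W K a \<omega> =
      (\<Sum>j<m. \<phi> j \<omega> * ((W (min r (s (Suc j))) \<omega> - W (min a (s (Suc j))) \<omega>) - (W (min r (s j)) \<omega> - W (min a (s j)) \<omega>)))"
      by (simp add: Kdef sum_subtractf[symmetric] algebra_simps)
    also have "\<dots> = (\<Sum>j<m. \<phi> j \<omega> * (W (cl (s (Suc j))) \<omega> - W (cl (s j)) \<omega>))"
      unfolding W by simp
    also have "\<dots> = (\<Sum>j<m. \<psi> (Suc j) \<omega> * (W (u (Suc (Suc j))) \<omega> - W (u (Suc j)) \<omega>))"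
    proof (intro sum.cong refl)
      fix j assume "j \<in> {..<m}"
      then have j: "j < m" by simp
      show "\<phi> j \<omega> * (W (cl (s (Suc j))) \<omega> - W (cl (s j)) \<omega>) = \<psi> (Suc j) \<omega> * (W (u (Suc (Suc j))) \<omega> - W (u (Suc j)) \<omega>)"
      proof (cases "s j < r")
        case True
        then show ?thesis using j uS[of j] uS[of "Suc j"] by (simp add: \<psi>_def)
      next
        case False
        then have "cl (s j) = r" "cl (s (Suc j)) = r" using s[OF j] ar by (auto simp: cl_def)
        then show ?thesis using False by (simp add: \<psi>_def)
      qed
    qed
    also have "\<dots> = (\<Sum>i<N. \<psi> i \<omega> * (W (u (Suc i)) \<omega> - W (u i) \<omega>))"
      unfolding N_def by (subst sum.lessThan_Suc, subst sum.lessThan_Suc_shift) (simp add: \<psi>_def)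
    finally have 1: "simple_integral W K r \<omega> - simple_integral W K a \<omega> = (\<Sum>i<N. \<psi> i \<omega> * (W (u (Suc i)) \<omega> - W (u i) \<omega>))" .
    have "(\<Sum>i<N. W (u (Suc i)) \<omega> - W (u i) \<omega>) = W (u N) \<omega> - W (u 0) \<omega>"
      by (rule sum_lessThan_telescope)
    then have 2: "c \<omega> * (W r \<omega> - W a \<omega>) = (\<Sum>i<N. c \<omega> * (W (u (Suc i)) \<omega> - W (u i) \<omega>))"
      unfolding uN by (simp add: sum_distrib_left[symmetric] u_def)
    show ?thesis unfolding 1 2 \<theta>_def by (simp add: sum_subtractf[symmetric] algebra_simps)
  qed
  have proc: "simple_process K t \<omega> - c \<omega> = \<theta> i \<omega>" if i: "i < N" and t: "u i < t" "t \<le> u (Suc i)" for i t \<omega>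
  proof -
    have sp: "simple_process K t \<omega> = (\<Sum>k<m. \<phi> k \<omega> * indicator {s k<..s (Suc k)} t)" by (simp add: Kdef)
    have ta: "a < t" using u_ge[of i] t by simp
    consider "i = 0" | j where "i = Suc j" "j < m" | "i = Suc m"
      using i by (cases i) (auto simp: N_def less_Suc_eq)
    then have "simple_process K t \<omega> = \<psi> i \<omega>"
    proof cases
      case 1
      then have "t \<le> s 0" using t uS[of 0] ta by (auto simp: cl_def)
      then have "indicator {s k<..s (Suc k)} t = (0::real)" if "k < m" for k
        using smono[of 0 k] that by (auto simp: indicator_def)
      then show ?thesis unfolding sp using 1 by (simp add: \<psi>_def)
    next
      case (2 j)
      have tj: "s j < t" "t \<le> s (Suc j)" "s j < r"
        using 2 t ta uS[of j] uS[of "Suc j"] cl(2)[of "s (Suc j)"] by (auto simp: cl_def split: if_splits)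
      have "indicator {s k<..s (Suc k)} t = (if k = j then 1 else 0 :: real)" if "k < m" for k
      proof (cases k j rule: linorder_cases)
        case less
        then show ?thesis using smono[of "Suc k" j] 2 tj by (auto simp: indicator_def)
      next
        case greater
        then show ?thesis using smono[of "Suc j" k] that tj by (auto simp: indicator_def)
      qed (use tj in auto)
      then have "simple_process K t \<omega> = (\<Sum>k<m. \<phi> k \<omega> * (if k = j then 1 else 0))"
        unfolding sp by (intro sum.cong) auto
      also have "\<dots> = \<phi> j \<omega>" using 2 by (simp add: if_distrib[of "\<lambda>x. _ * x"] cong: if_cong)
      finally show ?thesis using 2 tj by (simp add: \<psi>_def)
    next
      case 3
      then have "s m < t" using t uS[of m] ta by (auto simp: cl_def u_def split: if_splits)
      then have "indicator {s k<..s (Suc k)} t = (0::real)" if "k < m" for k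
        using smono[of "Suc k" m] that by (auto simp: indicator_def)
      then show ?thesis unfolding sp using 3 by (simp add: \<psi>_def)
    qed
    then show ?thesis by (simp add: \<theta>_def)
  qed
  have en: "ennreal (\<Sum>i<N. (\<theta> i \<omega>)\<^sup>2 * (u (Suc i) - u i))
       = (\<integral>\<^sup>+t. ennreal ((simple_process K t \<omega> - c \<omega>)\<^sup>2) * indicator {a<..r} t \<partial>lborel)" for \<omega>
  proof -
    have "(\<integral>\<^sup>+t. ennreal ((simple_process K t \<omega> - c \<omega>)\<^sup>2) * indicator {a<..r} t \<partial>lborel)
      = (\<integral>\<^sup>+t. (\<Sum>i<N. ennreal ((\<theta> i \<omega>)\<^sup>2) * indicator {u i<..u (Suc i)} t) \<partial>lborel)"
    proof (intro nn_integral_cong)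
      fix t
      have "(indicator {a<..r} t :: ennreal) = (\<Sum>i<N. indicator {u i<..u (Suc i)} t)"
        using sum_indicator_mono_partition[of N u t] u_le uN by (simp add: u_def)
      then have "ennreal ((simple_process K t \<omega> - c \<omega>)\<^sup>2) * indicator {a<..r} t
        = (\<Sum>i<N. ennreal ((simple_process K t \<omega> - c \<omega>)\<^sup>2) * indicator {u i<..u (Suc i)} t)"
        by (simp add: sum_distrib_left)
      also have "\<dots> = (\<Sum>i<N. ennreal ((\<theta> i \<omega>)\<^sup>2) * indicator {u i<..u (Suc i)} t)"
        using proc by (intro sum.cong) (auto simp: indicator_def)
      finally show "ennreal ((simple_process K t \<omega> - c \<omega>)\<^sup>2) * indicator {a<..r} t
        = (\<Sum>i<N. ennreal ((\<theta> i \<omega>)\<^sup>2) * indicator {u i<..u (Suc i)} t)" .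
    qed
    also have "\<dots> = (\<Sum>i<N. ennreal ((\<theta> i \<omega>)\<^sup>2) * ennreal (u (Suc i) - u i))"
      using u_le by (subst nn_integral_sum) (auto intro!: sum.cong simp: nn_integral_cmult)
    also have "\<dots> = ennreal (\<Sum>i<N. (\<theta> i \<omega>)\<^sup>2 * (u (Suc i) - u i))"
      using u_le by (subst sum_ennreal[symmetric]) (auto simp: ennreal_mult)
    finally show ?thesis by simp
  qed
  show thesis
    by (rule that[of N \<theta> u]) (use u_le \<theta>m \<theta>b sum_eq en in \<open>auto simp: u_def\<close>)
qed

end

section \<open>Freezing the integrand of an Ito integral\<close>

context brownian_filtration begin

lemma path_continuous: "\<omega> \<in> space M \<Longrightarrow> continuous_on {0..} (\<lambda>t. W t \<omega>)"
  using bm by (auto simp: brownian_motion_def)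

lemma simple_integrand_parts:
  assumes "K \<in> simple_integrands M F T"
  obtains m s \<phi> where "K = (m, s, \<phi>)" "\<And>i. i \<le> m \<Longrightarrow> 0 \<le> s i"
    "\<And>i. i < m \<Longrightarrow> \<phi> i \<in> borel_measurable M"
proof -
  obtain m s \<phi> where K: "K = (m, s, \<phi>)" by (cases K) auto
  have s: "0 \<le> s i" if "i \<le> m" for i
    using that
  proof (induction i)
    case (Suc i)
    then have "0 \<le> s i" "s i \<le> s (Suc i)" using assms by (auto simp: simple_integrands_def K)
    then show ?case by simp
  qed (use assms in \<open>simp add: simple_integrands_def K\<close>)
  have "\<phi> i \<in> borel_measurable M" if "i < m" for i
    using F_measurable_M[OF s, of i "\<phi> i"] that assms by (auto simp: simple_integrands_def K)
  with K s show thesis by (rule that)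
qed

lemma simple_process_measurable:
  assumes "K \<in> simple_integrands M F T"
  shows "(\<lambda>p. simple_process K (fst p) (snd p)) \<in> borel_measurable (borel \<Otimes>\<^sub>M M)"
proof -
  obtain m s \<phi> where K: "K = (m, s, \<phi>)" and \<phi>: "\<And>i. i < m \<Longrightarrow> \<phi> i \<in> borel_measurable M"
    using assms by (rule simple_integrand_parts) blast
  have "(\<lambda>p. \<phi> i (snd p) * indicator {s i<..s (Suc i)} (fst p)) \<in> borel_measurable (borel \<Otimes>\<^sub>M M)"
    if "i < m" for i
    by (intro borel_measurable_times measurable_compose[OF measurable_snd \<phi>[OF that]]
          measurable_compose[OF measurable_fst borel_measurable_indicator]) auto
  then show ?thesis unfolding K simple_process.simps by (intro borel_measurable_sum) simp
qed

text \<open>Convergence in probability gives a bound on the exceptional events only if these are measurable;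
  this lemma and the next one establish it for the two errors in the definition of the Ito integral.\<close>
lemma approximation_error_measurable:
  assumes K: "K \<in> simple_integrands M F T" and H: "progressively_measurable F T H" and T: "0 \<le> T"
  shows "(\<lambda>\<omega>. \<integral>\<^sup>+ s\<in>{0..T}. ennreal ((simple_process K s \<omega> - H s \<omega>)\<^sup>2) \<partial>lborel) \<in> borel_measurable M"
    and "\<omega> \<in> space M \<Longrightarrow> (\<lambda>s. ennreal ((simple_process K s \<omega> - H s \<omega>)\<^sup>2) * indicator {0..T} s) \<in> borel_measurable lborel"
proof -
  let ?R = "restrict_space lborel {0..T}"
  interpret R: sigma_finite_measure ?R by (rule sigma_finite_measure_restrict_space) (auto intro: sigma_finite_lborel)
  have id: "(\<lambda>\<omega>. \<omega>) \<in> M \<rightarrow>\<^sub>M F T" by (rule id_measurable_F[OF T])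
  have "(\<lambda>p. (snd p, fst p)) \<in> M \<Otimes>\<^sub>M ?R \<rightarrow>\<^sub>M restrict_space borel {0..T} \<Otimes>\<^sub>M F T"
    by (intro measurable_Pair measurable_compose[OF measurable_fst id])
       (auto intro!: measurable_compose[OF measurable_snd] measurable_ident_sets sets_restrict_space_cong)
  from measurable_compose[OF this, of "\<lambda>(s, \<omega>). H s \<omega>" borel] H T
  have Hm: "(\<lambda>p. H (snd p) (fst p)) \<in> borel_measurable (M \<Otimes>\<^sub>M ?R)"
    by (simp add: progressively_measurable_def)
  have "(\<lambda>p. (snd p, fst p)) \<in> M \<Otimes>\<^sub>M ?R \<rightarrow>\<^sub>M borel \<Otimes>\<^sub>M M"
    by (intro measurable_Pair measurable_fst measurable_compose[OF measurable_snd])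
       (auto intro!: measurable_restrict_space1)
  from measurable_compose[OF this simple_process_measurable[OF K]]
  have Km: "(\<lambda>p. simple_process K (snd p) (fst p)) \<in> borel_measurable (M \<Otimes>\<^sub>M ?R)" by simp
  have m: "(\<lambda>(\<omega>, s). ennreal ((simple_process K s \<omega> - H s \<omega>)\<^sup>2)) \<in> borel_measurable (M \<Otimes>\<^sub>M ?R)"
    unfolding case_prod_beta using Hm Km by measurable
  from R.borel_measurable_nn_integral[OF m]
  show "(\<lambda>\<omega>. \<integral>\<^sup>+ s\<in>{0..T}. ennreal ((simple_process K s \<omega> - H s \<omega>)\<^sup>2) \<partial>lborel) \<in> borel_measurable M"
    by (simp add: nn_integral_restrict_space)
  assume "\<omega> \<in> space M"
  from measurable_Pair2[OF m this]
  show "(\<lambda>s. ennreal ((simple_process K s \<omega> - H s \<omega>)\<^sup>2) * indicator {0..T} s) \<in> borel_measurable lborel"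
    by (subst (asm) borel_measurable_restrict_space_iff_ennreal) auto
qed

lemma uniform_error_measurable:
  assumes K: "K \<in> simple_integrands M F T" and I: "continuous_adapted M F T I" and T: "0 \<le> T"
  shows "(\<lambda>\<omega>. SUP t\<in>{0..T}. ennreal \<bar>simple_integral W K t \<omega> - I t \<omega>\<bar>) \<in> borel_measurable M"
proof -
  obtain m s \<phi> where Kdef: "K = (m, s, \<phi>)" and s: "\<And>i. i \<le> m \<Longrightarrow> 0 \<le> s i"
    and \<phi>: "\<And>i. i < m \<Longrightarrow> \<phi> i \<in> borel_measurable M"
    using K by (rule simple_integrand_parts) blast
  let ?cl = "\<lambda>q. max 0 (min T q)"
  have cont: "continuous_on {0..T} (\<lambda>t. \<bar>simple_integral W K t \<omega> - I t \<omega>\<bar>)" if \<omega>: "\<omega> \<in> space M" for \<omega>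
  proof -
    have W: "continuous_on {0..T} (\<lambda>t. W (min t x) \<omega>)" if "0 \<le> x" for x
      by (rule continuous_on_compose2[OF path_continuous[OF \<omega>]]) (use that in \<open>auto intro!: continuous_intros\<close>)
    have "continuous_on {0..T} (\<lambda>t. simple_integral W K t \<omega>)"
      unfolding Kdef simple_integral.simps by (intro continuous_intros W s) auto
    then show ?thesis using I \<omega> by (auto simp: continuous_adapted_def intro!: continuous_intros)
  qed
  have meas: "(\<lambda>\<omega>. ennreal \<bar>simple_integral W K t \<omega> - I t \<omega>\<bar>) \<in> borel_measurable M" if t: "t \<in> {0..T}" for t
  proof -
    have "I t \<in> borel_measurable M" by (rule F_measurable_M[of t]) (use t I in \<open>auto simp: continuous_adapted_def\<close>)
    moreover have "simple_integral W K t \<in> borel_measurable M"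
      unfolding Kdef simple_integral.simps
      by (intro borel_measurable_sum borel_measurable_times borel_measurable_diff \<phi> W_measurable) (use t s in auto)
    ultimately show ?thesis by simp
  qed
  have "(\<lambda>\<omega>. SUP q\<in>\<rat>. ennreal \<bar>simple_integral W K (?cl q) \<omega> - I (?cl q) \<omega>\<bar>) \<in> borel_measurable M"
    using meas T by (intro borel_measurable_SUP countable_rat) auto
  also have "?this \<longleftrightarrow> ?thesis"
    by (intro measurable_cong continuous_SUP_eq_rational_SUP[symmetric] cont T)
  finally show ?thesis .
qed

text \<open>On \<open>G\<close> the integrand is uniformly \<open>\<epsilon>\<close>-close to \<open>c\<close>, so for a good simple approximation \<open>K\<close> the energy of
  \<open>K - c\<close> is at most four times \<open>\<epsilon>\<^sup>2 * (r - a)\<close> and stopping at this level changes nothing on \<open>G\<close>.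
  Truncation at \<open>R\<close> makes the vanishing exceptional events harmless.\<close>
lemma ito_integral_truncated_bound:
  assumes ito: "is_ito_integral M F W T H I" and ar: "0 \<le> a" "a < r" "r \<le> T"
    and c: "c \<in> borel_measurable (F a)" "\<And>\<omega>. \<omega> \<in> space M \<Longrightarrow> \<bar>c \<omega>\<bar> \<le> C"
    and G: "G \<in> sets M" and e: "0 < \<epsilon>"
    and close: "\<And>\<omega> t. \<omega> \<in> G \<Longrightarrow> a < t \<Longrightarrow> t \<le> r \<Longrightarrow> \<bar>H t \<omega> - c \<omega>\<bar> \<le> \<epsilon>"
    and R: "0 \<le> R"
  shows "(\<integral>\<^sup>+\<omega>. ennreal (min \<bar>I r \<omega> - I a \<omega> - c \<omega> * (W r \<omega> - W a \<omega>)\<bar> R) * indicator G \<omega> \<partial>M)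
    \<le> ennreal (2 * \<epsilon> * sqrt (r - a))"
proof -
  let ?J = "\<lambda>\<omega>. I r \<omega> - I a \<omega> - c \<omega> * (W r \<omega> - W a \<omega>)"
  let ?L = "\<integral>\<^sup>+\<omega>. ennreal (min \<bar>?J \<omega>\<bar> R) * indicator G \<omega> \<partial>M"
  have T: "0 \<le> T" using ar by simp
  have H: "progressively_measurable F T H" and I: "continuous_adapted M F T I"
    using ito by (auto simp: is_ito_integral_def)
  obtain K where K: "\<And>n. K n \<in> simple_integrands M F T"
    and lim1: "tendsto_zero_in_prob M (\<lambda>n \<omega>. \<integral>\<^sup>+ s\<in>{0..T}. ennreal ((simple_process (K n) s \<omega> - H s \<omega>)\<^sup>2) \<partial>lborel)"
    and lim2: "tendsto_zero_in_prob M (\<lambda>n \<omega>. SUP t\<in>{0..T}. ennreal \<bar>simple_integral W (K n) t \<omega> - I t \<omega>\<bar>)"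
    using ito by (auto simp: is_ito_integral_def)
  define E1 where "E1 n \<omega> = (\<integral>\<^sup>+ s\<in>{0..T}. ennreal ((simple_process (K n) s \<omega> - H s \<omega>)\<^sup>2) \<partial>lborel)" for n \<omega>
  define E2 where "E2 n \<omega> = (SUP t\<in>{0..T}. ennreal \<bar>simple_integral W (K n) t \<omega> - I t \<omega>\<bar>)" for n \<omega>
  have E1m [measurable]: "E1 n \<in> borel_measurable M" for n
    unfolding E1_def by (rule approximation_error_measurable(1)[OF K H T])
  have E2m [measurable]: "E2 n \<in> borel_measurable M" for n
    unfolding E2_def by (rule uniform_error_measurable[OF K I T])
  have [measurable]: "I r \<in> borel_measurable M" "I a \<in> borel_measurable M"
    by (rule F_measurable_M[of r], use ar I in \<open>auto simp: continuous_adapted_def\<close>)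
       (rule F_measurable_M[of a], use ar I in \<open>auto simp: continuous_adapted_def\<close>)
  have [measurable]: "c \<in> borel_measurable M" by (rule F_measurable_M[OF ar(1) c(1)])
  have [measurable]: "W r \<in> borel_measurable M" "W a \<in> borel_measurable M" using ar by auto
  note [measurable] = G
  \<comment> \<open>A bound for the energy of \<open>H - c\<close> on \<open>G\<close>; approximations within the same bound are good enough.\<close>
  define \<theta> where "\<theta> = \<epsilon>\<^sup>2 * (r - a)"
  have \<theta>: "0 < \<theta>" using e ar by (simp add: \<theta>_def)
  have sq: "sqrt (4 * \<theta>) = 2 * \<epsilon> * sqrt (r - a)"
    using e by (simp add: \<theta>_def real_sqrt_mult)
  have main: "?L \<le> ennreal (2 * \<epsilon> * sqrt (r - a) + 2 * d + R * (measure M {\<omega>\<in>space M. ennreal \<theta> < E1 n \<omega>} + measure M {\<omega>\<in>space M. ennreal d < E2 n \<omega>}))"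
    if d: "0 < d" for d n
  proof -
    let ?B1 = "{\<omega>\<in>space M. ennreal \<theta> < E1 n \<omega>}" and ?B2 = "{\<omega>\<in>space M. ennreal d < E2 n \<omega>}"
    obtain N \<phi> u where \<phi>: "\<And>i. i < N \<Longrightarrow> \<phi> i \<in> borel_measurable (F (u i))"
      and u0: "u 0 = a" and u: "\<And>i. i < N \<Longrightarrow> u i \<le> u (Suc i)"
      and \<phi>b: "\<And>i. i < N \<Longrightarrow> \<exists>B. \<forall>\<omega>\<in>space M. \<bar>\<phi> i \<omega>\<bar> \<le> B"
      and tr: "\<And>\<omega>. simple_integral W (K n) r \<omega> - simple_integral W (K n) a \<omega> - c \<omega> * (W r \<omega> - W a \<omega>)
         = (\<Sum>i<N. \<phi> i \<omega> * (W (u (Suc i)) \<omega> - W (u i) \<omega>))"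
      and en: "\<And>\<omega>. ennreal (\<Sum>i<N. (\<phi> i \<omega>)\<^sup>2 * (u (Suc i) - u i))
         = (\<integral>\<^sup>+t. ennreal ((simple_process (K n) t \<omega> - c \<omega>)\<^sup>2) * indicator {a<..r} t \<partial>lborel)"
      by (rule simple_increment_as_transform[OF K[of n] ar(1,2) c(1)]) (erule c(2), rule that)
    have u0': "0 \<le> u 0" using u0 ar by simp
    have v: "0 \<le> 4 * \<theta>" using \<theta> by simp
    obtain S where S: "S \<in> borel_measurable M" "integrable M S" "(\<integral>\<omega>. \<bar>S \<omega>\<bar> \<partial>M) \<le> sqrt (4 * \<theta>)"
      and Seq: "\<And>\<omega>. (\<Sum>i<N. (\<phi> i \<omega>)\<^sup>2 * (u (Suc i) - u i)) \<le> 4 * \<theta> \<Longrightarrow>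
        S \<omega> = (\<Sum>i<N. \<phi> i \<omega> * (W (u (Suc i)) \<omega> - W (u i) \<omega>))"
      by (rule stopped_transform[where N=N and u=u and \<theta>=\<phi>, OF u0' u \<phi> \<phi>b v]) (assumption | rule that)+
    note [measurable] = S(1)
    have pt: "ennreal (min \<bar>?J \<omega>\<bar> R) * indicator G \<omega> \<le> ennreal (\<bar>S \<omega>\<bar> + 2 * d + R * (indicator ?B1 \<omega> + indicator ?B2 \<omega>))"
      if \<omega>: "\<omega> \<in> space M" for \<omega>
    proof (cases "\<omega> \<in> G \<and> \<omega> \<notin> ?B1 \<and> \<omega> \<notin> ?B2")
      case True
      then have \<omega>G: "\<omega> \<in> G" and e1: "E1 n \<omega> \<le> ennreal \<theta>" and e2: "E2 n \<omega> \<le> ennreal d" using \<omega> by auto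
      have "ennreal (\<Sum>i<N. (\<phi> i \<omega>)\<^sup>2 * (u (Suc i) - u i))
         = (\<integral>\<^sup>+t. ennreal ((simple_process (K n) t \<omega> - c \<omega>)\<^sup>2) * indicator {a<..r} t \<partial>lborel)" by (rule en)
      also have "\<dots> \<le> (\<integral>\<^sup>+t. 2 * (ennreal ((simple_process (K n) t \<omega> - H t \<omega>)\<^sup>2) * indicator {0..T} t) + ennreal (2 * \<epsilon>\<^sup>2) * indicator {a<..r} t \<partial>lborel)"
      proof (rule nn_integral_mono)
        fix t
        show "ennreal ((simple_process (K n) t \<omega> - c \<omega>)\<^sup>2) * indicator {a<..r} t
          \<le> 2 * (ennreal ((simple_process (K n) t \<omega> - H t \<omega>)\<^sup>2) * indicator {0..T} t) + ennreal (2 * \<epsilon>\<^sup>2) * indicator {a<..r} t"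
        proof (cases "t \<in> {a<..r}")
          case True
          let ?x = "simple_process (K n) t \<omega> - H t \<omega>" and ?y = "H t \<omega> - c \<omega>"
          have "?y\<^sup>2 \<le> \<epsilon>\<^sup>2" using close[OF \<omega>G, of t] True e by (intro abs_le_square_iff[THEN iffD1]) auto
          moreover have "(?x + ?y)\<^sup>2 \<le> 2 * ?x\<^sup>2 + 2 * ?y\<^sup>2"
            using zero_le_power2[of "?x - ?y"] by (simp add: power2_eq_square algebra_simps)
          ultimately have "(simple_process (K n) t \<omega> - c \<omega>)\<^sup>2 \<le> 2 * ?x\<^sup>2 + 2 * \<epsilon>\<^sup>2" by simp
          then have "ennreal ((simple_process (K n) t \<omega> - c \<omega>)\<^sup>2) \<le> ennreal (2 * ?x\<^sup>2 + 2 * \<epsilon>\<^sup>2)" by (rule ennreal_leI)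
          also have "\<dots> = 2 * ennreal (?x\<^sup>2) + ennreal (2 * \<epsilon>\<^sup>2)" by (simp add: ennreal_plus ennreal_mult)
          finally show ?thesis using True ar by (simp add: indicator_def)
        qed simp
      qed
      also have "\<dots> = 2 * E1 n \<omega> + ennreal (2 * \<epsilon>\<^sup>2) * ennreal (r - a)"
        unfolding E1_def using approximation_error_measurable(2)[OF K H T \<omega>] ar
        by (subst nn_integral_add) (auto simp: nn_integral_cmult)
      also have "\<dots> \<le> 2 * ennreal \<theta> + ennreal (2 * \<epsilon>\<^sup>2) * ennreal (r - a)"
        by (intro add_right_mono mult_left_mono e1) simp
      also have "\<dots> = ennreal (4 * \<theta>)"
        using ar \<theta> by (simp add: ennreal_mult[symmetric] ennreal_plus[symmetric] \<theta>_def flip: ennreal_numeral del: ennreal_plus)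
      finally have "(\<Sum>i<N. (\<phi> i \<omega>)\<^sup>2 * (u (Suc i) - u i)) \<le> 4 * \<theta>" using \<theta> by (subst (asm) ennreal_le_iff) auto
      then have S': "S \<omega> = simple_integral W (K n) r \<omega> - simple_integral W (K n) a \<omega> - c \<omega> * (W r \<omega> - W a \<omega>)"
        using Seq tr by simp
      have err: "\<bar>simple_integral W (K n) t \<omega> - I t \<omega>\<bar> \<le> d" if t: "t \<in> {0..T}" for t
      proof -
        have "ennreal \<bar>simple_integral W (K n) t \<omega> - I t \<omega>\<bar> \<le> E2 n \<omega>" unfolding E2_def by (rule SUP_upper[OF t])
        then have "ennreal \<bar>simple_integral W (K n) t \<omega> - I t \<omega>\<bar> \<le> ennreal d" using e2 by (rule order_trans)
        then show ?thesis using d by (subst (asm) ennreal_le_iff) auto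
      qed
      have "\<bar>?J \<omega>\<bar> \<le> \<bar>S \<omega>\<bar> + 2 * d" using err[of r] err[of a] ar unfolding S' by auto
      then have "min \<bar>?J \<omega>\<bar> R \<le> \<bar>S \<omega>\<bar> + 2 * d + R * (indicator ?B1 \<omega> + indicator ?B2 \<omega>)" using True by simp
      then show ?thesis using \<omega>G by (simp add: ennreal_leI)
    next
      case False
      show ?thesis
      proof (cases "\<omega> \<in> G")
        case True
        then have "1 \<le> (indicator ?B1 \<omega> + indicator ?B2 \<omega> :: real)" using False by (auto simp: indicator_def)
        then have "R \<le> R * (indicator ?B1 \<omega> + indicator ?B2 \<omega>)" using R by (simp add: mult_le_cancel_left1)
        then have "min \<bar>?J \<omega>\<bar> R \<le> \<bar>S \<omega>\<bar> + 2 * d + R * (indicator ?B1 \<omega> + indicator ?B2 \<omega>)"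
          using d by linarith
        then show ?thesis using True by (simp add: ennreal_leI)
      qed simp
    qed
    have "?L \<le> (\<integral>\<^sup>+\<omega>. ennreal (\<bar>S \<omega>\<bar> + 2 * d + R * (indicator ?B1 \<omega> + indicator ?B2 \<omega>)) \<partial>M)"
      by (intro nn_integral_mono pt)
    also have "\<dots> = ennreal (\<integral>\<omega>. \<bar>S \<omega>\<bar> + 2 * d + R * (indicator ?B1 \<omega> + indicator ?B2 \<omega>) \<partial>M)"
      using S(2) d R by (intro nn_integral_eq_integral) (auto intro!: Bochner_Integration.integrable_add integrable_mult_right integrable_real_indicator simp: less_top[symmetric])
    also have "(\<integral>\<omega>. \<bar>S \<omega>\<bar> + 2 * d + R * (indicator ?B1 \<omega> + indicator ?B2 \<omega>) \<partial>M) = (\<integral>\<omega>. \<bar>S \<omega>\<bar> \<partial>M) + 2 * d + R * (measure M ?B1 + measure M ?B2)"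
      using S(2) by (simp add: prob_space Bochner_Integration.integral_add integrable_real_indicator less_top[symmetric])
    also have "ennreal \<dots> \<le> ennreal (2 * \<epsilon> * sqrt (r - a) + 2 * d + R * (measure M ?B1 + measure M ?B2))"
      using S(3) sq by (intro ennreal_leI) simp
    finally show ?thesis .
  qed
  have lim: "?L \<le> ennreal (2 * \<epsilon> * sqrt (r - a)) + ennreal d'" if d': "0 < d'" for d'
  proof -
    let ?d = "d' / 2"
    have "(\<lambda>n. 2 * \<epsilon> * sqrt (r - a) + 2 * ?d + R * (measure M {\<omega>\<in>space M. ennreal \<theta> < E1 n \<omega>} + measure M {\<omega>\<in>space M. ennreal ?d < E2 n \<omega>}))
      \<longlonglongrightarrow> 2 * \<epsilon> * sqrt (r - a) + 2 * ?d + R * (0 + 0)"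
      using lim1 lim2 \<theta> d' unfolding tendsto_zero_in_prob_def E1_def E2_def
      by (intro tendsto_intros) auto
    then have "(\<lambda>n. ennreal (2 * \<epsilon> * sqrt (r - a) + 2 * ?d + R * (measure M {\<omega>\<in>space M. ennreal \<theta> < E1 n \<omega>} + measure M {\<omega>\<in>space M. ennreal ?d < E2 n \<omega>})))
      \<longlonglongrightarrow> ennreal (2 * \<epsilon> * sqrt (r - a) + 2 * ?d + R * (0 + 0))" by (rule tendsto_ennrealI)
    then have "?L \<le> ennreal (2 * \<epsilon> * sqrt (r - a) + 2 * ?d + R * (0 + 0))"
      by (rule LIMSEQ_le_const) (use main[of ?d] d' in auto)
    also have "\<dots> = ennreal (2 * \<epsilon> * sqrt (r - a)) + ennreal d'"
      using e ar d' by (simp add: ennreal_plus)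
    finally show ?thesis .
  qed
  show ?thesis by (rule ennreal_le_epsilon) (rule lim)
qed

text \<open>On an event where the integrand stays close to a value known at the left endpoint, the stochastic
  integral is linear in \<open>W\<close> up to a small multiple of the square root of the length. The truncated
  bound passes to the limit by monotone convergence.\<close>
lemma ito_integral_frozen_integrand_bound:
  assumes ito: "is_ito_integral M F W T H I" and ar: "0 \<le> a" "a < r" "r \<le> T"
    and c: "c \<in> borel_measurable (F a)" "\<And>\<omega>. \<omega> \<in> space M \<Longrightarrow> \<bar>c \<omega>\<bar> \<le> C"
    and G: "G \<in> sets M" and e: "0 < \<epsilon>"
    and close: "\<And>\<omega> t. \<omega> \<in> G \<Longrightarrow> a < t \<Longrightarrow> t \<le> r \<Longrightarrow> \<bar>H t \<omega> - c \<omega>\<bar> \<le> \<epsilon>"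
  shows "(\<integral>\<^sup>+\<omega>. ennreal \<bar>I r \<omega> - I a \<omega> - c \<omega> * (W r \<omega> - W a \<omega>)\<bar> * indicator G \<omega> \<partial>M)
    \<le> ennreal (2 * \<epsilon> * sqrt (r - a))"
proof -
  let ?J = "\<lambda>\<omega>. I r \<omega> - I a \<omega> - c \<omega> * (W r \<omega> - W a \<omega>)"
  have I: "continuous_adapted M F T I" using ito by (auto simp: is_ito_integral_def)
  have [measurable]: "I r \<in> borel_measurable M" "I a \<in> borel_measurable M"
    by (rule F_measurable_M[of r], use ar I in \<open>auto simp: continuous_adapted_def\<close>)
       (rule F_measurable_M[of a], use ar I in \<open>auto simp: continuous_adapted_def\<close>)
  have [measurable]: "c \<in> borel_measurable M" by (rule F_measurable_M[OF ar(1) c(1)])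
  have [measurable]: "W r \<in> borel_measurable M" "W a \<in> borel_measurable M" using ar by auto
  note [measurable] = G
  have "(\<integral>\<^sup>+\<omega>. ennreal \<bar>?J \<omega>\<bar> * indicator G \<omega> \<partial>M) \<le> (\<integral>\<^sup>+\<omega>. (SUP k. ennreal (min \<bar>?J \<omega>\<bar> (real k)) * indicator G \<omega>) \<partial>M)"
  proof (rule nn_integral_mono)
    fix \<omega>
    obtain k :: nat where "\<bar>?J \<omega>\<bar> \<le> real k" using real_arch_simple by blast
    then show "ennreal \<bar>?J \<omega>\<bar> * indicator G \<omega> \<le> (SUP k. ennreal (min \<bar>?J \<omega>\<bar> (real k)) * indicator G \<omega>)"
      by (intro SUP_upper2[of k]) (auto simp: min_absorb1)
  qed
  also have "\<dots> = (SUP k. \<integral>\<^sup>+\<omega>. ennreal (min \<bar>?J \<omega>\<bar> (real k)) * indicator G \<omega> \<partial>M)"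
    by (rule nn_integral_monotone_convergence_SUP)
       (auto simp: incseq_def le_fun_def intro!: mult_right_mono ennreal_leI)
  also have "\<dots> \<le> ennreal (2 * \<epsilon> * sqrt (r - a))"
    by (intro SUP_least ito_integral_truncated_bound[OF ito ar c G e close]) auto
  finally show ?thesis .
qed

end

section \<open>Window averages in \<open>L\<^sup>1\<close>\<close>

text \<open>Integrals over windows are the observables through which the \<open>L\<^sup>1\<close>-distance is bounded from
  below. Unlike point evaluations they are continuous on \<open>L\<^sup>1\<close>.\<close>
lemma sum_interval_integrals_le_L1_norm:
  assumes f: "f \<in> L1_space T" and J: "finite J" "disjoint_family_on D J"
    "\<And>i. i \<in> J \<Longrightarrow> D i \<in> sets borel" "\<And>i. i \<in> J \<Longrightarrow> D i \<subseteq> {0..T}"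
  shows "(\<Sum>i\<in>J. \<bar>LINT s:D i|lborel. f s\<bar>) \<le> L1_norm T f"
proof -
  have f': "set_integrable lborel {0..T} f" using f by (simp add: L1_space_def)
  have int: "set_integrable lborel (D i) f" if "i \<in> J" for i
    by (rule set_integrable_subset[OF f']) (use that J in auto)
  have "(\<Sum>i\<in>J. \<bar>LINT s:D i|lborel. f s\<bar>) \<le> (\<Sum>i\<in>J. LINT s:D i|lborel. \<bar>f s\<bar>)"
    by (intro sum_mono) (use set_integral_norm_bound[OF int] in simp)
  also have "\<dots> = (LINT s:(\<Union>i\<in>J. D i)|lborel. \<bar>f s\<bar>)"
    by (rule set_integral_finite_Union[symmetric]) (use J set_integrable_abs[OF int] in auto)
  also have "\<dots> \<le> L1_norm T f"
    unfolding L1_norm_def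
    unfolding set_lebesgue_integral_def
  proof (rule integral_mono)
    show "integrable lborel (\<lambda>s. indicator (\<Union>i\<in>J. D i) s *\<^sub>R \<bar>f s\<bar>)"
    proof -
      have "(\<Union>i\<in>J. D i) \<in> sets lborel" using J(1,3) by (simp add: sets.finite_UN)
      moreover have "(\<Union>i\<in>J. D i) \<subseteq> {0..T}" using J(4) by blast
      ultimately show ?thesis
        using set_integrable_subset[OF set_integrable_abs[OF f']] by (simp add: set_integrable_def)
    qed
    show "integrable lborel (\<lambda>s. indicator {0..T} s *\<^sub>R \<bar>f s\<bar>)"
      using set_integrable_abs[OF f'] by (simp add: set_integrable_def)
  qed (use J(4) in \<open>force simp: indicator_def\<close>)
  finally show ?thesis .
qed

lemma interval_integral_L1_borel_measurable:
  assumes D: "D \<in> sets borel" "D \<subseteq> {0..T}"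
  shows "(\<lambda>f. LINT s:D|lborel. f s) \<in> borel_measurable (L1_borel T)"
proof (rule borel_measurableI)
  fix U :: "real set" assume U: "open U"
  have sp: "space (L1_borel T) = L1_space T" by (simp add: L1_borel_def space_measure_of_conv)
  let ?A = "\<lambda>f. LINT s:D|lborel. f s"
  have "L1_open T (?A -` U \<inter> L1_space T)"
    unfolding L1_open_def
  proof safe
    fix f assume f: "f \<in> L1_space T" "?A f \<in> U"
    then obtain e where e: "0 < e" "ball (?A f) e \<subseteq> U" using U by (meson openE)
    have "?A h \<in> U" if h: "h \<in> L1_space T" "L1_norm T (\<lambda>x. h x - f x) < e" for h
    proof -
      have int: "set_integrable lborel D f" "set_integrable lborel D h"
        using f(1) h(1) D set_integrable_subset[of lborel "{0..T}" _ D] by (auto simp: L1_space_def)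
      have "(\<lambda>x. h x - f x) \<in> L1_space T" using f(1) h(1) by (simp add: L1_space_def set_integral_diff)
      from sum_interval_integrals_le_L1_norm[OF this, of "{()}" "\<lambda>_. D"] D
      have "\<bar>?A (\<lambda>x. h x - f x)\<bar> \<le> L1_norm T (\<lambda>x. h x - f x)" by (simp add: disjoint_family_on_def)
      also have "?A (\<lambda>x. h x - f x) = ?A h - ?A f" using int by (simp add: set_integral_diff)
      finally have "?A h \<in> ball (?A f) e" using h(2) by (simp add: dist_real_def)
      with e show ?thesis by blast
    qed
    with e(1) show "\<exists>e>0. \<forall>h\<in>L1_space T. L1_norm T (\<lambda>x. h x - f x) < e \<longrightarrow> h \<in> ?A -` U \<inter> L1_space T" by blast
  qed
  then show "?A -` U \<inter> space (L1_borel T) \<in> sets (L1_borel T)"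
    unfolding sp by (auto simp: L1_borel_def L1_open_def intro!: in_measure_of)
qed

section \<open>Clamp and swing\<close>

definition clamp_sym :: "real \<Rightarrow> real \<Rightarrow> real" where
  "clamp_sym R x = max (- R) (min R x)"

lemma clamp_sym_bound: "0 \<le> R \<Longrightarrow> \<bar>clamp_sym R x\<bar> \<le> R"
  by (auto simp: clamp_sym_def)

lemma clamp_sym_lipschitz: "\<bar>clamp_sym R x - clamp_sym R y\<bar> \<le> \<bar>x - y\<bar>"
  by (auto simp: clamp_sym_def min_def max_def abs_if)

lemma clamp_sym_measurable [measurable]: "clamp_sym R \<in> borel_measurable borel"
  unfolding clamp_sym_def[abs_def] by measurable

text \<open>Detects whether the two halves of a cell move by at least \<open>q\<close> in opposite directions. Both orders are
  included, with opposite signs, to obtain antisymmetry.\<close>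
definition swing :: "real \<Rightarrow> real \<Rightarrow> real \<Rightarrow> real" where
  "swing q u v = (if q \<le> u \<and> v \<le> - q then 1 else 0) - (if q \<le> v \<and> u \<le> - q then 1 else 0)"

lemma swing_bound: "\<bar>swing q u v\<bar> \<le> 1"
  by (auto simp: swing_def)

lemma swing_antisymmetric: "swing q v u = - swing q u v"
  by (auto simp: swing_def)

lemma swing_measurable: "(\<lambda>(u, v). swing q u v) \<in> borel_measurable (borel \<Otimes>\<^sub>M borel)"
  unfolding swing_def by measurable

text \<open>Both events seen by \<open>swing\<close> contribute with the right sign: \<open>u\<close> and \<open>swing q u v\<close> have equal signs
  whenever the latter is nonzero, and \<open>sgn c\<close> compensates for the sign of the slope.\<close>
lemma clamp_swing_lower_bound:
  assumes q: "0 < q" and s: "0 < s" "s \<le> \<bar>c\<bar>"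
  shows "s * q * (if q \<le> u \<and> v \<le> - q then 1 else 0) \<le> clamp_sym (s * q) (c * u) * (sgn c * swing q u v)"
proof -
  have sq: "0 < s * q" using q s by simp
  have up: "clamp_sym (s * q) (c * x) * sgn c = s * q" if x: "q \<le> x" for x
  proof (cases "0 < c")
    case True
    then have "s * q \<le> c * x" using x q s by (intro mult_mono) auto
    then show ?thesis using True sq by (simp add: clamp_sym_def)
  next
    case False
    then have "c < 0" using s by auto
    then have "s * q \<le> - c * x" using x q s by (intro mult_mono) auto
    then show ?thesis using \<open>c < 0\<close> sq by (simp add: clamp_sym_def)
  qed
  have odd: "clamp_sym (s * q) (- y) = - clamp_sym (s * q) y" for y
    using sq by (auto simp: clamp_sym_def min_def max_def)
  have dn: "clamp_sym (s * q) (c * u) * sgn c = - (s * q)" if "u \<le> - q"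
    using up[of "- u"] odd[of "c * u"] that by simp
  consider "q \<le> u" "v \<le> - q" | "q \<le> v" "u \<le> - q" | "\<not> (q \<le> u \<and> v \<le> - q)" "\<not> (q \<le> v \<and> u \<le> - q)" by blast
  then show ?thesis
  proof cases
    case 1
    then show ?thesis using up[of u] q by (simp add: swing_def)
  next
    case 2
    then have "swing q u v = - 1" using q by (simp add: swing_def)
    moreover have "\<not> (q \<le> u \<and> v \<le> - q)" using 2 q by simp
    ultimately show ?thesis using dn 2 sq by (simp add: mult.assoc[symmetric])
  qed (auto simp: swing_def)
qed

section \<open>Linearisation of the solution\<close>

context brownian_filtration begin

text \<open>A continuous process is the limit of its discretisations in time, which take countably many time
  values.\<close>
lemma continuous_adapted_jointly_measurable:
  assumes X: "continuous_adapted M F T X" and T: "0 \<le> T"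
  shows "(\<lambda>p. X (max 0 (min T (fst p))) (snd p)) \<in> borel_measurable (borel \<Otimes>\<^sub>M M)"
proof -
  let ?cl = "\<lambda>s. max 0 (min T s)"
  define d where "d k s = real_of_int \<lfloor>real (Suc k) * s\<rfloor> / real (Suc k)" for k s
  have Xm: "X (?cl s) \<in> borel_measurable M" for s
    by (rule F_measurable_M[of "?cl s"]) (use X T in \<open>auto simp: continuous_adapted_def\<close>)
  have meas: "(\<lambda>p. X (?cl (d k (fst p))) (snd p)) \<in> borel_measurable (borel \<Otimes>\<^sub>M M)" for k
  proof -
    have "(\<lambda>p. X (?cl (real_of_int i / real (Suc k))) (snd p)) \<in> borel_measurable (borel \<Otimes>\<^sub>M M)" for i :: int
      by (rule measurable_compose[OF measurable_snd Xm])
    moreover have "(\<lambda>p. \<lfloor>real (Suc k) * fst p\<rfloor>) \<in> (borel \<Otimes>\<^sub>M M) \<rightarrow>\<^sub>M count_space UNIV" by measurable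
    ultimately show ?thesis unfolding d_def by (rule measurable_compose_countable)
  qed
  have dlim: "(\<lambda>k. d k s) \<longlonglongrightarrow> s" for s
  proof (rule tendsto_sandwich[of "\<lambda>k. s - inverse (real (Suc k))" _ _ "\<lambda>_. s"])
    show "\<forall>\<^sub>F k in sequentially. s - inverse (real (Suc k)) \<le> d k s"
    proof (intro always_eventually allI)
      fix k
      have "real (Suc k) * s - 1 \<le> real_of_int \<lfloor>real (Suc k) * s\<rfloor>" by linarith
      then have "(real (Suc k) * s - 1) / real (Suc k) \<le> d k s" unfolding d_def by (rule divide_right_mono) simp
      then show "s - inverse (real (Suc k)) \<le> d k s" by (simp add: field_simps)
    qed
    show "\<forall>\<^sub>F k in sequentially. d k s \<le> s"
      by (intro always_eventually allI) (simp add: d_def field_simps)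
    show "(\<lambda>k. s - inverse (real (Suc k))) \<longlonglongrightarrow> s"
      using tendsto_diff[OF tendsto_const LIMSEQ_inverse_real_of_nat, of s] by simp
  qed simp
  show ?thesis
  proof (rule borel_measurable_LIMSEQ_real[OF _ meas])
    fix p :: "real \<times> 'a" assume "p \<in> space (borel \<Otimes>\<^sub>M M)"
    then have "continuous_on {0..T} (\<lambda>t. X t (snd p))"
      using X by (auto simp: continuous_adapted_def space_pair_measure)
    moreover have "(\<lambda>k. ?cl (d k (fst p))) \<longlonglongrightarrow> ?cl (fst p)" by (intro tendsto_intros dlim)
    ultimately show "(\<lambda>k. X (?cl (d k (fst p))) (snd p)) \<longlonglongrightarrow> X (?cl (fst p)) (snd p)"
      by (rule continuous_on_tendsto_compose) (use T in auto)
  qed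
qed

lemma path_set_integrable:
  assumes "continuous_adapted M F T X" "\<omega> \<in> space M" "0 \<le> p" "q \<le> T"
  shows "set_integrable lborel {p..q} (\<lambda>s. X s \<omega>)"
  by (rule borel_integrable_atLeastAtMost')
     (use assms in \<open>auto simp: continuous_adapted_def intro: continuous_on_subset[of "{0..T}"]\<close>)

lemma path_integral_measurable:
  assumes X: "continuous_adapted M F T X" and pq: "0 \<le> p" "q \<le> T" and T: "0 \<le> T"
  shows "(\<lambda>\<omega>. LINT s:{p..q}|lborel. X s \<omega>) \<in> borel_measurable M"
proof -
  have m: "(\<lambda>(\<omega>, s). indicator {p..q} s *\<^sub>R X (max 0 (min T s)) \<omega>) \<in> borel_measurable (M \<Otimes>\<^sub>M lborel)"
  proof -
    have "(\<lambda>x. X (max 0 (min T (snd x))) (fst x)) \<in> borel_measurable (M \<Otimes>\<^sub>M lborel)"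
      using measurable_compose[OF _ continuous_adapted_jointly_measurable[OF X T], of "\<lambda>x. (snd x, fst x)"] by simp
    then show ?thesis unfolding case_prod_beta by measurable
  qed
  have "(\<lambda>\<omega>. LINT s:{p..q}|lborel. X (max 0 (min T s)) \<omega>) \<in> borel_measurable M"
    unfolding set_lebesgue_integral_def using lborel.borel_measurable_lebesgue_integral[OF m] by simp
  also have "(\<lambda>\<omega>. LINT s:{p..q}|lborel. X (max 0 (min T s)) \<omega>) = (\<lambda>\<omega>. LINT s:{p..q}|lborel. X s \<omega>)"
    using pq by (intro ext set_lebesgue_integral_cong) auto
  finally show ?thesis .
qed

lemma drift_bound:
  fixes b :: "real \<Rightarrow> real"
  assumes b: "set_integrable lborel {0..T} b" and ar: "0 \<le> a" "a \<le> r" "r \<le> T"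
    and B: "\<And>t. a < t \<Longrightarrow> t \<le> r \<Longrightarrow> \<bar>b t\<bar> \<le> B" "0 \<le> B"
  shows "\<bar>(LINT s:{0..r}|lborel. b s) - (LINT s:{0..a}|lborel. b s)\<bar> \<le> B * (r - a)"
proof -
  have i: "set_integrable lborel {0..a} b" "set_integrable lborel {a<..r} b"
    by (rule set_integrable_subset[OF b]; use ar in auto)+
  have "(LINT s:{0..a} \<union> {a<..r}|lborel. b s) = (LINT s:{0..a}|lborel. b s) + (LINT s:{a<..r}|lborel. b s)"
    by (rule set_integral_Un) (use i in auto)
  moreover have "{0..a} \<union> {a<..r} = {0..r}" using ar by auto
  ultimately have "\<bar>(LINT s:{0..r}|lborel. b s) - (LINT s:{0..a}|lborel. b s)\<bar> = \<bar>LINT s:{a<..r}|lborel. b s\<bar>" by simp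
  also have "\<dots> \<le> (LINT s:{a<..r}|lborel. \<bar>b s\<bar>)" using set_integral_norm_bound[OF i(2)] by simp
  also have "\<dots> \<le> (LINT s:{a<..r}|lborel. B)"
  proof (rule set_integral_mono[OF set_integrable_abs[OF i(2)]])
    show "set_integrable lborel {a<..r} (\<lambda>_. B)"
      unfolding set_integrable_def real_scaleR_def
      by (intro integrable_mult_left integrable_real_indicator) (use ar in auto)
  qed (use B in auto)
  also have "\<dots> = B * (r - a)" using ar by (simp add: set_lebesgue_integral_def)
  finally show ?thesis .
qed

lemma expected_abs_increment:
  assumes "0 \<le> s" "s \<le> t"
  shows "(\<integral>\<^sup>+\<omega>. ennreal \<bar>W t \<omega> - W s \<omega>\<bar> \<partial>M) \<le> ennreal (sqrt (t - s))"
proof -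
  note mom = increment_moments[OF assms]
  have m: "(\<lambda>\<omega>. W t \<omega> - W s \<omega>) \<in> borel_measurable M" using mom by auto
  have "(\<integral>\<^sup>+\<omega>. ennreal \<bar>W t \<omega> - W s \<omega>\<bar> \<partial>M) = ennreal (\<integral>\<omega>. \<bar>W t \<omega> - W s \<omega>\<bar> \<partial>M)"
    using mom by (intro nn_integral_eq_integral) auto
  also have "\<dots> \<le> ennreal (sqrt (t - s))"
    by (intro ennreal_leI expectation_abs_le_sqrt(2)[OF m]) (use mom in auto)
  finally show ?thesis .
qed

text \<open>The increment of \<open>X\<close> is compared with the frozen diffusion coefficient \<open>c\<close> times a Brownian increment. The
  three terms account for the drift, for the variation of the coefficient, and for the Brownian
  increment after the reference time \<open>m\<close>.\<close>
lemma linearisation_error: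
  assumes X: "continuous_adapted M F T X" and ito: "is_ito_integral M F W T (\<lambda>s \<omega>. \<sigma> (X s \<omega>)) I"
    and \<mu>i: "AE \<omega> in M. set_integrable lborel {0..T} (\<lambda>s. \<mu> (X s \<omega>))"
    and sde: "\<forall>t\<in>{0..T}. AE \<omega> in M. X t \<omega> = X 0 \<omega> + (LINT s:{0..t}|lborel. \<mu> (X s \<omega>)) + I t \<omega>"
    and amr: "0 \<le> a" "a < m" "m \<le> r" "r \<le> T"
    and c: "c \<in> borel_measurable (F a)" "\<And>\<omega>. \<omega> \<in> space M \<Longrightarrow> \<bar>c \<omega>\<bar> \<le> C"
    and G: "G \<in> sets M" and e: "0 < \<epsilon>" and B: "0 \<le> B"
    and close: "\<And>\<omega> t. \<omega> \<in> G \<Longrightarrow> a < t \<Longrightarrow> t \<le> r \<Longrightarrow> \<bar>\<sigma> (X t \<omega>) - c \<omega>\<bar> \<le> \<epsilon> \<and> \<bar>\<mu> (X t \<omega>)\<bar> \<le> B"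
  shows "(\<integral>\<^sup>+\<omega>. ennreal \<bar>X r \<omega> - X a \<omega> - c \<omega> * (W m \<omega> - W a \<omega>)\<bar> * indicator G \<omega> \<partial>M)
    \<le> ennreal (B * (r - a) + 2 * \<epsilon> * sqrt (r - a) + C * sqrt (r - m))"
proof -
  have C: "0 \<le> C" using c(2) not_empty by fastforce
  let ?J = "\<lambda>\<omega>. I r \<omega> - I a \<omega> - c \<omega> * (W r \<omega> - W a \<omega>)"
  have I: "continuous_adapted M F T I" using ito by (auto simp: is_ito_integral_def)
  have [measurable]: "I r \<in> borel_measurable M" "I a \<in> borel_measurable M"
    by (rule F_measurable_M[of r], use amr I in \<open>auto simp: continuous_adapted_def\<close>)
       (rule F_measurable_M[of a], use amr I in \<open>auto simp: continuous_adapted_def\<close>)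
  have [measurable]: "c \<in> borel_measurable M" by (rule F_measurable_M[OF amr(1) c(1)])
  have [measurable]: "W r \<in> borel_measurable M" "W a \<in> borel_measurable M" "W m \<in> borel_measurable M" using amr by auto
  note [measurable] = G
  have r: "r \<in> {0..T}" "a \<in> {0..T}" using amr by auto
  have "AE \<omega> in M. ennreal \<bar>X r \<omega> - X a \<omega> - c \<omega> * (W m \<omega> - W a \<omega>)\<bar> * indicator G \<omega>
     \<le> ennreal (B * (r - a)) + (ennreal \<bar>?J \<omega>\<bar> * indicator G \<omega> + ennreal C * ennreal \<bar>W r \<omega> - W m \<omega>\<bar>)"
    using \<mu>i bspec[OF sde r(1)] bspec[OF sde r(2)] AE_space
  proof eventually_elim
    case (elim \<omega>)
    show ?case
    proof (cases "\<omega> \<in> G")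
      case True
      let ?b = "(LINT s:{0..r}|lborel. \<mu> (X s \<omega>)) - (LINT s:{0..a}|lborel. \<mu> (X s \<omega>))"
      have "\<bar>?b\<bar> \<le> B * (r - a)"
        by (rule drift_bound[OF elim(1)]) (use amr B close[OF True] in auto)
      moreover have "X r \<omega> - X a \<omega> - c \<omega> * (W m \<omega> - W a \<omega>) = ?b + ?J \<omega> + c \<omega> * (W r \<omega> - W m \<omega>)"
        using elim(2,3) by (simp add: algebra_simps)
      moreover have "\<bar>c \<omega> * (W r \<omega> - W m \<omega>)\<bar> \<le> C * \<bar>W r \<omega> - W m \<omega>\<bar>"
        unfolding abs_mult by (intro mult_right_mono c(2) elim(4)) simp
      ultimately have "\<bar>X r \<omega> - X a \<omega> - c \<omega> * (W m \<omega> - W a \<omega>)\<bar> \<le> B * (r - a) + (\<bar>?J \<omega>\<bar> + C * \<bar>W r \<omega> - W m \<omega>\<bar>)"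
        by linarith
      then have "ennreal \<bar>X r \<omega> - X a \<omega> - c \<omega> * (W m \<omega> - W a \<omega>)\<bar> \<le> ennreal (B * (r - a) + (\<bar>?J \<omega>\<bar> + C * \<bar>W r \<omega> - W m \<omega>\<bar>))"
        by (rule ennreal_leI)
      also have "\<dots> = ennreal (B * (r - a)) + (ennreal \<bar>?J \<omega>\<bar> + ennreal C * ennreal \<bar>W r \<omega> - W m \<omega>\<bar>)"
        using B C amr by (simp add: ennreal_plus ennreal_mult)
      finally show ?thesis using True by simp
    qed simp
  qed
  then have "(\<integral>\<^sup>+\<omega>. ennreal \<bar>X r \<omega> - X a \<omega> - c \<omega> * (W m \<omega> - W a \<omega>)\<bar> * indicator G \<omega> \<partial>M)
    \<le> (\<integral>\<^sup>+\<omega>. ennreal (B * (r - a)) + (ennreal \<bar>?J \<omega>\<bar> * indicator G \<omega> + ennreal C * ennreal \<bar>W r \<omega> - W m \<omega>\<bar>) \<partial>M)"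
    by (rule nn_integral_mono_AE)
  also have "\<dots> = ennreal (B * (r - a)) + ((\<integral>\<^sup>+\<omega>. ennreal \<bar>?J \<omega>\<bar> * indicator G \<omega> \<partial>M) + ennreal C * (\<integral>\<^sup>+\<omega>. ennreal \<bar>W r \<omega> - W m \<omega>\<bar> \<partial>M))"
    by (simp add: nn_integral_add nn_integral_cmult emeasure_space_1)
  also have "\<dots> \<le> ennreal (B * (r - a)) + (ennreal (2 * \<epsilon> * sqrt (r - a)) + ennreal C * ennreal (sqrt (r - m)))"
    using amr close
    by (intro add_mono mult_left_mono order_refl expected_abs_increment
          ito_integral_frozen_integrand_bound[OF ito amr(1) _ amr(4) c G e]) auto
  also have "\<dots> = ennreal (B * (r - a) + 2 * \<epsilon> * sqrt (r - a) + C * sqrt (r - m))"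
    using B C amr e by (simp add: ennreal_plus ennreal_mult add.assoc)
  finally show ?thesis .
qed

text \<open>Tonelli's theorem: a mean error that is uniform over a time window also bounds the mean error of the
  average over the window.\<close>
lemma average_error_le:
  assumes X: "continuous_adapted M F T X" and pq: "0 \<le> p" "p < q" "q \<le> T"
    and Y: "Y \<in> borel_measurable M" and G: "G \<in> sets M"
    and bd: "\<And>r. p \<le> r \<Longrightarrow> r \<le> q \<Longrightarrow> (\<integral>\<^sup>+\<omega>. ennreal \<bar>X r \<omega> - Y \<omega>\<bar> * indicator G \<omega> \<partial>M) \<le> E"
  shows "(\<integral>\<^sup>+\<omega>. ennreal \<bar>(LINT s:{p..q}|lborel. X s \<omega>) / (q - p) - Y \<omega>\<bar> * indicator G \<omega> \<partial>M) \<le> E"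
proof -
  have T: "0 \<le> T" using pq by simp
  interpret L: pair_sigma_finite lborel M ..
  let ?cl = "\<lambda>s. max 0 (min T s)"
  let ?h = "\<lambda>r \<omega>. ennreal \<bar>X (?cl r) \<omega> - Y \<omega>\<bar> * indicator G \<omega> * indicator {p..q} r"
  note [measurable] = Y G
  have m: "(\<lambda>(r, \<omega>). ?h r \<omega>) \<in> borel_measurable (lborel \<Otimes>\<^sub>M M)"
  proof -
    have "(\<lambda>x. X (?cl (fst x)) (snd x)) \<in> borel_measurable (lborel \<Otimes>\<^sub>M M)"
      using continuous_adapted_jointly_measurable[OF X T] by (simp cong: measurable_cong_sets sets_pair_measure_cong)
    then show ?thesis unfolding case_prod_beta by measurable
  qed
  have m': "(\<lambda>(\<omega>, r). ?h r \<omega>) \<in> borel_measurable (M \<Otimes>\<^sub>M lborel)"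
    using measurable_compose[OF measurable_pair_swap' m] by (simp add: case_prod_beta')
  have pt: "ennreal \<bar>(LINT s:{p..q}|lborel. X s \<omega>) / (q - p) - Y \<omega>\<bar> * indicator G \<omega> \<le> ennreal (1 / (q - p)) * (\<integral>\<^sup>+r. ?h r \<omega> \<partial>lborel)"
    if \<omega>: "\<omega> \<in> space M" for \<omega>
  proof (cases "\<omega> \<in> G")
    case True
    have i1: "set_integrable lborel {p..q} (\<lambda>s. X s \<omega>)" by (rule path_set_integrable[OF X \<omega>]) (use pq in auto)
    have i2: "set_integrable lborel {p..q} (\<lambda>s. Y \<omega>)"
      unfolding set_integrable_def real_scaleR_def
      by (intro integrable_mult_left integrable_real_indicator) (use pq in auto)
    have i: "set_integrable lborel {p..q} (\<lambda>s. X s \<omega> - Y \<omega>)" using i1 i2 by (rule set_integral_diff)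
    have "(LINT s:{p..q}|lborel. X s \<omega> - Y \<omega>) = (LINT s:{p..q}|lborel. X s \<omega>) - Y \<omega> * (q - p)"
      using i1 i2 pq by (simp add: set_integral_diff) (simp add: set_lebesgue_integral_def)
    then have "(LINT s:{p..q}|lborel. X s \<omega>) / (q - p) - Y \<omega> = 1 / (q - p) * (LINT s:{p..q}|lborel. X s \<omega> - Y \<omega>)"
      using pq by (simp add: field_simps)
    then have "ennreal \<bar>(LINT s:{p..q}|lborel. X s \<omega>) / (q - p) - Y \<omega>\<bar> = ennreal (1 / (q - p)) * ennreal (norm (LINT s:{p..q}|lborel. X s \<omega> - Y \<omega>))"
      using pq by (simp add: abs_mult ennreal_mult[symmetric] del: times_divide_eq_left)
    also have "\<dots> \<le> ennreal (1 / (q - p)) * (\<integral>\<^sup>+r. ennreal (norm (indicator {p..q} r *\<^sub>R (X r \<omega> - Y \<omega>))) \<partial>lborel)"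
      unfolding set_lebesgue_integral_def
      by (intro mult_left_mono integral_norm_bound_ennreal) (use i in \<open>auto simp: set_integrable_def\<close>)
    also have "(\<integral>\<^sup>+r. ennreal (norm (indicator {p..q} r *\<^sub>R (X r \<omega> - Y \<omega>))) \<partial>lborel) = (\<integral>\<^sup>+r. ?h r \<omega> \<partial>lborel)"
      using True pq by (intro nn_integral_cong) (auto simp: indicator_def)
    finally show ?thesis using True by simp
  qed simp
  have "(\<integral>\<^sup>+\<omega>. ennreal \<bar>(LINT s:{p..q}|lborel. X s \<omega>) / (q - p) - Y \<omega>\<bar> * indicator G \<omega> \<partial>M)
    \<le> (\<integral>\<^sup>+\<omega>. ennreal (1 / (q - p)) * (\<integral>\<^sup>+r. ?h r \<omega> \<partial>lborel) \<partial>M)"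
    by (intro nn_integral_mono pt)
  also have "\<dots> = ennreal (1 / (q - p)) * (\<integral>\<^sup>+\<omega>. (\<integral>\<^sup>+r. ?h r \<omega> \<partial>lborel) \<partial>M)"
    using lborel.borel_measurable_nn_integral[OF m'] by (rule nn_integral_cmult)
  also have "(\<integral>\<^sup>+\<omega>. (\<integral>\<^sup>+r. ?h r \<omega> \<partial>lborel) \<partial>M) = (\<integral>\<^sup>+r. (\<integral>\<^sup>+\<omega>. ?h r \<omega> \<partial>M) \<partial>lborel)"
    by (rule L.Fubini'[OF m])
  also have "\<dots> \<le> (\<integral>\<^sup>+r. E * indicator {p..q} r \<partial>lborel)"
  proof (rule nn_integral_mono)
    fix r
    show "(\<integral>\<^sup>+\<omega>. ?h r \<omega> \<partial>M) \<le> E * indicator {p..q} r"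
    proof (cases "r \<in> {p..q}")
      case True
      then have "?cl r = r" using pq by auto
      then show ?thesis using bd[of r] True by simp
    qed simp
  qed
  also have "\<dots> = E * ennreal (q - p)" using pq by (simp add: nn_integral_cmult)
  also have "ennreal (1 / (q - p)) * (E * ennreal (q - p)) = E"
    using pq by (simp add: mult.left_commute[of _ E] ennreal_mult[symmetric])
  finally show ?thesis by (simp add: mult_left_mono)
qed

end

section \<open>The lower bound on one cell\<close>

context brownian_filtration begin

text \<open>The duality argument on one cell. \<open>Y\<close> stands for any function of the observations \<open>W r\<close>, \<open>r \<in> R\<close>, none
  of which lies inside the cell. Let \<open>\<psi>\<close> be the clamp at level \<open>s * sqrt \<eta>\<close> and \<open>Z\<close> the swing of the two
  halves of the cell, weighted by the indicator of \<open>A\<close> and the sign of \<open>c\<close>. As \<open>\<psi>\<close> is \<open>1\<close>-Lipschitz and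
  \<open>\<bar>Z\<bar> \<le> 1\<close>, the mean distance from the window average of \<open>X\<close> to \<open>Y\<close> is at least the mean of
  \<open>(\<psi> (average - X a) - \<psi> (Y - X a)) * Z\<close>. The part with \<open>Y\<close> vanishes by orthogonality. In the other part
  the average is replaced by the linearisation \<open>X a + c * U\<close>, which costs the linearisation error on \<open>G\<close>
  and at most twice the clamp level on \<open>A - G\<close>.\<close>
lemma interval_lower_bound:
  assumes X: "continuous_adapted M F T X" and ito: "is_ito_integral M F W T (\<lambda>s \<omega>. \<sigma> (X s \<omega>)) I"
    and \<mu>i: "AE \<omega> in M. set_integrable lborel {0..T} (\<lambda>s. \<mu> (X s \<omega>))"
    and sde: "\<forall>t\<in>{0..T}. AE \<omega> in M. X t \<omega> = X 0 \<omega> + (LINT s:{0..t}|lborel. \<mu> (X s \<omega>)) + I t \<omega>"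
    and a: "0 \<le> a" "0 < \<eta>" "a + 2 * \<eta> \<le> T" and \<kappa>: "0 < \<kappa>" "\<kappa> \<le> 1"
    and c: "c \<in> borel_measurable (F a)" "\<And>\<omega>. \<omega> \<in> space M \<Longrightarrow> \<bar>c \<omega>\<bar> \<le> C"
    and A: "A \<in> sets (F a)" "\<And>\<omega>. \<omega> \<in> A \<Longrightarrow> s \<le> \<bar>c \<omega>\<bar>" and s: "0 < s"
    and G: "G \<in> sets M" "G \<subseteq> A" and e: "0 < \<epsilon>" and B: "0 \<le> B"
    and close: "\<And>\<omega> t. \<omega> \<in> G \<Longrightarrow> a < t \<Longrightarrow> t \<le> a + 2 * \<eta> \<Longrightarrow> \<bar>\<sigma> (X t \<omega>) - c \<omega>\<bar> \<le> \<epsilon> \<and> \<bar>\<mu> (X t \<omega>)\<bar> \<le> B"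
    and R: "finite R" "\<And>r. r \<in> R \<Longrightarrow> 0 \<le> r" "\<And>r. r \<in> R \<Longrightarrow> r \<notin> {a<..<a + 2 * \<eta>}"
    and Y: "\<And>H. subalgebra M H \<Longrightarrow> (\<And>r. r \<in> R \<Longrightarrow> W r \<in> borel_measurable H) \<Longrightarrow> Y \<in> borel_measurable H"
  shows "ennreal (s * sqrt \<eta> * (tail\<^sup>2 * prob A - 2 * prob (A - G)) - (B * (2 * \<eta>) + 2 * \<epsilon> * sqrt (2 * \<eta>) + C * sqrt (\<kappa> * \<eta>)))
    \<le> (\<integral>\<^sup>+\<omega>. ennreal \<bar>(LINT r:{a + \<eta>..a + \<eta> + \<kappa> * \<eta>}|lborel. X r \<omega>) / (\<kappa> * \<eta>) - Y \<omega>\<bar> \<partial>M)"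
proof -
  have C: "0 \<le> C" using c(2) not_empty by fastforce
  let ?m = "a + \<eta>" and ?b = "a + 2 * \<eta>" and ?q = "a + \<eta> + \<kappa> * \<eta>"
  have q: "?m < ?q" "?q \<le> ?b" using a \<kappa> by auto
  have T: "0 \<le> T" using a by simp
  define U where "U \<omega> = W ?m \<omega> - W a \<omega>" for \<omega>
  define V where "V \<omega> = W ?b \<omega> - W ?m \<omega>" for \<omega>
  define h where "h = sqrt \<eta>"
  have h: "0 < h" using a by (simp add: h_def)
  define K where "K = s * h"
  have K: "0 < K" using s h by (simp add: K_def)
  define \<theta> where "\<theta> \<omega> = indicator A \<omega> * sgn (c \<omega>)" for \<omega>
  define Z where "Z \<omega> = \<theta> \<omega> * swing h (U \<omega>) (V \<omega>)" for \<omega>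
  define Xb where "Xb \<omega> = (LINT r:{?m..?q}|lborel. X r \<omega>) / (\<kappa> * \<eta>)" for \<omega>
  have AM [measurable]: "A \<in> sets M" using A(1) sets_F[OF a(1)] by auto
  note [measurable] = G(1) c(1)
  have cM [measurable]: "c \<in> borel_measurable M" by (rule F_measurable_M[OF a(1) c(1)])
  have \<theta>m: "\<theta> \<in> borel_measurable (F a)" unfolding \<theta>_def[abs_def] using A(1) by measurable
  have \<theta>b: "\<bar>\<theta> \<omega>\<bar> \<le> 1" for \<omega> by (simp add: \<theta>_def indicator_def abs_sgn_eq)
  have \<theta>M [measurable]: "\<theta> \<in> borel_measurable M" by (rule F_measurable_M[OF a(1) \<theta>m])
  obtain H where H: "subalgebra M H" "sets (F a) \<subseteq> sets H" and RH: "\<And>r. r \<in> R \<Longrightarrow> W r \<in> borel_measurable H"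
    and orth': "orthogonal_to M H (\<lambda>\<omega>. \<theta> \<omega> * swing h (W ?m \<omega> - W a \<omega>) (W ?b \<omega> - W ?m \<omega>))"
    by (rule antisymmetric_orthogonal_to_observations[OF a(1,2) \<theta>m \<theta>b swing_measurable[of h] swing_bound[of h] swing_antisymmetric[of h] R]) (assumption | rule that)+
  have orth: "orthogonal_to M H Z" using orth' by (simp add: Z_def[abs_def] U_def V_def)
  have Um [measurable]: "U \<in> borel_measurable M" and Vm [measurable]: "V \<in> borel_measurable M"
    unfolding U_def[abs_def] V_def[abs_def] using a by (auto intro!: borel_measurable_diff W_measurable)
  have Zm [measurable]: "Z \<in> borel_measurable M"
  proof -
    have "(\<lambda>\<omega>. swing h (U \<omega>) (V \<omega>)) \<in> borel_measurable M"
      using measurable_compose[OF measurable_Pair[OF Um Vm] swing_measurable] by simp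
    then show ?thesis unfolding Z_def[abs_def] by simp
  qed
  have Zb: "\<bar>Z \<omega>\<bar> \<le> indicator A \<omega>" for \<omega>
    using swing_bound[of h "U \<omega>" "V \<omega>"] by (auto simp: Z_def \<theta>_def indicator_def abs_mult abs_sgn_eq)
  have Zb1: "\<bar>Z \<omega>\<bar> \<le> 1" for \<omega> using order_trans[OF Zb indicator_le_1] .
  have XaF: "X a \<in> borel_measurable (F a)" using X a by (auto simp: continuous_adapted_def)
  have XaM [measurable]: "X a \<in> borel_measurable M" by (rule F_measurable_M[OF a(1) XaF])
  have XaH: "X a \<in> borel_measurable H"
    by (rule measurable_coarser[OF XaF _ H(2)]) (use H(1) space_F[OF a(1)] in \<open>auto simp: subalgebra_def\<close>)
  have YH: "Y \<in> borel_measurable H" by (rule Y[OF H(1) RH])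
  have YM [measurable]: "Y \<in> borel_measurable M" by (rule measurable_from_subalg[OF H(1) YH])
  have XbM [measurable]: "Xb \<in> borel_measurable M"
  proof -
    have "(\<lambda>\<omega>. LINT r:{?m..?q}|lborel. X r \<omega>) \<in> borel_measurable M"
      by (rule path_integral_measurable[OF X _ _ T]) (use a q in auto)
    then show ?thesis unfolding Xb_def[abs_def] by measurable
  qed
  let ?\<psi> = "clamp_sym K"
  have Kb: "\<bar>?\<psi> x\<bar> \<le> K" for x by (rule clamp_sym_bound) (use K in simp)
  have Zint: "integrable M Z" by (rule integrable_const_bound[of _ 1]) (use Zb1 in auto)
  have zero: "(\<integral>\<omega>. ?\<psi> (Y \<omega> - X a \<omega>) * Z \<omega> \<partial>M) = 0"
    by (rule integral_mult_eq_0_if_orthogonal[OF H(1) orth Zint _ Kb]) (use YH XaH in measurable)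
  have bint: "integrable M (\<lambda>\<omega>. ?\<psi> (f \<omega>) * Z \<omega>)" if [measurable]: "f \<in> borel_measurable M" for f
  proof (rule integrable_const_bound[of _ K])
    have "\<bar>?\<psi> x * Z \<omega>\<bar> \<le> K" for x \<omega>
      using mult_mono[OF Kb[of x] Zb1[of \<omega>]] K by (simp add: abs_mult)
    then show "AE \<omega> in M. norm (?\<psi> (f \<omega>) * Z \<omega>) \<le> K" by simp
  qed measurable
  define D where "D \<omega> = Xb \<omega> - X a \<omega> - c \<omega> * U \<omega>" for \<omega>
  have Dm [measurable]: "D \<in> borel_measurable M" unfolding D_def[abs_def] by measurable
  define err where "err = B * (2 * \<eta>) + 2 * \<epsilon> * sqrt (2 * \<eta>) + C * sqrt (\<kappa> * \<eta>)"
  have err0: "0 \<le> err" using B e C a \<kappa> by (simp add: err_def)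
  have Dnn: "(\<integral>\<^sup>+\<omega>. ennreal \<bar>D \<omega>\<bar> * indicator G \<omega> \<partial>M) \<le> ennreal err"
  proof -
    have "(\<integral>\<^sup>+\<omega>. ennreal \<bar>(LINT r:{?m..?q}|lborel. X r \<omega>) / (?q - ?m) - (X a \<omega> + c \<omega> * U \<omega>)\<bar> * indicator G \<omega> \<partial>M) \<le> ennreal err"
    proof (rule average_error_le[OF X _ q(1) _ _ G(1)])
      fix r assume r: "?m \<le> r" "r \<le> ?q"
      have "(\<integral>\<^sup>+\<omega>. ennreal \<bar>X r \<omega> - X a \<omega> - c \<omega> * (W ?m \<omega> - W a \<omega>)\<bar> * indicator G \<omega> \<partial>M)
        \<le> ennreal (B * (r - a) + 2 * \<epsilon> * sqrt (r - a) + C * sqrt (r - ?m))"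
        by (rule linearisation_error[OF X ito \<mu>i sde a(1) _ r(1) _ c G(1) e B close])
           (use a q r in auto)
      also have "\<dots> \<le> ennreal err"
        unfolding err_def
        by (intro ennreal_leI add_mono mult_left_mono real_sqrt_le_mono) (use a q r B e C in auto)
      finally show "(\<integral>\<^sup>+\<omega>. ennreal \<bar>X r \<omega> - (X a \<omega> + c \<omega> * U \<omega>)\<bar> * indicator G \<omega> \<partial>M) \<le> ennreal err"
        by (simp add: U_def diff_diff_add)
    qed (use a q in auto)
    then show ?thesis by (simp add: D_def Xb_def diff_diff_add)
  qed
  have Deq: "(\<integral>\<^sup>+\<omega>. ennreal (\<bar>D \<omega>\<bar> * indicator G \<omega>) \<partial>M) = (\<integral>\<^sup>+\<omega>. ennreal \<bar>D \<omega>\<bar> * indicator G \<omega> \<partial>M)"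
    by (intro nn_integral_cong) (simp add: indicator_def)
  have Dint: "integrable M (\<lambda>\<omega>. \<bar>D \<omega>\<bar> * indicator G \<omega>)"
    using Dnn Deq by (intro integrableI_nonneg) (auto intro: le_less_trans)
  have Dexp: "(\<integral>\<omega>. \<bar>D \<omega>\<bar> * indicator G \<omega> \<partial>M) \<le> err"
  proof -
    have "ennreal (\<integral>\<omega>. \<bar>D \<omega>\<bar> * indicator G \<omega> \<partial>M) = (\<integral>\<^sup>+\<omega>. ennreal (\<bar>D \<omega>\<bar> * indicator G \<omega>) \<partial>M)"
      by (rule nn_integral_eq_integral[symmetric, OF Dint]) auto
    also have "\<dots> \<le> ennreal err" unfolding Deq by (rule Dnn)
    finally show ?thesis using err0 by (subst (asm) ennreal_le_iff) auto
  qed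
  define E where "E = {\<omega>\<in>space M. h \<le> U \<omega> \<and> V \<omega> \<le> - h}"
  have Em [measurable]: "E \<in> sets M" unfolding E_def by measurable
  have PE: "prob (A \<inter> E) = tail\<^sup>2 * prob A"
  proof -
    let ?E1 = "U -` {h..} \<inter> space M" and ?E2 = "V -` {..- h} \<inter> space M"
    have "U \<in> borel_measurable (F ?m)"
      unfolding U_def[abs_def] using a by (intro borel_measurable_diff W_measurable_F) auto
    then have "?E1 \<in> sets (F ?m)" using measurable_sets[of U "F ?m" borel "{h..}"] space_F[of ?m] a by simp
    then have "A \<inter> ?E1 \<in> sets (F ?m)" using A(1) filtration_mono[of a ?m] a by auto
    from increment_indep[OF _ _ this, of ?b "{..- h}"] a
    have 1: "prob (A \<inter> ?E1 \<inter> ?E2) = prob (A \<inter> ?E1) * prob ?E2" by (simp add: V_def[abs_def])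
    from increment_indep[OF a(1) _ A(1), of ?m "{h..}"] a
    have 2: "prob (A \<inter> ?E1) = prob A * prob ?E1" by (simp add: U_def[abs_def])
    have "prob ?E1 = tail"
      using increment_tail(1)[of a ?m] a by (simp add: U_def h_def vimage_def Int_def conj_commute)
    moreover have "prob ?E2 = tail"
      using increment_tail(2)[of ?m ?b] a by (simp add: V_def h_def vimage_def Int_def conj_commute)
    moreover have "A \<inter> E = A \<inter> ?E1 \<inter> ?E2" by (auto simp: E_def)
    ultimately show ?thesis using 1 2 by (simp add: power2_eq_square)
  qed
  let ?g = "\<lambda>\<omega>. K * indicator (A \<inter> E) \<omega> - 2 * K * indicator (A - G) \<omega> - \<bar>D \<omega>\<bar> * indicator G \<omega>"
  have low: "?g \<omega> \<le> ?\<psi> (Xb \<omega> - X a \<omega>) * Z \<omega>" if \<omega>: "\<omega> \<in> space M" for \<omega>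
  proof (cases "\<omega> \<in> A")
    case True
    have 1: "K * indicator (A \<inter> E) \<omega> \<le> ?\<psi> (c \<omega> * U \<omega>) * Z \<omega>"
    proof -
      have "indicator (A \<inter> E) \<omega> = (if h \<le> U \<omega> \<and> V \<omega> \<le> - h then 1 else 0 :: real)"
        using True \<omega> by (simp add: E_def)
      moreover have "Z \<omega> = sgn (c \<omega>) * swing h (U \<omega>) (V \<omega>)" using True by (simp add: Z_def \<theta>_def)
      ultimately show ?thesis unfolding K_def
        using clamp_swing_lower_bound[OF h s A(2)[OF True], of "U \<omega>" "V \<omega>"] by simp
    qed
    let ?d = "?\<psi> (Xb \<omega> - X a \<omega>) - ?\<psi> (c \<omega> * U \<omega>)"
    have 2: "\<bar>?d\<bar> \<le> 2 * K * indicator (A - G) \<omega> + \<bar>D \<omega>\<bar> * indicator G \<omega>"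
    proof (cases "\<omega> \<in> G")
      case True
      then show ?thesis using clamp_sym_lipschitz[of K "Xb \<omega> - X a \<omega>" "c \<omega> * U \<omega>"] by (simp add: D_def)
    next
      case False
      then show ?thesis using \<open>\<omega> \<in> A\<close> Kb[of "Xb \<omega> - X a \<omega>"] Kb[of "c \<omega> * U \<omega>"] by simp
    qed
    have "\<bar>?d * Z \<omega>\<bar> \<le> \<bar>?d\<bar> * 1" unfolding abs_mult by (intro mult_left_mono Zb1) simp
    then have "- \<bar>?d\<bar> \<le> ?d * Z \<omega>" by (metis abs_le_D2 minus_le_iff mult.right_neutral)
    then have "?\<psi> (c \<omega> * U \<omega>) * Z \<omega> - \<bar>?d\<bar> \<le> ?\<psi> (c \<omega> * U \<omega>) * Z \<omega> + ?d * Z \<omega>" by simp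
    also have "\<dots> = ?\<psi> (Xb \<omega> - X a \<omega>) * Z \<omega>" by (simp add: algebra_simps)
    finally show ?thesis using 1 2 by linarith
  next
    case False
    then show ?thesis using Zb[of \<omega>] G(2) by (auto simp: indicator_def)
  qed
  have gint: "integrable M ?g"
    using Dint by (intro Bochner_Integration.integrable_diff integrable_mult_right integrable_real_indicator)
      (auto simp: less_top[symmetric])
  have "K * prob (A \<inter> E) - 2 * K * prob (A - G) - err \<le> (\<integral>\<omega>. ?g \<omega> \<partial>M)"
    using Dint Dexp by (simp add: Bochner_Integration.integral_diff integrable_real_indicator less_top[symmetric])
  also have "\<dots> \<le> (\<integral>\<omega>. ?\<psi> (Xb \<omega> - X a \<omega>) * Z \<omega> \<partial>M)"
    by (rule integral_mono[OF gint bint low]) measurable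
  also have "\<dots> = (\<integral>\<omega>. ?\<psi> (Xb \<omega> - X a \<omega>) * Z \<omega> - ?\<psi> (Y \<omega> - X a \<omega>) * Z \<omega> \<partial>M)"
    by (subst Bochner_Integration.integral_diff) (auto intro!: bint simp: zero)
  finally have key: "K * prob (A \<inter> E) - 2 * K * prob (A - G) - err \<le> (\<integral>\<omega>. ?\<psi> (Xb \<omega> - X a \<omega>) * Z \<omega> - ?\<psi> (Y \<omega> - X a \<omega>) * Z \<omega> \<partial>M)" .
  have fint: "integrable M (\<lambda>\<omega>. ?\<psi> (Xb \<omega> - X a \<omega>) * Z \<omega> - ?\<psi> (Y \<omega> - X a \<omega>) * Z \<omega>)"
    by (intro Bochner_Integration.integrable_diff bint) measurable
  have "ennreal (s * sqrt \<eta> * (tail\<^sup>2 * prob A - 2 * prob (A - G)) - err) \<le> ennreal (\<integral>\<omega>. \<bar>?\<psi> (Xb \<omega> - X a \<omega>) * Z \<omega> - ?\<psi> (Y \<omega> - X a \<omega>) * Z \<omega>\<bar> \<partial>M)"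
  proof (rule ennreal_leI)
    have "s * sqrt \<eta> * (tail\<^sup>2 * prob A - 2 * prob (A - G)) - err = K * prob (A \<inter> E) - 2 * K * prob (A - G) - err"
      unfolding PE by (simp add: K_def h_def algebra_simps)
    also note key
    also have "(\<integral>\<omega>. ?\<psi> (Xb \<omega> - X a \<omega>) * Z \<omega> - ?\<psi> (Y \<omega> - X a \<omega>) * Z \<omega> \<partial>M) \<le> (\<integral>\<omega>. \<bar>?\<psi> (Xb \<omega> - X a \<omega>) * Z \<omega> - ?\<psi> (Y \<omega> - X a \<omega>) * Z \<omega>\<bar> \<partial>M)"
      by (intro integral_mono integrable_abs fint) auto
    finally show "s * sqrt \<eta> * (tail\<^sup>2 * prob A - 2 * prob (A - G)) - err \<le> (\<integral>\<omega>. \<bar>?\<psi> (Xb \<omega> - X a \<omega>) * Z \<omega> - ?\<psi> (Y \<omega> - X a \<omega>) * Z \<omega>\<bar> \<partial>M)" .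
  qed
  also have "\<dots> = (\<integral>\<^sup>+\<omega>. ennreal \<bar>?\<psi> (Xb \<omega> - X a \<omega>) * Z \<omega> - ?\<psi> (Y \<omega> - X a \<omega>) * Z \<omega>\<bar> \<partial>M)"
    by (rule nn_integral_eq_integral[symmetric]) (use fint in auto)
  also have "\<dots> \<le> (\<integral>\<^sup>+\<omega>. ennreal \<bar>Xb \<omega> - Y \<omega>\<bar> \<partial>M)"
  proof (intro nn_integral_mono ennreal_leI)
    fix \<omega>
    have "\<bar>?\<psi> (Xb \<omega> - X a \<omega>) * Z \<omega> - ?\<psi> (Y \<omega> - X a \<omega>) * Z \<omega>\<bar> = \<bar>?\<psi> (Xb \<omega> - X a \<omega>) - ?\<psi> (Y \<omega> - X a \<omega>)\<bar> * \<bar>Z \<omega>\<bar>"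
      by (simp add: abs_mult[symmetric] algebra_simps)
    also have "\<dots> \<le> \<bar>(Xb \<omega> - X a \<omega>) - (Y \<omega> - X a \<omega>)\<bar> * 1"
      by (intro mult_mono clamp_sym_lipschitz Zb1) auto
    finally show "\<bar>?\<psi> (Xb \<omega> - X a \<omega>) * Z \<omega> - ?\<psi> (Y \<omega> - X a \<omega>) * Z \<omega>\<bar> \<le> \<bar>Xb \<omega> - Y \<omega>\<bar>" by simp
  qed
  finally show ?thesis unfolding err_def Xb_def .
qed

text \<open>This is path continuity at \<open>t\<^sub>0\<close>. It suffices that the exceptional probability is below a fixed
  constant, because the clamp level that multiplies it already shrinks with the cell.\<close>
lemma small_oscillation_event:
  assumes X: "continuous_adapted M F T X" and t: "0 \<le> t\<^sub>0" "t\<^sub>0 < T"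
    and \<rho>: "0 < \<rho>" and e: "0 < e" and \<tau>': "0 < \<tau>'"
  obtains \<tau> G where "0 < \<tau>" "\<tau> \<le> \<tau>'" "t\<^sub>0 + \<tau> \<le> T" "G \<in> sets M" "prob (space M - G) \<le> e"
    "\<And>\<omega> t. \<omega> \<in> G \<Longrightarrow> t\<^sub>0 \<le> t \<Longrightarrow> t \<le> t\<^sub>0 + \<tau> \<Longrightarrow> \<bar>X t \<omega> - X t\<^sub>0 \<omega>\<bar> \<le> \<rho>"
proof -
  define d where "d = min \<tau>' (T - t\<^sub>0)"
  have d: "0 < d" "d \<le> \<tau>'" "t\<^sub>0 + d \<le> T" using t \<tau>' by (auto simp: d_def)
  define \<tau> where "\<tau> k = d * inverse (real (Suc k))" for k
  have \<tau>: "0 < \<tau> k" "\<tau> k \<le> d" for k using d by (auto simp: \<tau>_def field_simps)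
  have \<tau>T: "t\<^sub>0 + \<tau> k \<le> T" for k using \<tau>(2)[of k] d by simp
  define S where "S k \<omega> = (SUP t\<in>{t\<^sub>0..t\<^sub>0 + \<tau> k}. ennreal \<bar>X t \<omega> - X t\<^sub>0 \<omega>\<bar>)" for k \<omega>
  define G where "G k = {\<omega>\<in>space M. S k \<omega> \<le> ennreal \<rho>}" for k
  have cont: "continuous_on {0..T} (\<lambda>t. X t \<omega>)" if "\<omega> \<in> space M" for \<omega>
    using X that by (auto simp: continuous_adapted_def)
  have Xm: "X t \<in> borel_measurable M" if "t \<in> {0..T}" for t
    by (rule F_measurable_M[of t]) (use X that in \<open>auto simp: continuous_adapted_def\<close>)
  have Sm: "S k \<in> borel_measurable M" for k
  proof -
    let ?cl = "\<lambda>q. max t\<^sub>0 (min (t\<^sub>0 + \<tau> k) q)"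
    have "(\<lambda>\<omega>. SUP q\<in>\<rat>. ennreal \<bar>X (?cl q) \<omega> - X t\<^sub>0 \<omega>\<bar>) \<in> borel_measurable M"
    proof (intro borel_measurable_SUP countable_rat)
      fix q :: real
      have "?cl q \<in> {0..T}" "t\<^sub>0 \<in> {0..T}" using t \<tau>T[of k] \<tau>(1)[of k] by auto
      from Xm[OF this(1)] Xm[OF this(2)] show "(\<lambda>\<omega>. ennreal \<bar>X (?cl q) \<omega> - X t\<^sub>0 \<omega>\<bar>) \<in> borel_measurable M" by simp
    qed
    also have "?this \<longleftrightarrow> ?thesis"
    proof (intro measurable_cong)
      fix \<omega> assume "\<omega> \<in> space M"
      then have "continuous_on {t\<^sub>0..t\<^sub>0 + \<tau> k} (\<lambda>t. \<bar>X t \<omega> - X t\<^sub>0 \<omega>\<bar>)"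
        by (intro continuous_intros continuous_on_subset[OF cont]) (use t \<tau>T[of k] in auto)
      from continuous_SUP_eq_rational_SUP[OF this] \<tau>(1)[of k]
      show "(SUP q\<in>\<rat>. ennreal \<bar>X (?cl q) \<omega> - X t\<^sub>0 \<omega>\<bar>) = S k \<omega>" unfolding S_def by simp
    qed
    finally show ?thesis .
  qed
  have Gm: "G k \<in> sets M" for k unfolding G_def using Sm by measurable
  have Gosc: "\<omega> \<in> G k \<longleftrightarrow> \<omega> \<in> space M \<and> (\<forall>t. t\<^sub>0 \<le> t \<longrightarrow> t \<le> t\<^sub>0 + \<tau> k \<longrightarrow> \<bar>X t \<omega> - X t\<^sub>0 \<omega>\<bar> \<le> \<rho>)" for k \<omega>
    unfolding G_def S_def SUP_le_iff using \<rho> by (auto simp: ennreal_le_iff)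
  have inc: "incseq G"
  proof (intro incseq_SucI subsetI)
    fix k \<omega> assume "\<omega> \<in> G k"
    moreover have "\<tau> (Suc k) \<le> \<tau> k" using d by (simp add: \<tau>_def field_simps)
    ultimately show "\<omega> \<in> G (Suc k)" unfolding Gosc by auto
  qed
  have un: "(\<Union>k. G k) = space M"
  proof (intro antisym subsetI)
    fix \<omega> assume \<omega>: "\<omega> \<in> space M"
    from cont[OF \<omega>] t have "\<exists>r>0. \<forall>t\<in>{0..T}. dist t t\<^sub>0 < r \<longrightarrow> dist (X t \<omega>) (X t\<^sub>0 \<omega>) < \<rho>"
      using \<rho> unfolding continuous_on_iff by force
    then obtain r where r: "0 < r" "\<And>t. t \<in> {0..T} \<Longrightarrow> dist t t\<^sub>0 < r \<Longrightarrow> dist (X t \<omega>) (X t\<^sub>0 \<omega>) < \<rho>" by blast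
    obtain k where k: "inverse (real (Suc k)) < r / d" using reals_Archimedean[of "r / d"] r(1) d by auto
    have "\<tau> k < r" using k d by (simp add: \<tau>_def field_simps)
    have "\<omega> \<in> G k" unfolding Gosc
    proof (intro conjI allI impI \<omega>)
      fix u assume u: "t\<^sub>0 \<le> u" "u \<le> t\<^sub>0 + \<tau> k"
      have "dist (X u \<omega>) (X t\<^sub>0 \<omega>) < \<rho>"
        by (rule r(2)) (use u t \<tau>T[of k] \<open>\<tau> k < r\<close> in \<open>auto simp: dist_real_def\<close>)
      then show "\<bar>X u \<omega> - X t\<^sub>0 \<omega>\<bar> \<le> \<rho>" by (simp add: dist_real_def)
    qed
    then show "\<omega> \<in> (\<Union>k. G k)" by blast
  qed (auto simp: G_def)
  have "(\<lambda>k. prob (G k)) \<longlonglongrightarrow> prob (\<Union>k. G k)"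
    by (rule finite_Lim_measure_incseq) (use Gm inc in auto)
  then have "(\<lambda>k. prob (G k)) \<longlonglongrightarrow> 1" unfolding un by (simp add: prob_space)
  then have "\<forall>\<^sub>F k in sequentially. 1 - e < prob (G k)" by (rule order_tendstoD) (use e in simp)
  then obtain k where k: "1 - e < prob (G k)" by (auto simp: eventually_sequentially)
  show thesis
  proof (rule that[of "\<tau> k" "G k"])
    show "prob (space M - G k) \<le> e" using k Gm[of k] by (simp add: prob_compl)
  qed (use \<tau>[of k] \<tau>T[of k] d Gm Gosc in auto)
qed

end

section \<open>From one cell to the whole interval\<close>

text \<open>Each point lies in at most one of the \<open>2 * n\<close> disjoint open cells.\<close>
lemma card_cells_without_points:
  fixes x :: "nat \<Rightarrow> real"
  assumes l: "0 < l"
  shows "n \<le> card {i\<in>{..<2 * n}. \<forall>j\<in>{1..n}. x j \<notin> {t + real i * l<..<t + real i * l + l}}"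
proof -
  let ?C = "\<lambda>i. {t + real i * l<..<t + real i * l + l}"
  let ?bad = "\<lambda>j. {i\<in>{..<2 * n}. x j \<in> ?C i}"
  have one: "card (?bad j) \<le> 1" for j
  proof -
    have "i = k" if "x j \<in> ?C i" "x j \<in> ?C k" for i k
    proof -
      have "real i * l < (real k + 1) * l" "real k * l < (real i + 1) * l" using that by (auto simp: algebra_simps)
      then have "real i < real k + 1" "real k < real i + 1" using l by (auto simp: mult_less_cancel_right)
      then show "i = k" by linarith
    qed
    then show ?thesis by (intro card_le_Suc0_iff_eq[THEN iffD2, folded One_nat_def]) auto
  qed
  have eq: "{..<2 * n} = {i\<in>{..<2 * n}. \<forall>j\<in>{1..n}. x j \<notin> ?C i} \<union> (\<Union>j\<in>{1..n}. ?bad j)" by auto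
  have "2 * n = card {..<2 * n}" by simp
  also have "\<dots> \<le> card {i\<in>{..<2 * n}. \<forall>j\<in>{1..n}. x j \<notin> ?C i} + card (\<Union>j\<in>{1..n}. ?bad j)"
    by (subst eq) (rule card_Un_le)
  also have "card (\<Union>j\<in>{1..n}. ?bad j) \<le> (\<Sum>j\<in>{1..n}. card (?bad j))" by (rule card_UN_le) simp
  also have "\<dots> \<le> (\<Sum>j\<in>{1..n}. 1)" by (intro sum_mono one)
  also have "(\<Sum>j\<in>{1..n}. 1) = n" by simp
  finally show ?thesis by simp
qed

context brownian_filtration begin

text \<open>Choice of the constants. With \<open>P\<close> the probability of reaching the ball, the signal on a cell is
  \<open>C1 * sqrt \<eta>\<close> with \<open>C1 = s * tail\<^sup>2 * P\<close>. All errors are of order \<open>sqrt \<eta>\<close> too, but with coefficients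
  that are small multiples of \<open>C1\<close> once the oscillation, the window and the time horizon are small. The
  freezing value \<open>c = \<sigma> (X t\<^sub>0)\<close> is the same for all cells up to the horizon.\<close>
lemma local_lower_bound:
  assumes X: "continuous_adapted M F T X" and ito: "is_ito_integral M F W T (\<lambda>s \<omega>. \<sigma> (X s \<omega>)) I"
    and \<mu>i: "AE \<omega> in M. set_integrable lborel {0..T} (\<lambda>s. \<mu> (X s \<omega>))"
    and sde: "\<forall>t\<in>{0..T}. AE \<omega> in M. X t \<omega> = X 0 \<omega> + (LINT s:{0..t}|lborel. \<mu> (X s \<omega>)) + I t \<omega>"
    and \<sigma>m: "\<sigma> \<in> borel_measurable borel"
    and t0: "0 \<le> t\<^sub>0" "t\<^sub>0 < T" and \<delta>: "0 < \<delta>"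
    and reach: "prob {\<omega>\<in>space M. X t\<^sub>0 \<omega> \<in> ball \<xi> \<delta>} > 0"
    and \<mu>b: "bounded (\<mu> ` {\<xi> - \<delta>..\<xi> + \<delta>})" and lip: "L-lipschitz_on {\<xi> - \<delta>..\<xi> + \<delta>} \<sigma>"
    and nondeg: "(INF x\<in>ball \<xi> \<delta>. \<bar>\<sigma> x\<bar>) > 0"
  obtains \<tau> \<kappa> k where "0 < \<tau>" "t\<^sub>0 + \<tau> \<le> T" "0 < \<kappa>" "\<kappa> \<le> 1" "0 < k"
    "\<And>a \<eta> R Y. t\<^sub>0 \<le> a \<Longrightarrow> 0 < \<eta> \<Longrightarrow> a + 2 * \<eta> \<le> t\<^sub>0 + \<tau> \<Longrightarrow> finite R \<Longrightarrow> (\<And>r. r \<in> R \<Longrightarrow> 0 \<le> r) \<Longrightarrow>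
       (\<And>r. r \<in> R \<Longrightarrow> r \<notin> {a<..<a + 2 * \<eta>}) \<Longrightarrow>
       (\<And>H. subalgebra M H \<Longrightarrow> (\<And>r. r \<in> R \<Longrightarrow> W r \<in> borel_measurable H) \<Longrightarrow> Y \<in> borel_measurable H) \<Longrightarrow>
       ennreal (k * sqrt \<eta>) \<le> (\<integral>\<^sup>+\<omega>. ennreal \<bar>(LINT r:{a + \<eta>..a + \<eta> + \<kappa> * \<eta>}|lborel. X r \<omega>) / (\<kappa> * \<eta>) - Y \<omega>\<bar> \<partial>M)"
proof -
  define s where "s = (INF x\<in>ball \<xi> \<delta>. \<bar>\<sigma> x\<bar>)"
  have s: "0 < s" using nondeg by (simp add: s_def)
  have s_le: "s \<le> \<bar>\<sigma> x\<bar>" if "x \<in> ball \<xi> \<delta>" for x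
    unfolding s_def by (rule cINF_lower[OF _ that]) (rule bdd_belowI[of _ 0], auto)
  obtain B' where B': "\<And>x. x \<in> {\<xi> - \<delta>..\<xi> + \<delta>} \<Longrightarrow> \<bar>\<mu> x\<bar> \<le> B'"
    using \<mu>b unfolding bounded_iff ball_simps real_norm_def by blast
  define B where "B = max B' 1"
  have B: "0 < B" "\<And>x. x \<in> {\<xi> - \<delta>..\<xi> + \<delta>} \<Longrightarrow> \<bar>\<mu> x\<bar> \<le> B" using B' by (auto simp: B_def le_max_iff_disj)
  have L: "0 \<le> L" using lip by (rule lipschitz_on_nonneg)
  have lipD: "\<bar>\<sigma> x - \<sigma> y\<bar> \<le> L * \<bar>x - y\<bar>" if "x \<in> {\<xi> - \<delta>..\<xi> + \<delta>}" "y \<in> {\<xi> - \<delta>..\<xi> + \<delta>}" for x y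
    using lipschitz_onD[OF lip that] by (simp add: dist_real_def)
  define C where "C = \<bar>\<sigma> \<xi>\<bar> + L * \<delta> + 1"
  have C: "0 < C" using L \<delta> by (simp add: C_def add_nonneg_pos)
  have \<sigma>C: "\<bar>\<sigma> x\<bar> \<le> C" if "x \<in> {\<xi> - \<delta>..\<xi> + \<delta>}" for x
  proof -
    have "\<bar>\<sigma> x - \<sigma> \<xi>\<bar> \<le> L * \<bar>x - \<xi>\<bar>" by (rule lipD[OF that]) (use \<delta> in simp)
    also have "\<dots> \<le> L * \<delta>" using that L by (intro mult_left_mono) auto
    finally show ?thesis unfolding C_def by linarith
  qed
  have XF: "X t\<^sub>0 \<in> borel_measurable (F t\<^sub>0)" using X t0 by (auto simp: continuous_adapted_def)
  define A where "A d = {\<omega>\<in>space (F t\<^sub>0). X t\<^sub>0 \<omega> \<in> ball \<xi> d}" for d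
  have AF: "A d \<in> sets (F t\<^sub>0)" for d
    using measurable_sets[OF XF, of "ball \<xi> d"] by (simp add: A_def vimage_def Int_def conj_commute)
  have AM: "A d \<in> sets M" for d using AF sets_F[OF t0(1)] by blast
  have spF: "space (F t\<^sub>0) = space M" by (rule space_F[OF t0(1)])
  \<comment> \<open>A slightly smaller ball is still reached, which leaves room for the path to move.\<close>
  obtain \<delta>' where \<delta>': "\<delta>' < \<delta>" "0 < prob (A \<delta>')"
  proof -
    have "\<exists>k. 0 < prob (A (\<delta> - inverse (real (Suc k))))"
    proof (rule ccontr)
      assume "\<not> ?thesis"
      then have "A (\<delta> - inverse (real (Suc k))) \<in> null_sets M" for k
        using AM by (auto simp: null_sets_def emeasure_eq_measure not_less measure_le_0_iff)
      then have "(\<Union>k. A (\<delta> - inverse (real (Suc k)))) \<in> null_sets M" by (intro null_sets_UN) auto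
      also have "(\<Union>k. A (\<delta> - inverse (real (Suc k)))) = A \<delta>"
      proof (intro antisym subsetI)
        fix \<omega> assume "\<omega> \<in> A \<delta>"
        then have \<omega>: "\<omega> \<in> space (F t\<^sub>0)" "dist \<xi> (X t\<^sub>0 \<omega>) < \<delta>" by (auto simp: A_def)
        obtain k where "inverse (real (Suc k)) < \<delta> - dist \<xi> (X t\<^sub>0 \<omega>)" using reals_Archimedean[of "\<delta> - dist \<xi> (X t\<^sub>0 \<omega>)"] \<omega>(2) by auto
        then have "\<omega> \<in> A (\<delta> - inverse (real (Suc k)))" using \<omega>(1) by (simp add: A_def)
        then show "\<omega> \<in> (\<Union>k. A (\<delta> - inverse (real (Suc k))))" by blast
      next
        fix \<omega> assume "\<omega> \<in> (\<Union>k. A (\<delta> - inverse (real (Suc k))))"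
        then obtain k where \<omega>: "\<omega> \<in> space (F t\<^sub>0)" "dist \<xi> (X t\<^sub>0 \<omega>) < \<delta> - inverse (real (Suc k))" by (auto simp: A_def)
        have "0 < inverse (real (Suc k))" by simp
        with \<omega>(2) have "dist \<xi> (X t\<^sub>0 \<omega>) < \<delta>" by linarith
        with \<omega>(1) show "\<omega> \<in> A \<delta>" by (simp add: A_def)
      qed
      finally have "prob (A \<delta>) = 0" by (auto simp: null_sets_def measure_def)
      then show False using reach spF by (simp add: A_def)
    qed
    then obtain k where "0 < prob (A (\<delta> - inverse (real (Suc k))))" ..
    moreover have "\<delta> - inverse (real (Suc k)) < \<delta>" by simp
    ultimately show thesis by (rule that[rotated])
  qed
  define P where "P = prob (A \<delta>')"
  define C1 where "C1 = s * tail\<^sup>2 * P"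
  have P: "0 < P" using \<delta>' by (simp add: P_def)
  have C1: "0 < C1" using s tail_pos P by (simp add: C1_def)
  define \<epsilon> where "\<epsilon> = C1 / 48"
  have \<epsilon>: "0 < \<epsilon>" using C1 by (simp add: \<epsilon>_def)
  \<comment> \<open>The window is short enough for the Brownian increment inside it to stay below the signal.\<close>
  define \<kappa> where "\<kappa> = min 1 ((C1 / (8 * C))\<^sup>2)"
  have \<kappa>: "0 < \<kappa>" "\<kappa> \<le> 1" using C1 C by (auto simp: \<kappa>_def)
  have "sqrt \<kappa> \<le> sqrt ((C1 / (8 * C))\<^sup>2)" by (intro real_sqrt_le_mono) (simp add: \<kappa>_def)
  also have "\<dots> = C1 / (8 * C)" using C1 C by simp
  finally have \<kappa>C: "C * sqrt \<kappa> \<le> C1 / 8" using C by (simp add: field_simps)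
  \<comment> \<open>Paths that start in the smaller ball stay in the larger one, and \<open>\<sigma>\<close> varies by at most \<open>\<epsilon>\<close>.\<close>
  define \<rho> where "\<rho> = min (\<delta> - \<delta>') (\<epsilon> / (L + 1))"
  have \<rho>: "0 < \<rho>" using \<delta>' \<epsilon> L by (simp add: \<rho>_def)
  have L\<rho>: "L * \<rho> \<le> \<epsilon>"
  proof -
    have "L * \<rho> \<le> (L + 1) * \<rho>" using \<rho> by (simp add: algebra_simps)
    also have "\<dots> \<le> (L + 1) * (\<epsilon> / (L + 1))" using L by (intro mult_left_mono) (auto simp: \<rho>_def)
    finally show ?thesis using L by simp
  qed
  \<comment> \<open>The event outside \<open>G\<close> is weighted by twice the clamp level; the drift has an extra factor \<open>sqrt \<eta>\<close>
    that a short horizon absorbs.\<close>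
  have e: "0 < C1 / (16 * s)" using C1 s by simp
  have \<tau>': "0 < (C1 / (16 * B))\<^sup>2" using C1 B by simp
  obtain \<tau> G0 where \<tau>: "0 < \<tau>" "\<tau> \<le> (C1 / (16 * B))\<^sup>2" "t\<^sub>0 + \<tau> \<le> T"
    and G0: "G0 \<in> sets M" "prob (space M - G0) \<le> C1 / (16 * s)"
    and osc: "\<And>\<omega> t. \<omega> \<in> G0 \<Longrightarrow> t\<^sub>0 \<le> t \<Longrightarrow> t \<le> t\<^sub>0 + \<tau> \<Longrightarrow> \<bar>X t \<omega> - X t\<^sub>0 \<omega>\<bar> \<le> \<rho>"
    using small_oscillation_event[OF X t0 \<rho> e \<tau>'] by metis
  define G where "G = A \<delta>' \<inter> G0"
  have G: "G \<in> sets M" "G \<subseteq> A \<delta>'" using AM G0 by (auto simp: G_def)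
  \<comment> \<open>The value zero for paths that miss the ball keeps \<open>c\<close> bounded.\<close>
  define c where "c \<omega> = (if X t\<^sub>0 \<omega> \<in> ball \<xi> \<delta> then \<sigma> (X t\<^sub>0 \<omega>) else 0)" for \<omega>
  have cF: "c \<in> borel_measurable (F t\<^sub>0)"
    unfolding c_def[abs_def] mem_ball using XF measurable_compose[OF XF \<sigma>m] by measurable
  have cC: "\<bar>c \<omega>\<bar> \<le> C" for \<omega>
    using \<sigma>C[of "X t\<^sub>0 \<omega>"] C by (auto simp: c_def dist_real_def abs_less_iff)
  have inball: "X t\<^sub>0 \<omega> \<in> ball \<xi> \<delta>" if "\<omega> \<in> A \<delta>'" for \<omega> using that \<delta>' by (auto simp: A_def)
  have sc: "s \<le> \<bar>c \<omega>\<bar>" if "\<omega> \<in> A \<delta>'" for \<omega> using s_le inball[OF that] by (simp add: c_def)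
  have close: "\<bar>\<sigma> (X t \<omega>) - c \<omega>\<bar> \<le> \<epsilon> \<and> \<bar>\<mu> (X t \<omega>)\<bar> \<le> B"
    if \<omega>: "\<omega> \<in> G" and t: "t\<^sub>0 \<le> t" "t \<le> t\<^sub>0 + \<tau>" for \<omega> t
  proof -
    have A: "\<omega> \<in> A \<delta>'" and o: "\<bar>X t \<omega> - X t\<^sub>0 \<omega>\<bar> \<le> \<rho>" using osc[of \<omega> t] \<omega> t by (auto simp: G_def)
    have d: "\<bar>\<xi> - X t\<^sub>0 \<omega>\<bar> < \<delta>'" using A by (simp add: A_def dist_real_def)
    have \<rho>': "\<rho> \<le> \<delta> - \<delta>'" by (simp add: \<rho>_def)
    have x0: "X t\<^sub>0 \<omega> \<in> {\<xi> - \<delta>..\<xi> + \<delta>}" using d \<delta>' by auto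
    have x: "X t \<omega> \<in> {\<xi> - \<delta>..\<xi> + \<delta>}" using d o \<rho>' unfolding atLeastAtMost_iff by linarith
    have "\<bar>\<sigma> (X t \<omega>) - \<sigma> (X t\<^sub>0 \<omega>)\<bar> \<le> L * \<bar>X t \<omega> - X t\<^sub>0 \<omega>\<bar>" by (rule lipD[OF x x0])
    also have "\<dots> \<le> L * \<rho>" using o L by (rule mult_left_mono)
    finally show ?thesis using L\<rho> B(2)[OF x] inball[OF A] by (simp add: c_def)
  qed
  have PG: "s * (2 * prob (A \<delta>' - G)) \<le> C1 / 8"
  proof -
    have "prob (A \<delta>' - G) \<le> prob (space M - G0)"
      using G0 AM[of \<delta>'] sets.sets_into_space by (intro finite_measure_mono) (auto simp: G_def)
    also note G0(2)
    finally show ?thesis using s by (simp add: field_simps)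
  qed
  show thesis
  proof (rule that[of \<tau> \<kappa> "C1 / 2"])
    fix a \<eta> R and Y :: "'a \<Rightarrow> real"
    assume a: "t\<^sub>0 \<le> a" "0 < \<eta>" "a + 2 * \<eta> \<le> t\<^sub>0 + \<tau>"
      and R: "finite R" "\<And>r. r \<in> R \<Longrightarrow> 0 \<le> r" "\<And>r. r \<in> R \<Longrightarrow> r \<notin> {a<..<a + 2 * \<eta>}"
      and Y: "\<And>H. subalgebra M H \<Longrightarrow> (\<And>r. r \<in> R \<Longrightarrow> W r \<in> borel_measurable H) \<Longrightarrow> Y \<in> borel_measurable H"
    have a0: "0 \<le> a" using a t0 by simp
    have aT: "a + 2 * \<eta> \<le> T" using a \<tau> by simp
    let ?h = "sqrt \<eta>"
    have h: "0 < ?h" using a by simp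
    \<comment> \<open>The errors amount to \<open>1/8 + 1/12 + 1/8 + 1/8 < 1/2\<close> of the signal.\<close>
    have "ennreal (C1 / 2 * ?h) \<le> ennreal (s * ?h * (tail\<^sup>2 * P - 2 * prob (A \<delta>' - G)) - (B * (2 * \<eta>) + 2 * \<epsilon> * sqrt (2 * \<eta>) + C * sqrt (\<kappa> * \<eta>)))"
    proof (rule ennreal_leI)
      have "?h \<le> C1 / (16 * B)"
      proof -
        have "?h \<le> sqrt ((C1 / (16 * B))\<^sup>2)" using a \<tau>(2) by (intro real_sqrt_le_mono) linarith
        also have "\<dots> = C1 / (16 * B)" using C1 B by simp
        finally show ?thesis .
      qed
      then have "B * 2 * ?h \<le> C1 / 8" using B by (simp add: field_simps)
      then have "B * 2 * ?h * ?h \<le> C1 / 8 * ?h" using h by (intro mult_right_mono) auto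
      then have 1: "B * (2 * \<eta>) \<le> C1 / 8 * ?h" using a by (simp add: mult.assoc)
      have "sqrt (2 * \<eta>) \<le> sqrt (2\<^sup>2 * \<eta>)" using a by (intro real_sqrt_le_mono) simp
      also have "\<dots> = 2 * ?h" by (simp add: real_sqrt_mult)
      finally have "2 * \<epsilon> * sqrt (2 * \<eta>) \<le> 2 * \<epsilon> * (2 * ?h)" using \<epsilon> by (intro mult_left_mono) auto
      then have 2: "2 * \<epsilon> * sqrt (2 * \<eta>) \<le> C1 / 12 * ?h" by (simp add: \<epsilon>_def)
      have 3: "C * sqrt (\<kappa> * \<eta>) \<le> C1 / 8 * ?h"
        using mult_right_mono[OF \<kappa>C, of ?h] h by (simp add: real_sqrt_mult mult.assoc)
      have 4: "s * ?h * (2 * prob (A \<delta>' - G)) \<le> C1 / 8 * ?h"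
        using mult_right_mono[OF PG, of ?h] h by (simp add: mult_ac)
      have 5: "s * ?h * (tail\<^sup>2 * P - 2 * prob (A \<delta>' - G)) = C1 * ?h - s * ?h * (2 * prob (A \<delta>' - G))"
        by (simp add: C1_def algebra_simps)
      have "0 < C1 * ?h" using C1 h by simp
      then show "C1 / 2 * ?h \<le> s * ?h * (tail\<^sup>2 * P - 2 * prob (A \<delta>' - G)) - (B * (2 * \<eta>) + 2 * \<epsilon> * sqrt (2 * \<eta>) + C * sqrt (\<kappa> * \<eta>))"
        using 1 2 3 4 unfolding 5 by linarith
    qed
    also have "\<dots> \<le> (\<integral>\<^sup>+\<omega>. ennreal \<bar>(LINT r:{a + \<eta>..a + \<eta> + \<kappa> * \<eta>}|lborel. X r \<omega>) / (\<kappa> * \<eta>) - Y \<omega>\<bar> \<partial>M)"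
      unfolding P_def
    proof (rule interval_lower_bound[OF X ito \<mu>i sde a0 a(2) aT \<kappa> _ cC _ sc s G \<epsilon> less_imp_le[OF B(1)] close R Y])
      show "c \<in> borel_measurable (F a)" by (rule F_measurable_mono[OF t0(1) a(1) cF])
      show "A \<delta>' \<in> sets (F a)" using AF filtration_mono[OF t0(1) a(1)] by blast
    qed (use a in auto)
    finally show "ennreal (C1 / 2 * ?h) \<le> (\<integral>\<^sup>+\<omega>. ennreal \<bar>(LINT r:{a + \<eta>..a + \<eta> + \<kappa> * \<eta>}|lborel. X r \<omega>) / (\<kappa> * \<eta>) - Y \<omega>\<bar> \<partial>M)" .
  qed (use \<tau> \<kappa> C1 in auto)
qed

text \<open>At least \<open>n\<close> of \<open>2 * n\<close> cells of length \<open>2 * \<eta>\<close> contain no observation time; each contributes its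
  window length \<open>\<kappa> * \<eta>\<close> times \<open>k * sqrt \<eta>\<close>. As \<open>\<eta>\<close> is \<open>\<tau> / (4 * n)\<close>, the total has order
  \<open>n * n powr (- 3/2)\<close>.\<close>
lemma L1_lower_bound:
  assumes X: "continuous_adapted M F T X" and t0: "0 \<le> t\<^sub>0"
    and \<tau>: "0 < \<tau>" "t\<^sub>0 + \<tau> \<le> T" and \<kappa>: "0 < \<kappa>" "\<kappa> \<le> 1" and k: "0 < k"
    and loc: "\<And>a \<eta> R Y. t\<^sub>0 \<le> a \<Longrightarrow> 0 < \<eta> \<Longrightarrow> a + 2 * \<eta> \<le> t\<^sub>0 + \<tau> \<Longrightarrow> finite R \<Longrightarrow> (\<And>r. r \<in> R \<Longrightarrow> 0 \<le> r) \<Longrightarrow>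
       (\<And>r. r \<in> R \<Longrightarrow> r \<notin> {a<..<a + 2 * \<eta>}) \<Longrightarrow>
       (\<And>H. subalgebra M H \<Longrightarrow> (\<And>r. r \<in> R \<Longrightarrow> W r \<in> borel_measurable H) \<Longrightarrow> Y \<in> borel_measurable H) \<Longrightarrow>
       ennreal (k * sqrt \<eta>) \<le> (\<integral>\<^sup>+\<omega>. ennreal \<bar>(LINT r:{a + \<eta>..a + \<eta> + \<kappa> * \<eta>}|lborel. X r \<omega>) / (\<kappa> * \<eta>) - Y \<omega>\<bar> \<partial>M)"
    and n: "1 \<le> n" and t: "\<And>j. j \<in> {1..n} \<Longrightarrow> t j \<in> {0..T}"
    and g: "g \<in> PiM {1..n} (\<lambda>_. borel) \<rightarrow>\<^sub>M L1_borel T"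
  shows "ennreal (\<kappa> * k * (\<tau> / 4) * sqrt (\<tau> / 4) / sqrt (real n))
    \<le> (\<integral>\<^sup>+ \<omega>. ennreal (L1_norm T (\<lambda>s. X s \<omega> - g (\<lambda>i\<in>{1..n}. W (t i) \<omega>) s)) \<partial>M)"
proof -
  have T: "0 \<le> T" using t0 \<tau> by simp
  define l where "l = \<tau> / (2 * real n)"
  define \<eta> where "\<eta> = l / 2"
  have l: "0 < l" "2 * \<eta> = l" "0 < \<eta>" using \<tau> n by (auto simp: l_def \<eta>_def)
  define a where "a i = t\<^sub>0 + real i * l" for i
  define D where "D i = {a i + \<eta>..a i + \<eta> + \<kappa> * \<eta>}" for i
  define J where "J = {i\<in>{..<2 * n}. \<forall>j\<in>{1..n}. t j \<notin> {t\<^sub>0 + real i * l<..<t\<^sub>0 + real i * l + l}}"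
  have J: "finite J" "n \<le> card J" unfolding J_def using card_cells_without_points[OF l(1)] by auto
  have a_ge: "t\<^sub>0 \<le> a i" for i using l by (simp add: a_def)
  have a_le: "a i + 2 * \<eta> \<le> t\<^sub>0 + \<tau>" if "i \<in> J" for i
  proof -
    have "(real i + 1) * l \<le> (2 * real n) * l" using that l by (intro mult_right_mono) (auto simp: J_def)
    also have "\<dots> = \<tau>" using n by (simp add: l_def)
    finally show ?thesis using l by (simp add: a_def algebra_simps)
  qed
  have \<kappa>\<eta>: "0 < \<kappa> * \<eta>" "\<kappa> * \<eta> \<le> \<eta>" using \<kappa> l by auto
  have Dsub: "D i \<subseteq> {0..T}" if "i \<in> J" for i
    using a_ge[of i] a_le[OF that] t0 \<tau> l \<kappa>\<eta> by (auto simp: D_def)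
  have Ddisj: "disjoint_family_on D J"
  proof -
    have less: "D i \<inter> D j = {}" if "i < j" for i j
    proof -
      have "(real i + 1) * l \<le> real j * l" using that l by (intro mult_right_mono) auto
      then have "a i + l \<le> a j" by (simp add: a_def algebra_simps)
      then show ?thesis using l \<kappa>\<eta> by (auto simp: D_def)
    qed
    show ?thesis unfolding disjoint_family_on_def
      by (metis less Int_commute linorder_neqE_nat)
  qed
  define G where "G \<omega> = g (\<lambda>i\<in>{1..n}. W (t i) \<omega>)" for \<omega>
  have obs: "(\<lambda>\<omega>. \<lambda>i\<in>{1..n}. W (t i) \<omega>) \<in> H \<rightarrow>\<^sub>M PiM {1..n} (\<lambda>_. borel)"
    if "\<And>r. r \<in> t ` {1..n} \<Longrightarrow> W r \<in> borel_measurable H" for H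
    by (rule measurable_restrict) (use that in auto)
  have Wt: "W r \<in> borel_measurable M" if "r \<in> t ` {1..n}" for r using t that by auto
  have GL: "G \<omega> \<in> L1_space T" if "\<omega> \<in> space M" for \<omega>
    using measurable_space[OF measurable_compose[OF obs[OF Wt] g] that]
    by (simp add: G_def L1_borel_def space_measure_of_conv)
  have Ym: "(\<lambda>\<omega>. (LINT s:D i|lborel. G \<omega> s) / (\<kappa> * \<eta>)) \<in> borel_measurable H"
    if i: "i \<in> J" and H: "\<And>r. r \<in> t ` {1..n} \<Longrightarrow> W r \<in> borel_measurable H" for i H
  proof -
    have "(\<lambda>\<omega>. LINT s:D i|lborel. G \<omega> s) \<in> borel_measurable H"
      unfolding G_def
      by (rule measurable_compose[OF measurable_compose[OF obs[OF H] g] interval_integral_L1_borel_measurable[OF _ Dsub[OF i]]])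
         (auto simp: D_def)
    then show ?thesis by simp
  qed
  define Q where "Q i \<omega> = \<bar>(LINT s:D i|lborel. X s \<omega>) / (\<kappa> * \<eta>) - (LINT s:D i|lborel. G \<omega> s) / (\<kappa> * \<eta>)\<bar>" for i \<omega>
  have Qm: "(\<lambda>\<omega>. ennreal (Q i \<omega>)) \<in> borel_measurable M" if i: "i \<in> J" for i
  proof -
    have "(\<lambda>\<omega>. LINT s:D i|lborel. X s \<omega>) \<in> borel_measurable M"
      unfolding D_def by (rule path_integral_measurable[OF X _ _ T]) (use Dsub[OF i] \<kappa>\<eta> in \<open>auto simp: D_def\<close>)
    with Ym[OF i Wt] show ?thesis unfolding Q_def by simp
  qed
  have cell: "ennreal (k * sqrt \<eta>) \<le> (\<integral>\<^sup>+\<omega>. ennreal (Q i \<omega>) \<partial>M)" if i: "i \<in> J" for i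
    unfolding Q_def D_def
  proof (rule loc[OF a_ge l(3) a_le[OF i], of "t ` {1..n}"])
    show "r \<notin> {a i<..<a i + 2 * \<eta>}" if "r \<in> t ` {1..n}" for r
      using i that l(2) by (auto simp: J_def a_def)
    show "(\<lambda>\<omega>. (LINT s:{a i + \<eta>..a i + \<eta> + \<kappa> * \<eta>}|lborel. G \<omega> s) / (\<kappa> * \<eta>)) \<in> borel_measurable H"
      if "\<And>r. r \<in> t ` {1..n} \<Longrightarrow> W r \<in> borel_measurable H" for H
      using Ym[OF i that] by (simp add: D_def)
  qed (use t in auto)
  have pt: "(\<Sum>i\<in>J. ennreal (\<kappa> * \<eta>) * ennreal (Q i \<omega>)) \<le> ennreal (L1_norm T (\<lambda>s. X s \<omega> - G \<omega> s))"
    if \<omega>: "\<omega> \<in> space M" for \<omega>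
  proof -
    have XL: "set_integrable lborel {0..T} (\<lambda>s. X s \<omega>)" by (rule path_set_integrable[OF X \<omega>]) auto
    have GL': "set_integrable lborel {0..T} (G \<omega>)" using GL[OF \<omega>] by (simp add: L1_space_def)
    have "(\<lambda>s. X s \<omega> - G \<omega> s) \<in> L1_space T" using XL GL' by (simp add: L1_space_def set_integral_diff)
    from sum_interval_integrals_le_L1_norm[OF this J(1) Ddisj _ Dsub]
    have "(\<Sum>i\<in>J. \<bar>LINT s:D i|lborel. X s \<omega> - G \<omega> s\<bar>) \<le> L1_norm T (\<lambda>s. X s \<omega> - G \<omega> s)" by (auto simp: D_def)
    moreover have "\<bar>LINT s:D i|lborel. X s \<omega> - G \<omega> s\<bar> = \<kappa> * \<eta> * Q i \<omega>" if i: "i \<in> J" for i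
    proof -
      have "set_integrable lborel (D i) (\<lambda>s. X s \<omega>)" "set_integrable lborel (D i) (G \<omega>)"
        using set_integrable_subset[OF XL _ Dsub[OF i]] set_integrable_subset[OF GL' _ Dsub[OF i]] by (auto simp: D_def)
      then have "(LINT s:D i|lborel. X s \<omega> - G \<omega> s) = (LINT s:D i|lborel. X s \<omega>) - (LINT s:D i|lborel. G \<omega> s)"
        by (rule set_integral_diff(2))
      also have "\<dots> = \<kappa> * \<eta> * ((LINT s:D i|lborel. X s \<omega>) / (\<kappa> * \<eta>) - (LINT s:D i|lborel. G \<omega> s) / (\<kappa> * \<eta>))"
      proof -
        have cancel: "x - y = w * (x / w - y / w)" if "0 < w" for w x y :: real
          using that by (simp add: right_diff_distrib)
        show ?thesis by (rule cancel[OF \<kappa>\<eta>(1)])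
      qed
      finally show ?thesis
        by (simp only: Q_def abs_mult[of "\<kappa> * \<eta>"] abs_of_pos[OF \<kappa>\<eta>(1)])
    qed
    ultimately have "(\<Sum>i\<in>J. \<kappa> * \<eta> * Q i \<omega>) \<le> L1_norm T (\<lambda>s. X s \<omega> - G \<omega> s)" by simp
    then have "ennreal (\<Sum>i\<in>J. \<kappa> * \<eta> * Q i \<omega>) \<le> ennreal (L1_norm T (\<lambda>s. X s \<omega> - G \<omega> s))" by (rule ennreal_leI)
    also have "ennreal (\<Sum>i\<in>J. \<kappa> * \<eta> * Q i \<omega>) = (\<Sum>i\<in>J. ennreal (\<kappa> * \<eta>) * ennreal (Q i \<omega>))"
      using \<kappa>\<eta>(1) by (subst sum_ennreal[symmetric]) (auto simp: ennreal_mult Q_def)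
    finally show ?thesis .
  qed
  have "\<kappa> * k * (\<tau> / 4) * sqrt (\<tau> / 4) / sqrt (real n) = real n * (\<kappa> * \<eta> * (k * sqrt \<eta>))"
  proof -
    have e: "\<eta> = \<tau> / 4 / real n" by (simp add: \<eta>_def l_def)
    have 1: "sqrt \<eta> = sqrt (\<tau> / 4) / sqrt (real n)" unfolding e by (rule real_sqrt_divide)
    have 2: "real n * \<eta> = \<tau> / 4" unfolding e using n by simp
    have 3: "real n * (\<kappa> * \<eta> * (k * sqrt \<eta>)) = \<kappa> * k * (real n * \<eta>) * sqrt \<eta>" by (simp only: mult_ac)
    show ?thesis unfolding 3 unfolding 2 1 by simp
  qed
  also have "ennreal \<dots> \<le> ennreal (real (card J) * (\<kappa> * \<eta> * (k * sqrt \<eta>)))"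
    using J(2) \<kappa>\<eta> k l by (intro ennreal_leI mult_right_mono) auto
  also have "\<dots> = (\<Sum>i\<in>J. ennreal (\<kappa> * \<eta>) * ennreal (k * sqrt \<eta>))"
    using \<kappa>\<eta> k l by (simp add: ennreal_mult ennreal_of_nat_eq_real_of_nat)
  also have "\<dots> \<le> (\<Sum>i\<in>J. ennreal (\<kappa> * \<eta>) * (\<integral>\<^sup>+\<omega>. ennreal (Q i \<omega>) \<partial>M))"
    by (intro sum_mono mult_left_mono cell) auto
  also have "\<dots> = (\<integral>\<^sup>+\<omega>. (\<Sum>i\<in>J. ennreal (\<kappa> * \<eta>) * ennreal (Q i \<omega>)) \<partial>M)"
    using Qm by (subst nn_integral_sum) (auto intro!: sum.cong simp: nn_integral_cmult)
  also have "\<dots> \<le> (\<integral>\<^sup>+ \<omega>. ennreal (L1_norm T (\<lambda>s. X s \<omega> - G \<omega> s)) \<partial>M)"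
    by (intro nn_integral_mono pt)
  finally show ?thesis unfolding G_def .
qed

end

theorem theorem3:
  fixes M :: "'a measure" and F :: "real \<Rightarrow> 'a measure"
    and W X :: "real \<Rightarrow> 'a \<Rightarrow> real" and \<mu> \<sigma> :: "real \<Rightarrow> real" and T :: real
  assumes "usual_filtered_prob_space M F"
    and "brownian_motion M F W"
    and "T > 0"
    and "\<mu> \<in> borel_measurable borel" and "\<sigma> \<in> borel_measurable borel"
    and "sde_solution M F W T \<mu> \<sigma> X"
    and "\<exists>t\<^sub>0\<in>{0..<T}. \<exists>T\<^sub>0\<in>{t\<^sub>0<..T}. \<exists>\<delta>>0. \<exists>\<xi>::real.
           measure M {\<omega>\<in>space M. X t\<^sub>0 \<omega> \<in> ball \<xi> \<delta>} > 0 \<and>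
           bounded (\<mu> ` {\<xi> - \<delta>..\<xi> + \<delta>}) \<and>
           (\<exists>L. L-lipschitz_on {\<xi> - \<delta>..\<xi> + \<delta>} \<sigma>) \<and>
           (INF x\<in>ball \<xi> \<delta>. \<bar>\<sigma> x\<bar>) > 0"
  shows "\<exists>c>0. \<forall>n\<ge>1.
           (INF (t, g)\<in>({1..n::nat} \<rightarrow>\<^sub>E {0..T}) \<times> (PiM {1..n} (\<lambda>_. borel) \<rightarrow>\<^sub>M L1_borel T).
              \<integral>\<^sup>+ \<omega>. ennreal (L1_norm T (\<lambda>s. X s \<omega> - g (\<lambda>i\<in>{1..n}. W (t i) \<omega>) s)) \<partial>M)
           \<ge> ennreal (c / real n powr (1/2))"
proof -
  interpret brownian_filtration M F W
    using assms(1,2) by (simp add: brownian_filtration_def brownian_filtration_axioms_def)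
  obtain t\<^sub>0 \<delta> \<xi> L where t0: "0 \<le> t\<^sub>0" "t\<^sub>0 < T" and \<delta>: "0 < \<delta>"
    and reach: "prob {\<omega>\<in>space M. X t\<^sub>0 \<omega> \<in> ball \<xi> \<delta>} > 0"
    and reg: "bounded (\<mu> ` {\<xi> - \<delta>..\<xi> + \<delta>})" "L-lipschitz_on {\<xi> - \<delta>..\<xi> + \<delta>} \<sigma>"
    and nondeg: "(INF x\<in>ball \<xi> \<delta>. \<bar>\<sigma> x\<bar>) > 0"
    using assms(7) by force
  obtain I where X: "continuous_adapted M F T X" and ito: "is_ito_integral M F W T (\<lambda>s \<omega>. \<sigma> (X s \<omega>)) I"
    and \<mu>i: "AE \<omega> in M. set_integrable lborel {0..T} (\<lambda>s. \<mu> (X s \<omega>))"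
    and sde: "\<forall>t\<in>{0..T}. AE \<omega> in M. X t \<omega> = X 0 \<omega> + (LINT s:{0..t}|lborel. \<mu> (X s \<omega>)) + I t \<omega>"
    using assms(6) by (auto simp: sde_solution_def)
  show ?thesis
  proof (rule local_lower_bound[OF X ito \<mu>i sde assms(5) t0 \<delta> reach reg nondeg])
    fix \<tau> \<kappa> k :: real
    assume \<tau>: "0 < \<tau>" "t\<^sub>0 + \<tau> \<le> T" and \<kappa>: "0 < \<kappa>" "\<kappa> \<le> 1" and k: "0 < k"
      and loc: "\<And>a \<eta> R Y. t\<^sub>0 \<le> a \<Longrightarrow> 0 < \<eta> \<Longrightarrow> a + 2 * \<eta> \<le> t\<^sub>0 + \<tau> \<Longrightarrow> finite R \<Longrightarrow> (\<And>r. r \<in> R \<Longrightarrow> 0 \<le> r) \<Longrightarrow>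
       (\<And>r. r \<in> R \<Longrightarrow> r \<notin> {a<..<a + 2 * \<eta>}) \<Longrightarrow>
       (\<And>H. subalgebra M H \<Longrightarrow> (\<And>r. r \<in> R \<Longrightarrow> W r \<in> borel_measurable H) \<Longrightarrow> Y \<in> borel_measurable H) \<Longrightarrow>
       ennreal (k * sqrt \<eta>) \<le> (\<integral>\<^sup>+\<omega>. ennreal \<bar>(LINT r:{a + \<eta>..a + \<eta> + \<kappa> * \<eta>}|lborel. X r \<omega>) / (\<kappa> * \<eta>) - Y \<omega>\<bar> \<partial>M)"
    define c where "c = \<kappa> * k * (\<tau> / 4) * sqrt (\<tau> / 4)"
    have "0 < c" using \<tau> \<kappa> k by (simp add: c_def)
    moreover have "ennreal (c / real n powr (1/2)) \<le> (\<integral>\<^sup>+ \<omega>. ennreal (L1_norm T (\<lambda>s. X s \<omega> - g (\<lambda>i\<in>{1..n}. W (t i) \<omega>) s)) \<partial>M)"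
      if "1 \<le> n" "t \<in> {1..n} \<rightarrow>\<^sub>E {0..T}" "g \<in> PiM {1..n} (\<lambda>_. borel) \<rightarrow>\<^sub>M L1_borel T" for n t g
      unfolding c_def powr_half_sqrt[OF of_nat_0_le_iff]
      by (rule L1_lower_bound[OF X t0(1) \<tau> \<kappa> k loc that(1) _ that(3)]) (use that(2) in auto)
    ultimately show ?thesis
      by (intro exI[of _ c] conjI allI impI INF_greatest) auto
  qed
qed

end
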